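(* Let $\Psi^{*}\in\mathcal{T}\mathcal{U}\mathcal{S}$. Then there is a dual geometric Gibbs type measure $\mu^{*}$ for the continuous potential $-\log\Psi^{*}$. It is a $g$-measure for the $g$-function $1/\Psi^{*}$, and the pressure satisfies $P(-\log\Psi^{*})=0$. Moreover, the Radon–Nikodým derivative satisfies $$D_{\mu^{*}}(w^{*})=\frac{1}{\Psi^{*}(w^{*})}\quad\text{for }\tilde\mu^{*}\text{-a.e. }w^{*}.$$ Furthermore, $\mu^{*}$ is an equilibrium state for the continuous potential $-\log\Psi^{*}$ in the sense that $$0=P(-\log\Psi^{*})=h_{\mu^{*}}(\sigma^{*})-\int_{\Sigma^{*}}\log\Psi^{*}\,d\mu^{*}=\sup_{\nu}\Big\{h_{\nu}(\sigma^{*})-\int_{\Sigma^{*}}\log\Psi^{*}\,d\nu\Big\},$$ where $\nu$ runs over all $\sigma^{*}$-invariant probability measures.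
   Context: $T$ is the unit circle. A circle endomorphism is an orientation-preserving covering map $f:T\to T$ of degree $d\ge2$ with $f(1)=1$; its lift is the homeomorphism $F:\mathbb{R}\to\mathbb{R}$ with $F(0)=0$, $F(x+1)=F(x)+d$ and $e^{2\pi i F(x)}=f(e^{2\pi i x})$. $f$ is uniformly symmetric if there is a bounded function $\varepsilon(t)>0$, $t>0$, with $\varepsilon(t)\to0$ as $t\to0^{+}$ and $$\frac{1}{1+\varepsilon(t)}\le\frac{|F^{-n}(x+t)-F^{-n}(x)|}{|F^{-n}(x)-F^{-n}(x-t)|}\le 1+\varepsilon(t)\quad\text{for all }x\in\mathbb{R},\ t>0,\ n>0.$$ Fix $d\ge2$; $\mathcal{U}\mathcal{S}$ is the set of uniformly symmetric circle endomorphisms of degree $d$. $\Sigma^{*}$ is the space of left-infinite sequences $w^{*}=\cdots j_{n-1}\cdots j_1j_0$ over $\{0,\dots,d-1\}$ with the product topology; $[w_n^{*}]$ with $w_n^{*}=j_{n-1}\cdots j_0$ is the right cylinder of sequences ending in $j_{n-1}\cdots j_0$; the right shift is $\sigma^{*}(\cdots j_1j_0)=\cdots j_2j_1$. Dual derivative: for a word $w_n=i_0\cdots i_{n-1}$ let $I_{w_n}=F^{-n}([m,m+1])\subset[0,1]$, $m=i_{n-1}+i_{n-2}d+\cdots+i_0d^{n-1}$. Then $D^{*}(f)(w^{*})=\lim_{n\to\infty}|I_{v_{n-1}}|/|I_{w_n}|$, with $w_n=j_{n-1}\cdots j_1j_0$, $v_{n-1}=j_{n-1}\cdots j_1$ read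 left to right as words; for $f\in\mathcal{U}\mathcal{S}$ the limit exists and is a positive continuous function. Here $\mathcal{T}\mathcal{U}\mathcal{S}$ is identified with the set of functions $\{D^{*}(f): f\in\mathcal{U}\mathcal{S}\}$ on $\Sigma^{*}$. For a positive continuous function $\Psi^{*}$ on $\Sigma^{*}$, a non-atomic probability measure $\mu^{*}$ with support the whole $\Sigma^{*}$ is a dual geometric Gibbs type measure for the potential $-\log\Psi^{*}$ if $$\frac{d\sigma^{*}}{dw^{*}}(w^{*}):=\lim_{n\to\infty}\frac{\mu^{*}(\sigma^{*}([w_n^{*}]))}{\mu^{*}([w_n^{*}])}=\Psi^{*}(w^{*})\quad\text{for all }w^{*}=\cdots w_n^{*}\in\Sigma^{*}.$$ A non-negative continuous function $\psi$ on $\Sigma^{*}$ is a $g$-function if $\sum_{\sigma^{*}(y)=x}\psi(y)=1$ for all $x$. For continuous $\psi$, $\mathcal{L}_\psi\phi(x)=\sum_{\sigma^{*}(y)=x}\phi(y)\psi(y)$ on continuous functions, with dual operator $\mathcal{L}_\psi^{*}$ on finite Borel measures. A probability measure $\mu$ is a $g$-measure for the $g$-function $\psi$ if $\mathcal{L}_\psi^{*}\mu=\mu$ (such $\mu$ is $\sigma^{*}$-invariant). For a probability measure $\mu^{*}$ put $\tilde\mu^{*}=\mathcal{L}_1^{*}\mu^{*}$; if $\mu^{*}$ is $\sigma^{*}$-invariant it is absolutely continuous with respect to $\tilde\mu^{*}$ and $D_{\mu^{*}}=d\mu^{*}/d\tilde\mu^{*}$. $P$ denotes topological pressure on $(\Sigma^{*},\sigma^{*})$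 and $h_\nu(\sigma^{*})$ measure-theoretic entropy. *)

theory Defs
  imports "HOL-Probability.Probability"
begin

definition circle_lift :: "nat \<Rightarrow> (complex \<Rightarrow> complex) \<Rightarrow> (real \<Rightarrow> real) \<Rightarrow> bool" where
  "circle_lift d f F \<longleftrightarrow>
     (\<exists>G. homeomorphism UNIV UNIV F G) \<and> F 0 = 0 \<and>
     (\<forall>x. F (x + 1) = F x + real d) \<and>
     (\<forall>x. cis (2 * pi * F x) = f (cis (2 * pi * x)))"

text \<open>Degree and orientation are expressed through the lift: the degree is the increment of the
  lift over a period, and the map preserves orientation iff the lift is increasing.\<close>

definition circle_endomorphism :: "nat \<Rightarrow> (complex \<Rightarrow> complex) \<Rightarrow> bool" where
  "circle_endomorphism d f \<longleftrightarrow>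
     2 \<le> d \<and> covering_space (sphere 0 1) f (sphere 0 1) \<and> f 1 = 1 \<and>
     (\<exists>F. circle_lift d f F \<and> strict_mono F)"

definition lift_of :: "nat \<Rightarrow> (complex \<Rightarrow> complex) \<Rightarrow> real \<Rightarrow> real" where
  "lift_of d f = (THE F. circle_lift d f F)"

lemma circle_lift_unique:
  assumes "circle_lift d f F" "circle_lift d f G"
  shows "F = G"
proof -
  have cont: "continuous_on UNIV (\<lambda>x. F x - G x)"
    using assms by (auto simp: circle_lift_def homeomorphism_def intro!: continuous_intros)
  have int: "F x - G x \<in> \<int>" for x
  proof -
    have "cis (2 * pi * F x) = cis (2 * pi * G x)"
      using assms by (simp add: circle_lift_def)
    then have "cis (2 * pi * (F x - G x)) = 1"
      by (simp add: right_diff_distrib cis_divide [symmetric])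
    then have "cos (2 * pi * (F x - G x)) = 1"
      by (metis cis.simps(1) one_complex.simps(1))
    then obtain n :: int where "2 * pi * (F x - G x) = of_int n * 2 * pi"
      by (auto simp: cos_one_2pi_int)
    then have "F x - G x = of_int n" by simp
    then show ?thesis by simp
  qed
  have "(\<lambda>x. F x - G x) constant_on UNIV"
  proof (rule continuous_discrete_range_constant [OF connected_UNIV cont])
    fix x
    show "\<exists>e>0. \<forall>y. y \<in> UNIV \<and> F y - G y \<noteq> F x - G x \<longrightarrow> e \<le> norm (F y - G y - (F x - G x))"
      using int by (intro exI [of _ 1]) (auto intro!: Ints_nonzero_abs_ge1)
  qed
  moreover have "F 0 - G 0 = 0"
    using assms by (simp add: circle_lift_def)
  ultimately have "F x - G x = 0" for x
    unfolding constant_on_def by (metis UNIV_I)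
  then show ?thesis by (simp add: fun_eq_iff)
qed

definition uniformly_symmetric :: "nat \<Rightarrow> (complex \<Rightarrow> complex) \<Rightarrow> bool" where
  "uniformly_symmetric d f \<longleftrightarrow>
     circle_endomorphism d f \<and>
     (let G = inv (lift_of d f) in
      \<exists>\<epsilon> :: real \<Rightarrow> real.
        (\<forall>t>0. 0 < \<epsilon> t) \<and> bounded (\<epsilon> ` {0<..}) \<and> (\<epsilon> \<longlongrightarrow> 0) (at_right 0) \<and>
        (\<forall>x. \<forall>t>0. \<forall>n>0.
           1 / (1 + \<epsilon> t) \<le> \<bar>(G ^^ n) (x + t) - (G ^^ n) x\<bar> / \<bar>(G ^^ n) x - (G ^^ n) (x - t)\<bar> \<and>
           \<bar>(G ^^ n) (x + t) - (G ^^ n) x\<bar> / \<bar>(G ^^ n) x - (G ^^ n) (x - t)\<bar> \<le> 1 + \<epsilon> t))"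

text \<open>A left-infinite sequence \<open>\<dots> j\<^sub>2 j\<^sub>1 j\<^sub>0\<close> is the function \<open>k \<mapsto> j\<^sub>k\<close>. The type \<open>nat \<Rightarrow> nat\<close>
  carries the product topology of the discrete topology on \<open>nat\<close>.\<close>

definition dual_space :: "nat \<Rightarrow> (nat \<Rightarrow> nat) set" where
  "dual_space d = {w. \<forall>k. w k < d}"

definition right_shift :: "(nat \<Rightarrow> nat) \<Rightarrow> nat \<Rightarrow> nat" where
  "right_shift w = (\<lambda>k. w (Suc k))"

definition right_cylinder :: "nat \<Rightarrow> (nat \<Rightarrow> nat) \<Rightarrow> nat \<Rightarrow> (nat \<Rightarrow> nat) set" where
  "right_cylinder d w n = {v \<in> dual_space d. \<forall>k<n. v k = w k}"

definition dual_borel :: "nat \<Rightarrow> (nat \<Rightarrow> nat) measure" where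
  "dual_borel d = restrict_space borel (dual_space d)"

definition dual_prob :: "nat \<Rightarrow> (nat \<Rightarrow> nat) measure \<Rightarrow> bool" where
  "dual_prob d \<mu> \<longleftrightarrow> prob_space \<mu> \<and> sets \<mu> = sets (dual_borel d)"

definition invariant_prob :: "nat \<Rightarrow> (nat \<Rightarrow> nat) measure \<Rightarrow> bool" where
  "invariant_prob d \<mu> \<longleftrightarrow> dual_prob d \<mu> \<and> distr \<mu> \<mu> right_shift = \<mu>"

text \<open>Finite words \<open>i\<^sub>0 \<dots> i\<^sub>n\<^sub>-\<^sub>1\<close> are lists, read left to right.\<close>

definition word_value :: "nat \<Rightarrow> nat list \<Rightarrow> nat" where
  "word_value d u = (\<Sum>k<length u. u ! k * d ^ (length u - 1 - k))"

definition word_interval :: "nat \<Rightarrow> (complex \<Rightarrow> complex) \<Rightarrow> nat list \<Rightarrow> real set" where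
  "word_interval d f u =
     (inv (lift_of d f) ^^ length u) ` {real (word_value d u) .. real (word_value d u) + 1}"

text \<open>The words \<open>j\<^sub>n\<^sub>-\<^sub>1 \<dots> j\<^sub>1 j\<^sub>0\<close> and \<open>j\<^sub>n\<^sub>-\<^sub>1 \<dots> j\<^sub>1\<close> list decreasing indices.\<close>

definition dual_derivative :: "nat \<Rightarrow> (complex \<Rightarrow> complex) \<Rightarrow> (nat \<Rightarrow> nat) \<Rightarrow> real" where
  "dual_derivative d f w =
     lim (\<lambda>n. measure lborel (word_interval d f (map w (rev [1..<n]))) /
              measure lborel (word_interval d f (map w (rev [0..<n]))))"

text \<open>Only values on the dual symbolic space matter, so its elements are not constrained outside.\<close>

definition TUS :: "nat \<Rightarrow> ((nat \<Rightarrow> nat) \<Rightarrow> real) set" where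
  "TUS d = {\<Psi>. \<exists>f. uniformly_symmetric d f \<and> (\<forall>w\<in>dual_space d. \<Psi> w = dual_derivative d f w)}"

definition non_atomic :: "'a measure \<Rightarrow> bool" where
  "non_atomic M \<longleftrightarrow>
     (\<forall>A\<in>sets M. 0 < emeasure M A \<longrightarrow>
        (\<exists>B\<in>sets M. B \<subseteq> A \<and> 0 < emeasure M B \<and> emeasure M B < emeasure M A))"

definition dual_support :: "nat \<Rightarrow> (nat \<Rightarrow> nat) measure \<Rightarrow> (nat \<Rightarrow> nat) set" where
  "dual_support d \<mu> =
     {w \<in> dual_space d. \<forall>U. open U \<and> w \<in> U \<longrightarrow> 0 < emeasure \<mu> (U \<inter> dual_space d)}"

text \<open>The potential is \<open>- log \<Psi>\<close>; the predicate takes \<open>\<Psi>\<close> itself.\<close>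

definition dual_gibbs_type :: "nat \<Rightarrow> ((nat \<Rightarrow> nat) \<Rightarrow> real) \<Rightarrow> (nat \<Rightarrow> nat) measure \<Rightarrow> bool" where
  "dual_gibbs_type d \<Psi> \<mu> \<longleftrightarrow>
     continuous_on (dual_space d) \<Psi> \<and> (\<forall>w\<in>dual_space d. 0 < \<Psi> w) \<and>
     dual_prob d \<mu> \<and> non_atomic \<mu> \<and> dual_support d \<mu> = dual_space d \<and>
     (\<forall>w\<in>dual_space d.
        (\<lambda>n. measure \<mu> (right_shift ` right_cylinder d w n) / measure \<mu> (right_cylinder d w n))
          \<longlonglongrightarrow> \<Psi> w)"

definition transfer_op ::
  "nat \<Rightarrow> ((nat \<Rightarrow> nat) \<Rightarrow> real) \<Rightarrow> ((nat \<Rightarrow> nat) \<Rightarrow> real) \<Rightarrow> (nat \<Rightarrow> nat) \<Rightarrow> real" where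
  "transfer_op d \<psi> \<phi> x = (\<Sum>y | y \<in> dual_space d \<and> right_shift y = x. \<phi> y * \<psi> y)"

text \<open>The image of \<open>\<mu>\<close> under the dual operator, as the measure representing the functional
  \<open>\<phi> \<mapsto> \<integral> L\<^sub>\<psi> \<phi> d\<mu>\<close> on continuous functions. It is a (positive) measure only for non-negative
  \<open>\<psi>\<close>, the only case used.\<close>

definition transfer_dual ::
  "nat \<Rightarrow> ((nat \<Rightarrow> nat) \<Rightarrow> real) \<Rightarrow> (nat \<Rightarrow> nat) measure \<Rightarrow> (nat \<Rightarrow> nat) measure" where
  "transfer_dual d \<psi> \<mu> =
     (THE \<nu>. finite_measure \<nu> \<and> sets \<nu> = sets (dual_borel d) \<and>
        (\<forall>\<phi>. continuous_on (dual_space d) \<phi> \<longrightarrow>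
           integral\<^sup>L \<nu> \<phi> = integral\<^sup>L \<mu> (transfer_op d \<psi> \<phi>)))"

definition g_function :: "nat \<Rightarrow> ((nat \<Rightarrow> nat) \<Rightarrow> real) \<Rightarrow> bool" where
  "g_function d \<psi> \<longleftrightarrow>
     continuous_on (dual_space d) \<psi> \<and> (\<forall>w\<in>dual_space d. 0 \<le> \<psi> w) \<and>
     (\<forall>x\<in>dual_space d. (\<Sum>y | y \<in> dual_space d \<and> right_shift y = x. \<psi> y) = 1)"

definition g_measure :: "nat \<Rightarrow> ((nat \<Rightarrow> nat) \<Rightarrow> real) \<Rightarrow> (nat \<Rightarrow> nat) measure \<Rightarrow> bool" where
  "g_measure d \<psi> \<mu> \<longleftrightarrow> g_function d \<psi> \<and> dual_prob d \<mu> \<and> transfer_dual d \<psi> \<mu> = \<mu>"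

definition separated :: "('a \<Rightarrow> 'a \<Rightarrow> real) \<Rightarrow> ('a \<Rightarrow> 'a) \<Rightarrow> nat \<Rightarrow> real \<Rightarrow> 'a set \<Rightarrow> bool" where
  "separated D T n \<epsilon> E \<longleftrightarrow>
     (\<forall>x\<in>E. \<forall>y\<in>E. x \<noteq> y \<longrightarrow> (\<exists>i<n. \<epsilon> < D ((T ^^ i) x) ((T ^^ i) y)))"

text \<open>Bowen's definition by separated sets, for a continuous self-map \<open>T\<close> of a space \<open>X\<close> that is
  compact for the metric \<open>D\<close>. The logarithm is taken inside the supremum so that the supremum is
  formed in the complete lattice \<open>ereal\<close>; the empty set is excluded because \<open>ln 0 = 0\<close> here.\<close>

definition pressure ::
  "'a set \<Rightarrow> ('a \<Rightarrow> 'a \<Rightarrow> real) \<Rightarrow> ('a \<Rightarrow> 'a) \<Rightarrow> ('a \<Rightarrow> real) \<Rightarrow> ereal" where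
  "pressure X D T \<phi> =
     Lim (at_right (0::real)) (\<lambda>\<epsilon>. limsup (\<lambda>n.
       SUP E\<in>{E. finite E \<and> E \<noteq> {} \<and> E \<subseteq> X \<and> separated D T n \<epsilon> E}.
         ereal (ln (\<Sum>x\<in>E. exp (\<Sum>i<n. \<phi> ((T ^^ i) x))) / real n)))"

text \<open>On a compact space the pressure does not depend on the metric chosen for the topology; this is
  the usual one on sequences, and it induces the product topology.\<close>

definition seq_dist :: "(nat \<Rightarrow> nat) \<Rightarrow> (nat \<Rightarrow> nat) \<Rightarrow> real" where
  "seq_dist w v = (if w = v then 0 else (1/2) ^ (LEAST k. w k \<noteq> v k))"

lemma seq_dist_less_iff: "seq_dist w v < (1/2) ^ n \<longleftrightarrow> (\<forall>k\<le>n. w k = v k)"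
proof (cases "w = v")
  case False
  define m where "m = (LEAST k. w k \<noteq> v k)"
  from False have ex: "\<exists>k. w k \<noteq> v k" by auto
  then have m: "w m \<noteq> v m" unfolding m_def by (rule LeastI_ex)
  have least: "w k = v k" if "k < m" for k
    using not_less_Least that unfolding m_def by blast
  have "seq_dist w v < (1/2) ^ n \<longleftrightarrow> n < m"
    using False by (simp add: seq_dist_def m_def [symmetric] power_strict_decreasing_iff)
  also have "\<dots> \<longleftrightarrow> (\<forall>k\<le>n. w k = v k)"
    using m least by (meson le_less_trans not_less)
  finally show ?thesis .
qed (simp add: seq_dist_def)

lemma Metric_space_seq_dist: "Metric_space UNIV seq_dist"
proof
  show "0 \<le> seq_dist x y" for x y by (simp add: seq_dist_def)
  show "seq_dist x y = seq_dist y x" for x y by (auto simp: seq_dist_def eq_commute)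
  show "seq_dist x y = 0 \<longleftrightarrow> x = y" for x y by (simp add: seq_dist_def)
  show "seq_dist x z \<le> seq_dist x y + seq_dist y z" for x y z
  proof (cases "x = z")
    case False
    define m where "m = (LEAST k. x k \<noteq> z k)"
    from False have "\<exists>k. x k \<noteq> z k" by auto
    then have "x m \<noteq> z m" unfolding m_def by (rule LeastI_ex)
    then have "\<not> seq_dist x y < (1/2) ^ m \<or> \<not> seq_dist y z < (1/2) ^ m"
      by (auto simp: seq_dist_less_iff)
    moreover have "seq_dist x z = (1/2) ^ m" using False by (simp add: seq_dist_def m_def)
    moreover have "0 \<le> seq_dist x y" "0 \<le> seq_dist y z" by (simp_all add: seq_dist_def)
    ultimately show ?thesis by linarith
  qed (simp add: seq_dist_def)
qed

lemma mtopology_seq_dist: "Metric_space.mtopology UNIV seq_dist = euclidean"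
proof -
  interpret Metric_space UNIV seq_dist by (rule Metric_space_seq_dist)
  have "openin mtopology U \<longleftrightarrow> open U" for U
  proof
    assume L: "openin mtopology U"
    show "open U"
    proof (subst open_subopen, intro ballI)
      fix x assume "x \<in> U"
      with L obtain r where r: "0 < r" "mball x r \<subseteq> U"
        unfolding openin_mtopology by blast
      obtain n where n: "(1/2) ^ n < r"
        using real_arch_pow_inv [of r "1/2"] r by auto
      define C where "C = (\<Inter>k\<le>n. (\<lambda>v. v k) -` {x k})"
      have "open C" unfolding C_def
        by (intro open_INT ballI open_vimage) (auto intro: Topological_Spaces.open_discrete)
      moreover have "C \<subseteq> U"
      proof
        fix v assume "v \<in> C"
        then have "seq_dist x v < (1/2) ^ n" by (auto simp: seq_dist_less_iff C_def)
        with n r show "v \<in> U" by (auto simp: subset_iff)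
      qed
      ultimately show "\<exists>T. open T \<and> x \<in> T \<and> T \<subseteq> U" by (intro exI [of _ C]) (auto simp: C_def)
    qed
  next
    assume R: "open U"
    show "openin mtopology U"
      unfolding openin_mtopology
    proof (intro conjI allI impI)
      fix x assume "x \<in> U"
      with R obtain X where X: "x \<in> Pi\<^sub>E UNIV X" "finite {i. X i \<noteq> UNIV}" "Pi\<^sub>E UNIV X \<subseteq> U"
        using product_topology_open_contains_basis [of "\<lambda>_. euclidean" UNIV U x]
        by (auto simp: open_fun_def)
      obtain n where n: "\<forall>i\<in>{i. X i \<noteq> UNIV}. i \<le> n"
        using X(2) finite_nat_set_iff_bounded_le by blast
      have "mball x ((1/2) ^ n) \<subseteq> U"
      proof
        fix v assume "v \<in> mball x ((1/2) ^ n)"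
        then have eq: "\<forall>k\<le>n. x k = v k" by (simp add: seq_dist_less_iff)
        have "v i \<in> X i" for i
        proof (cases "X i = UNIV")
          case False
          then have "x i = v i" using n eq by auto
          moreover have "x i \<in> X i" using X(1) by (auto simp: PiE_iff)
          ultimately show ?thesis by simp
        qed simp
        then show "v \<in> U" using X(3) by (auto simp: PiE_iff)
      qed
      then show "\<exists>r>0. mball x r \<subseteq> U" by (intro exI [of _ "(1/2) ^ n"]) simp
    qed simp
  qed
  then show ?thesis by (simp add: topology_eq)
qed

definition finite_partition :: "'a measure \<Rightarrow> 'a set set \<Rightarrow> bool" where
  "finite_partition M P \<longleftrightarrow> finite P \<and> P \<subseteq> sets M \<and> disjoint P \<and> \<Union>P = space M"

definition partition_entropy :: "'a measure \<Rightarrow> 'a set set \<Rightarrow> real" where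
  "partition_entropy M P = - (\<Sum>A\<in>P. measure M A * ln (measure M A))"

definition iterated_join :: "'a measure \<Rightarrow> ('a \<Rightarrow> 'a) \<Rightarrow> 'a set set \<Rightarrow> nat \<Rightarrow> 'a set set" where
  "iterated_join M T P n =
     {space M \<inter> (\<Inter>i<n. (T ^^ i) -` A i) | A. \<forall>i<n. A i \<in> P}"

definition measure_entropy :: "'a measure \<Rightarrow> ('a \<Rightarrow> 'a) \<Rightarrow> ereal" where
  "measure_entropy M T =
     (SUP P\<in>{P. finite_partition M P}.
        lim (\<lambda>n. ereal (partition_entropy M (iterated_join M T P n) / real n)))"

end

theory Submission
  imports Defs
begin

text \<open>
  The intervals of level \<open>n + 1\<close> subdivide those of level \<open>n\<close>, and uniform symmetry says that inverse
  branches almost preserve ratios of lengths at small scales. Hence the relative lengths \<open>\<rho>\<^sub>n\<close> of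
  an interval in its parent converge uniformly on the dual symbolic space, to a continuous positive
  function \<open>g = 1 / \<Psi>\<close> whose sum over the preimages of any point is one. Everything else holds for
  an arbitrary function \<open>g\<close> of this kind.

  A g-measure \<open>\<mu>\<close> is a limit of Cesaro means of the measures dual to the iterates of the transfer
  operator, applied to a point mass. The identity \<open>\<mu>[w\<^sub>n] = \<integral> g(j\<^sub>0 x) d\<mu>(x)\<close> over \<open>\<sigma>\<^sup>*[w\<^sub>n]\<close> and continuity
  of \<open>g\<close> give the Gibbs property. Since \<open>g\<close> is continuous, its Birkhoff products \<open>g\<^sub>n\<close> vary by at most
  \<open>exp (\<delta> n)\<close>, up to a constant, on cylinders of length \<open>n\<close>; as their sums over the fibres of the \<open>n\<close>-th
  iterate are one, the pressure vanishes and \<open>\<mu>[w\<^sub>n]\<close> is comparable with \<open>g\<^sub>n\<close>, which gives the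
  entropy of \<open>\<mu>\<close>. The upper bound for the entropy of an arbitrary invariant measure is Gibbs'
  inequality for suitable weights on the names of a partition.
\<close>

subsection \<open>The dual symbolic space\<close>

text \<open>Mere continuity of \<open>g\<close> shapes the argument: without control of its modulus
  there is no bounded distortion, hence neither uniform Gibbs constants nor uniqueness to rely on.
  The loss exp (\<delta> n) is harmless wherever a logarithm is divided by n and \<delta> tends to
  0, and the Gibbs property compares only one step of the shift at a time. Convergence of the ratios
  \<open>rho n\<close> rests on uniformity: a single modulus \<epsilon> controls all iterates of the
  inverse lift at once. The measure comes from a finitely additive set function on the algebra of
  clopen sets, where compactness supplies countable additivity. Entropy is a supremum over all
  finite measurable partitions. The lower bound may pick the partition by one digit, but the upper
  bound has to face an arbitrary partition, unrelated to cylinders. That partition is approximated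
  by clopen sets, and the rare points misread by the approximation are paid for by giving every
  wrong letter a small positive weight.\<close>

text \<open>Replaces the metric throughout: the dual space is compact, so continuity and clopenness
  are uniform and amount to a number m of digits that decides.\<close>

definition agree :: "nat \<Rightarrow> (nat \<Rightarrow> nat) \<Rightarrow> (nat \<Rightarrow> nat) \<Rightarrow> bool" where
  "agree m x y \<longleftrightarrow> (\<forall>k<m. x k = y k)"

text \<open>Sets decided by finitely many digits. They form an algebra that generates the Borel
  sets, and their indicators are continuous.\<close>

definition dual_clopen :: "nat \<Rightarrow> (nat \<Rightarrow> nat) set set" where
  "dual_clopen d = {A. A \<subseteq> dual_space d \<and>
     (\<exists>m. \<forall>x\<in>dual_space d. \<forall>y\<in>dual_space d. agree m x y \<longrightarrow> x \<in> A \<longrightarrow> y \<in> A)}"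

definition pad :: "nat \<Rightarrow> (nat \<Rightarrow> nat) \<Rightarrow> nat \<Rightarrow> nat" where
  "pad n x = (\<lambda>k. if k < n then x k else 0)"

text \<open>The preimage of the zero sequence under the n-th iterate of the shift. It is also a
  system of representatives of the cylinders of length n, with \<open>pad n\<close> choosing the
  representative.\<close>

definition fibre :: "nat \<Rightarrow> nat \<Rightarrow> (nat \<Rightarrow> nat) set" where
  "fibre d n = {y \<in> dual_space d. \<forall>k\<ge>n. y k = 0}"

text \<open>The inverse branches of the shift: position 0 is the right end of a left-infinite
  sequence, so \<open>case_nat i x\<close> appends the digit i on the right.\<close>

abbreviation cons_seq :: "nat \<Rightarrow> (nat \<Rightarrow> nat) \<Rightarrow> nat \<Rightarrow> nat" where
  "cons_seq \<equiv> case_nat"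

lemma agree_refl [simp]: "agree m x x" by (simp add: agree_def)

lemma agree_sym: "agree m x y \<Longrightarrow> agree m y x" by (simp add: agree_def)

lemma agree_trans: "agree m x y \<Longrightarrow> agree m y z \<Longrightarrow> agree m x z" by (simp add: agree_def)

lemma agree_mono: "agree m x y \<Longrightarrow> k \<le> m \<Longrightarrow> agree k x y" by (simp add: agree_def)

lemma agree_pad [simp]: "agree m x (pad m x)" by (simp add: agree_def pad_def)

lemma pad_eq_iff: "pad m x = pad m y \<longleftrightarrow> agree m x y"
  by (auto simp: agree_def pad_def fun_eq_iff)

lemma pad_fibre [simp]: "y \<in> fibre d m \<Longrightarrow> pad m y = y"
  by (auto simp: pad_def fibre_def fun_eq_iff)

lemma pad_eq_fibre_iff: "y \<in> fibre d m \<Longrightarrow> pad m x = y \<longleftrightarrow> agree m x y"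
  using pad_eq_iff[of m x y] by simp

lemma pad_in_fibre: "x \<in> dual_space d \<Longrightarrow> pad n x \<in> fibre d n"
  by (auto simp: pad_def fibre_def dual_space_def intro: le_less_trans[OF le0])

lemma fibre_subset: "fibre d n \<subseteq> dual_space d" by (auto simp: fibre_def)

lemma pad_in_dual: "x \<in> dual_space d \<Longrightarrow> pad n x \<in> dual_space d"
  using pad_in_fibre fibre_subset by blast

lemma funpow_right_shift: "(right_shift ^^ n) x = (\<lambda>k. x (k + n))"
  by (induction n) (simp_all add: right_shift_def fun_eq_iff)

lemma right_shift_dual [simp]: "x \<in> dual_space d \<Longrightarrow> right_shift x \<in> dual_space d"
  by (auto simp: right_shift_def dual_space_def)

lemma funpow_right_shift_dual [simp]: "x \<in> dual_space d \<Longrightarrow> (right_shift ^^ n) x \<in> dual_space d"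
  by (auto simp: funpow_right_shift dual_space_def)

lemma agree_shift: "agree (m + i) x y \<Longrightarrow> agree m ((right_shift ^^ i) x) ((right_shift ^^ i) y)"
  by (auto simp: agree_def funpow_right_shift)

lemma cons_seq_dual [simp]: "cons_seq i x \<in> dual_space d \<longleftrightarrow> i < d \<and> x \<in> dual_space d"
  by (auto simp: dual_space_def split: nat.splits)

lemma right_shift_cons [simp]: "right_shift (cons_seq i x) = x"
  by (simp add: right_shift_def)

lemma cons_seq_right_shift: "cons_seq (x 0) (right_shift x) = x"
  by (auto simp: right_shift_def fun_eq_iff split: nat.splits)

lemma cons_seq_inject [simp]: "cons_seq i x = cons_seq j y \<longleftrightarrow> i = j \<and> x = y"
  by (metis nat.case(1) right_shift_cons)

lemma agree_cons: "agree m x y \<Longrightarrow> agree (Suc m) (cons_seq i x) (cons_seq i y)"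
  by (auto simp: agree_def split: nat.splits)

lemma preimages_eq:
  assumes "x \<in> dual_space d"
  shows "{y. y \<in> dual_space d \<and> right_shift y = x} = (\<lambda>i. cons_seq i x) ` {..<d}"
proof (intro equalityI subsetI)
  fix y assume "y \<in> {y. y \<in> dual_space d \<and> right_shift y = x}"
  then have "y = cons_seq (y 0) x" "y 0 < d"
    by (auto simp: cons_seq_right_shift) (auto simp: dual_space_def)
  then show "y \<in> (\<lambda>i. cons_seq i x) ` {..<d}" by blast
qed (use assms in auto)

lemma sum_preimages:
  assumes "x \<in> dual_space d"
  shows "(\<Sum>y | y \<in> dual_space d \<and> right_shift y = x. h y) = (\<Sum>i<d. h (cons_seq i x))"
  unfolding preimages_eq[OF assms] by (subst sum.reindex) (auto simp: inj_on_def)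

lemma transfer_op_eq:
  "x \<in> dual_space d \<Longrightarrow> transfer_op d \<psi> \<phi> x = (\<Sum>i<d. \<phi> (cons_seq i x) * \<psi> (cons_seq i x))"
  unfolding transfer_op_def by (rule sum_preimages)

section \<open>Fibres of the iterated shift\<close>

lemma fibre_0: "0 < d \<Longrightarrow> fibre d 0 = {\<lambda>_. 0}"
  by (auto simp: fibre_def dual_space_def fun_eq_iff)

lemma fibre_Suc: "fibre d (Suc n) = (\<lambda>(i, y). cons_seq i y) ` ({..<d} \<times> fibre d n)"
proof (intro equalityI subsetI)
  fix x assume x: "x \<in> fibre d (Suc n)"
  then have "x = cons_seq (x 0) (right_shift x)" "x 0 < d" "right_shift x \<in> fibre d n"
    by (auto simp: cons_seq_right_shift)
       (auto simp: fibre_def dual_space_def right_shift_def)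
  then show "x \<in> (\<lambda>(i, y). cons_seq i y) ` ({..<d} \<times> fibre d n)" by force
qed (auto simp: fibre_def split: nat.splits)

lemma finite_fibre [simp]: "0 < d \<Longrightarrow> finite (fibre d n)"
  by (induction n) (simp_all add: fibre_0 fibre_Suc)

lemma fibre_nonempty: "0 < d \<Longrightarrow> fibre d n \<noteq> {}"
  by (auto simp: fibre_def dual_space_def intro!: exI[of _ "\<lambda>_. 0"])

lemma sum_fibre_Suc:
  fixes h :: "_ \<Rightarrow> real"
  shows "(\<Sum>y\<in>fibre d (Suc n). h y) = (\<Sum>y\<in>fibre d n. \<Sum>i<d. h (cons_seq i y))"
proof -
  have "(\<Sum>y\<in>fibre d (Suc n). h y) = (\<Sum>(i, y)\<in>{..<d} \<times> fibre d n. h (cons_seq i y))"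
    unfolding fibre_Suc by (subst sum.reindex) (auto simp: inj_on_def case_prod_unfold)
  also have "\<dots> = (\<Sum>y\<in>fibre d n. \<Sum>i<d. h (cons_seq i y))"
    by (subst sum.cartesian_product[symmetric], rule sum.swap)
  finally show ?thesis .
qed

lemma zero_in_dual [simp]: "0 < d \<Longrightarrow> (\<lambda>_. 0) \<in> dual_space d"
  by (simp add: dual_space_def)

section \<open>Topology: cylinders, compactness, uniform continuity\<close>

lemma open_agree: "open {v. agree m x v}"
proof -
  have "{v. agree m x v} = (\<Inter>k<m. (\<lambda>v. v k) -` {x k})"
    by (auto simp: agree_def)
  then show ?thesis
    by (auto intro!: open_INT ballI open_vimage Topological_Spaces.open_discrete)
qed

lemma agree_subset_open:
  assumes "open U" "x \<in> U"
  obtains m where "{v. agree m x v} \<subseteq> U"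
proof -
  interpret Metric_space UNIV seq_dist by (rule Metric_space_seq_dist)
  have "openin mtopology U" using assms(1) mtopology_seq_dist by simp
  then obtain r where r: "0 < r" "mball x r \<subseteq> U"
    using assms(2) unfolding openin_mtopology by blast
  obtain n where n: "(1/2) ^ n < r"
    using real_arch_pow_inv [of r "1/2"] r by auto
  \<comment> \<open>Distance below (1/2)^n means agreement at all indices up to and including n,
    that is on Suc n digits.\<close>
  have "{v. agree (Suc n) x v} \<subseteq> U"
  proof
    fix v assume "v \<in> {v. agree (Suc n) x v}"
    then have "seq_dist x v < (1/2) ^ n" by (auto simp: seq_dist_less_iff agree_def)
    with n r show "v \<in> U" by (auto simp: subset_iff)
  qed
  then show ?thesis by (rule that)
qed

text \<open>Tychonoff, for a product of finite discrete sets.\<close>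

lemma compact_dual_space: "compact (dual_space d)"
proof -
  have "compactin (product_topology (\<lambda>_::nat. euclidean :: nat topology) UNIV) (PiE UNIV (\<lambda>_. {..<d}))"
    by (simp add: compactin_PiE finite_imp_compact)
  moreover have "PiE UNIV (\<lambda>_. {..<d}) = dual_space d"
    by (auto simp: dual_space_def PiE_iff)
  ultimately show ?thesis by (simp add: euclidean_product_topology)
qed

lemma closed_dual_space: "closed (dual_space d)"
proof -
  have "- dual_space d = (\<Union>k. (\<lambda>v. v k) -` {d..})"
    by (auto simp: dual_space_def not_less) (meson leD)
  moreover have "open (\<Union>k. (\<lambda>v::nat \<Rightarrow> nat. v k) -` {d..})"
    by (intro open_UN ballI open_vimage Topological_Spaces.open_discrete) simp
  ultimately show ?thesis by (simp add: closed_def)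
qed

text \<open>Uniform continuity on a compact space: finitely many cylinders on which the oscillation
  is controlled cover everything, and the longest of them gives m.\<close>

lemma continuous_on_dual_iff:
  fixes \<phi> :: "_ \<Rightarrow> real"
  shows "continuous_on (dual_space d) \<phi> \<longleftrightarrow>
    (\<forall>e>0. \<exists>m. \<forall>x\<in>dual_space d. \<forall>y\<in>dual_space d. agree m x y \<longrightarrow> \<bar>\<phi> x - \<phi> y\<bar> < e)"
proof
  assume cont: "continuous_on (dual_space d) \<phi>"
  show "\<forall>e>0. \<exists>m. \<forall>x\<in>dual_space d. \<forall>y\<in>dual_space d. agree m x y \<longrightarrow> \<bar>\<phi> x - \<phi> y\<bar> < e"
  proof (intro allI impI)
    fix e :: real assume "0 < e"
    have "\<exists>m. \<forall>y\<in>dual_space d. agree m x y \<longrightarrow> \<bar>\<phi> x - \<phi> y\<bar> < e / 2" if x: "x \<in> dual_space d" for x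
    proof -
      obtain U where U: "open U" "U \<inter> dual_space d = \<phi> -` ball (\<phi> x) (e/2) \<inter> dual_space d"
        using cont unfolding continuous_on_open_invariant by (metis open_ball)
      have "x \<in> U" using U x \<open>0 < e\<close> by auto
      then obtain m where m: "{v. agree m x v} \<subseteq> U" using agree_subset_open U by metis
      then show ?thesis using U by (intro exI[of _ m]) (force simp: dist_real_def)
    qed
    then obtain M where M: "\<And>x y. x \<in> dual_space d \<Longrightarrow> y \<in> dual_space d \<Longrightarrow> agree (M x) x y \<Longrightarrow> \<bar>\<phi> x - \<phi> y\<bar> < e/2"
      by metis
    obtain C where C: "C \<subseteq> dual_space d" "finite C" "dual_space d \<subseteq> (\<Union>x\<in>C. {v. agree (M x) x v})"
      using compactE_image[OF compact_dual_space, of "dual_space d" "\<lambda>x. {v. agree (M x) x v}" d] open_agree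
      by (metis (no_types, lifting) UN_I agree_refl mem_Collect_eq subsetI)
    show "\<exists>m. \<forall>x\<in>dual_space d. \<forall>y\<in>dual_space d. agree m x y \<longrightarrow> \<bar>\<phi> x - \<phi> y\<bar> < e"
    proof (intro exI ballI impI)
      fix x y assume xy: "x \<in> dual_space d" "y \<in> dual_space d" "agree (Max (M ` C)) x y"
      then obtain z where z: "z \<in> C" "agree (M z) z x" using C by auto
      have "agree (M z) x y" using xy(3) C z by (auto intro: agree_mono)
      then have "agree (M z) z y" using z agree_trans by blast
      then have "\<bar>\<phi> z - \<phi> x\<bar> < e/2" "\<bar>\<phi> z - \<phi> y\<bar> < e/2" using M xy z C by blast+
      then show "\<bar>\<phi> x - \<phi> y\<bar> < e" by linarith
    qed
  qed
next
  assume R: "\<forall>e>0. \<exists>m. \<forall>x\<in>dual_space d. \<forall>y\<in>dual_space d. agree m x y \<longrightarrow> \<bar>\<phi> x - \<phi> y\<bar> < e"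
  show "continuous_on (dual_space d) \<phi>"
    unfolding continuous_on_topological
  proof (intro ballI allI impI)
    fix x B assume x: "x \<in> dual_space d" and B: "open B" "\<phi> x \<in> B"
    then obtain e where e: "e > 0" "ball (\<phi> x) e \<subseteq> B" using openE by blast
    with R obtain m where m: "\<And>x y. x\<in>dual_space d \<Longrightarrow> y\<in>dual_space d \<Longrightarrow> agree m x y \<Longrightarrow> \<bar>\<phi> x - \<phi> y\<bar> < e"
      by meson
    show "\<exists>A. open A \<and> x \<in> A \<and> (\<forall>y\<in>dual_space d. y \<in> A \<longrightarrow> \<phi> y \<in> B)"
      using m[OF x] e open_agree[of m x] by (intro exI[of _ "{v. agree m x v}"]) (auto simp: dist_real_def subset_iff)
  qed
qed

lemma continuous_on_dualE:
  fixes \<phi> :: "_ \<Rightarrow> real"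
  assumes "continuous_on (dual_space d) \<phi>" "0 < e"
  obtains m where "\<And>x y. x \<in> dual_space d \<Longrightarrow> y \<in> dual_space d \<Longrightarrow> agree m x y \<Longrightarrow> \<bar>\<phi> x - \<phi> y\<bar> < e"
  using assms unfolding continuous_on_dual_iff by blast

lemma continuous_on_dual_ext:
  fixes \<phi> \<phi>' :: "_ \<Rightarrow> real"
  assumes "continuous_on (dual_space d) \<phi>" "\<And>x. x \<in> dual_space d \<Longrightarrow> \<phi>' x = \<phi> x"
  shows "continuous_on (dual_space d) \<phi>'"
  using assms continuous_on_cong by metis

lemma dual_clopenI:
  assumes "A \<subseteq> dual_space d"
    and "\<And>x y. x \<in> dual_space d \<Longrightarrow> y \<in> dual_space d \<Longrightarrow> agree m x y \<Longrightarrow> x \<in> A \<Longrightarrow> y \<in> A"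
  shows "A \<in> dual_clopen d"
  using assms unfolding dual_clopen_def by blast

lemma dual_clopenE:
  assumes "A \<in> dual_clopen d"
  obtains m where "\<And>k x y. m \<le> k \<Longrightarrow> x \<in> dual_space d \<Longrightarrow> y \<in> dual_space d \<Longrightarrow> agree k x y \<Longrightarrow> x \<in> A \<longleftrightarrow> y \<in> A"
proof -
  obtain m where m: "\<And>x y. x \<in> dual_space d \<Longrightarrow> y \<in> dual_space d \<Longrightarrow> agree m x y \<Longrightarrow> x \<in> A \<Longrightarrow> y \<in> A"
    using assms unfolding dual_clopen_def by blast
  show ?thesis
  proof (rule that[of m])
    fix k x y assume "m \<le> k" "x \<in> dual_space d" "y \<in> dual_space d" "agree k x y"
    then show "x \<in> A \<longleftrightarrow> y \<in> A" using m[of x y] m[of y x] agree_mono agree_sym by blast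
  qed
qed

lemma dual_clopen_subset: "A \<in> dual_clopen d \<Longrightarrow> A \<subseteq> dual_space d"
  by (simp add: dual_clopen_def)

lemma algebra_dual_clopen: "algebra (dual_space d) (dual_clopen d)"
  unfolding algebra_iff_Un
proof (intro conjI ballI)
  show "dual_clopen d \<subseteq> Pow (dual_space d)" using dual_clopen_subset by blast
  show "{} \<in> dual_clopen d" by (rule dual_clopenI) auto
  fix A assume A: "A \<in> dual_clopen d"
  then obtain m where m: "\<And>k x y. m \<le> k \<Longrightarrow> x \<in> dual_space d \<Longrightarrow> y \<in> dual_space d \<Longrightarrow> agree k x y \<Longrightarrow> x \<in> A \<longleftrightarrow> y \<in> A"
    by (rule dual_clopenE) blast
  show "dual_space d - A \<in> dual_clopen d" by (rule dual_clopenI[of _ _ m]) (use m[of m] in blast)+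
  fix B assume B: "B \<in> dual_clopen d"
  then obtain n where n: "\<And>k x y. n \<le> k \<Longrightarrow> x \<in> dual_space d \<Longrightarrow> y \<in> dual_space d \<Longrightarrow> agree k x y \<Longrightarrow> x \<in> B \<longleftrightarrow> y \<in> B"
    by (rule dual_clopenE) blast
  show "A \<union> B \<in> dual_clopen d"
  proof (rule dual_clopenI[of _ _ "max m n"])
    show "A \<union> B \<subseteq> dual_space d" using A B dual_clopen_subset by blast
    fix x y assume "x \<in> dual_space d" "y \<in> dual_space d" "agree (max m n) x y" "x \<in> A \<union> B"
    then show "y \<in> A \<union> B" using m[of "max m n" x y] n[of "max m n" x y] by auto
  qed
qed

lemma right_cylinder_eq: "right_cylinder d w n = {v \<in> dual_space d. agree n v w}"
  by (simp add: right_cylinder_def agree_def)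

lemma right_cylinder_clopen: "right_cylinder d w n \<in> dual_clopen d"
  by (rule dual_clopenI[of _ _ n]) (auto simp: right_cylinder_eq intro: agree_trans agree_sym)

lemma closed_dual_clopen:
  assumes A: "A \<in> dual_clopen d" shows "closed A"
proof -
  obtain m where m: "\<And>k x y. m \<le> k \<Longrightarrow> x \<in> dual_space d \<Longrightarrow> y \<in> dual_space d \<Longrightarrow> agree k x y \<Longrightarrow> x \<in> A \<longleftrightarrow> y \<in> A"
    using A by (rule dual_clopenE) blast
  have "A = dual_space d - (\<Union>x\<in>dual_space d - A. {v. agree m x v})"
    using dual_clopen_subset[OF A] m[of m] agree_refl by blast
  moreover have "closed (dual_space d)" by (rule closed_dual_space)
  moreover have "open (\<Union>x\<in>dual_space d - A. {v. agree m x v})"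
    by (intro open_UN ballI open_agree)
  ultimately show ?thesis by (metis closed_Diff)
qed

lemma space_dual_borel [simp]: "space (dual_borel d) = dual_space d"
  by (simp add: dual_borel_def space_restrict_space)

lemma sets_dual_borel: "sets (dual_borel d) = sigma_sets (dual_space d) (dual_clopen d)"
proof -
  have meas: "dual_space d \<in> sets borel"
    by (intro borel_closed closed_dual_space)
  have "sets (dual_borel d) = (\<inter>) (dual_space d) ` sigma_sets UNIV {S. open S}"
    by (simp add: dual_borel_def sets_restrict_space borel_def)
  also have "\<dots> = sigma_sets (dual_space d) ((\<inter>) (dual_space d) ` {S. open S})"
    using meas by (intro sigma_sets_Int) (auto simp: borel_def)
  also have "\<dots> = sigma_sets (dual_space d) (dual_clopen d)"
  proof (rule sigma_sets_eqI)
    fix B assume "B \<in> (\<inter>) (dual_space d) ` {S. open S}"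
    then obtain U where U: "open U" and B: "B = dual_space d \<inter> U" by auto
    \<comment> \<open>Cylinders are indexed by lists of digits, which are countable in number, so
      that an open set becomes a countable union of them.\<close>
    define cyl where "cyl u = {v \<in> dual_space d. \<forall>k<length u. v k = u ! k}" for u :: "nat list"
    have "B = (\<Union>u\<in>{u. cyl u \<subseteq> U}. cyl u)"
    proof (intro equalityI subsetI)
      fix x assume x: "x \<in> B"
      then obtain m where m: "{v. agree m x v} \<subseteq> U" using U B agree_subset_open by blast
      have "cyl (map x [0..<m]) \<subseteq> U" "x \<in> cyl (map x [0..<m])"
        using m x by (auto simp: cyl_def agree_def B)
      then show "x \<in> (\<Union>u\<in>{u. cyl u \<subseteq> U}. cyl u)" by blast
    qed (auto simp: B cyl_def)
    moreover have "cyl u \<in> dual_clopen d" for u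
      by (rule dual_clopenI[of _ _ "length u"]) (auto simp: cyl_def agree_def)
    ultimately show "B \<in> sigma_sets (dual_space d) (dual_clopen d)"
      by (auto intro!: sigma_sets_UNION)
  next
    fix A assume A: "A \<in> dual_clopen d"
    then obtain m where m: "\<And>k x y. m \<le> k \<Longrightarrow> x \<in> dual_space d \<Longrightarrow> y \<in> dual_space d \<Longrightarrow> agree k x y \<Longrightarrow> x \<in> A \<longleftrightarrow> y \<in> A"
      by (rule dual_clopenE) blast
    have "A = dual_space d \<inter> (\<Union>x\<in>A. {v. agree m x v})"
      using dual_clopen_subset[OF A] m[of m] by auto
    then have "A \<in> (\<inter>) (dual_space d) ` {S. open S}"
      using open_agree by blast
    then show "A \<in> sigma_sets (dual_space d) ((\<inter>) (dual_space d) ` {S. open S})" by auto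
  qed
  finally show ?thesis .
qed

lemma dual_clopen_sets: "A \<in> dual_clopen d \<Longrightarrow> A \<in> sets (dual_borel d)"
  by (simp add: sets_dual_borel)

lemma right_cylinder_sets: "right_cylinder d w n \<in> sets (dual_borel d)"
  by (intro dual_clopen_sets right_cylinder_clopen)

lemma indicator_clopen_continuous:
  assumes "A \<in> dual_clopen d"
  shows "continuous_on (dual_space d) (indicator A :: _ \<Rightarrow> real)"
proof -
  obtain m where "\<And>k x y. m \<le> k \<Longrightarrow> x \<in> dual_space d \<Longrightarrow> y \<in> dual_space d \<Longrightarrow> agree k x y \<Longrightarrow> x \<in> A \<longleftrightarrow> y \<in> A"
    using assms by (rule dual_clopenE) blast
  then show ?thesis
    unfolding continuous_on_dual_iff by (intro allI impI exI[of _ m]) (auto simp: indicator_def)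
qed

lemma continuous_on_dual_measurable:
  fixes \<phi> :: "_ \<Rightarrow> real"
  assumes "continuous_on (dual_space d) \<phi>" "sets M = sets (dual_borel d)"
  shows "\<phi> \<in> borel_measurable M"
proof -
  have "\<phi> \<in> borel_measurable (dual_borel d)"
    using borel_measurable_continuous_on_restrict[OF assms(1)] by (simp add: dual_borel_def)
  then show ?thesis by (simp add: measurable_cong_sets[OF assms(2) refl])
qed

lemma continuous_on_dual_bounded:
  fixes \<phi> :: "_ \<Rightarrow> real"
  assumes "continuous_on (dual_space d) \<phi>"
  obtains B where "\<And>x. x \<in> dual_space d \<Longrightarrow> \<bar>\<phi> x\<bar> \<le> B"
proof -
  have "bounded (\<phi> ` dual_space d)"
    using assms compact_dual_space by (intro compact_imp_bounded compact_continuous_image)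
  then show ?thesis using that by (auto simp: bounded_iff)
qed

lemma continuous_on_dual_integrable:
  fixes \<phi> :: "_ \<Rightarrow> real"
  assumes "continuous_on (dual_space d) \<phi>" "sets M = sets (dual_borel d)" "finite_measure M"
  shows "integrable M \<phi>"
proof -
  interpret finite_measure M by fact
  obtain B where B: "\<And>x. x \<in> dual_space d \<Longrightarrow> \<bar>\<phi> x\<bar> \<le> B"
    using continuous_on_dual_bounded[OF assms(1)] by blast
  have "space M = dual_space d" using sets_eq_imp_space_eq[OF assms(2)] by simp
  then show ?thesis
    using B by (intro integrable_const_bound[of _ B] AE_I2 continuous_on_dual_measurable[OF assms(1,2)]) auto
qed

text \<open>Integrating the continuous indicators of clopen sets shows agreement on a generator that
  is stable under intersection.\<close>

lemma measure_eqI_continuous: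
  assumes M: "finite_measure M" "sets M = sets (dual_borel d)"
    and N: "finite_measure N" "sets N = sets (dual_borel d)"
    and eq: "\<And>\<phi>. continuous_on (dual_space d) \<phi> \<Longrightarrow> integral\<^sup>L M \<phi> = (integral\<^sup>L N \<phi> :: real)"
  shows "M = N"
proof -
  interpret A: algebra "dual_space d" "dual_clopen d" by (rule algebra_dual_clopen)
  interpret M: finite_measure M by fact
  interpret N: finite_measure N by fact
  show ?thesis
  proof (rule measure_eqI_generator_eq[where E = "dual_clopen d" and \<Omega> = "dual_space d" and A = "\<lambda>_. dual_space d"])
    show "Int_stable (dual_clopen d)" by (auto simp: Int_stable_def)
    show "dual_clopen d \<subseteq> Pow (dual_space d)" using dual_clopen_subset by blast
    fix X assume X: "X \<in> dual_clopen d"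
    have "measure M X = measure N X"
      using eq[OF indicator_clopen_continuous[OF X]] dual_clopen_sets[OF X] M(2) N(2) by simp
    then show "emeasure M X = emeasure N X" by (simp add: M.emeasure_eq_measure N.emeasure_eq_measure)
  qed (use M N sets_dual_borel in auto)
qed

lemma measurable_right_shift:
  assumes "sets M = sets (dual_borel d)"
  shows "right_shift \<in> measurable M M"
proof -
  have "right_shift \<in> measurable (dual_borel d) (dual_borel d)"
  proof (rule measurable_sigma_sets[OF sets_dual_borel])
    fix A assume A: "A \<in> dual_clopen d"
    then obtain m where m: "\<And>k x y. m \<le> k \<Longrightarrow> x \<in> dual_space d \<Longrightarrow> y \<in> dual_space d \<Longrightarrow> agree k x y \<Longrightarrow> x \<in> A \<longleftrightarrow> y \<in> A"
      by (rule dual_clopenE) blast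
    have "right_shift -` A \<inter> dual_space d \<in> dual_clopen d"
    proof (rule dual_clopenI[of _ _ "m + 1"])
      fix x y assume "x \<in> dual_space d" "y \<in> dual_space d" "agree (m + 1) x y" "x \<in> right_shift -` A \<inter> dual_space d"
      then show "y \<in> right_shift -` A \<inter> dual_space d"
        using m[of m "right_shift x" "right_shift y"] agree_shift[of m 1 x y] by auto
    qed auto
    then show "right_shift -` A \<inter> space (dual_borel d) \<in> sets (dual_borel d)"
      by (simp add: dual_clopen_sets)
  qed (use dual_clopen_subset in auto)
  then show ?thesis using measurable_cong_sets[OF assms assms] by blast
qed

text \<open>Resolves the definite description: a finite measure is determined by its integrals of
  continuous functions, so any candidate with the right integrals is the dual image.\<close>

lemma transfer_dual_eqI:
  assumes "finite_measure N" "sets N = sets (dual_borel d)"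
    and "\<And>\<phi>. continuous_on (dual_space d) \<phi> \<Longrightarrow> integral\<^sup>L N \<phi> = integral\<^sup>L M (transfer_op d \<psi> \<phi>)"
  shows "transfer_dual d \<psi> M = N"
  unfolding transfer_dual_def
proof (rule the_equality)
  fix N' assume "finite_measure N' \<and> sets N' = sets (dual_borel d) \<and>
    (\<forall>\<phi>. continuous_on (dual_space d) \<phi> \<longrightarrow> integral\<^sup>L N' \<phi> = integral\<^sup>L M (transfer_op d \<psi> \<phi>))"
  then show "N' = N" using assms by (intro measure_eqI_continuous[of N' d N]) auto
qed (use assms in auto)

subsection \<open>Distortion of monotone maps with bounded ratios\<close>

text \<open>Neighbouring increments differ by a factor of at most R, and two of the N parts are
  fewer than N steps apart; R \<ge> 1 lets the exponent be rounded up to N.\<close>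

lemma equal_parts_ratio:
  fixes H :: "real \<Rightarrow> real" and R t x :: real
  assumes R: "1 \<le> R" and mono: "\<And>x y. x \<le> y \<Longrightarrow> H x \<le> H y"
    and ratio: "\<And>x. H (x + t) - H x \<le> R * (H x - H (x - t))" "\<And>x. H x - H (x - t) \<le> R * (H (x + t) - H x)"
    and t: "0 \<le> t" and ij: "i < N" "j < N"
  shows "H (x + real (Suc i) * t) - H (x + real i * t) \<le> R ^ N * (H (x + real (Suc j) * t) - H (x + real j * t))"
proof -
  define D where "D i = H (x + real (Suc i) * t) - H (x + real i * t)" for i
  have D0: "0 \<le> D i" for i unfolding D_def using t by (simp add: mono mult_right_mono)
  have up: "D (Suc i) \<le> R * D i" for i
    using ratio(1)[of "x + real (Suc i) * t"] by (simp add: D_def algebra_simps)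
  have dn: "D i \<le> R * D (Suc i)" for i
    using ratio(2)[of "x + real (Suc i) * t"] by (simp add: D_def algebra_simps)
  have up': "D (i + k) \<le> R ^ k * D i" for i k
  proof (induction k)
    case (Suc k)
    have "D (i + Suc k) \<le> R * D (i + k)" using up by simp
    also have "\<dots> \<le> R * (R ^ k * D i)" using Suc R by (intro mult_left_mono) auto
    finally show ?case by (simp add: mult_ac)
  qed simp
  have dn': "D i \<le> R ^ k * D (i + k)" for i k
  proof (induction k)
    case (Suc k)
    have "R ^ k * D (i + k) \<le> R ^ k * (R * D (Suc (i + k)))" using dn R by (intro mult_left_mono) auto
    with Suc show ?case by (simp add: mult_ac)
  qed simp
  have pow: "R ^ k * D j \<le> R ^ N * D j" if "k \<le> N" for k
    using that R D0 by (intro mult_right_mono power_increasing) auto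
  have "D i \<le> R ^ N * D j"
  proof (cases "i \<le> j")
    case True
    then have "j - i \<le> N" using ij by simp
    then show ?thesis using dn'[of i "j - i"] pow[of "j - i"] True by simp
  next
    case False
    then have "i - j \<le> N" using ij by simp
    then show ?thesis using up'[of j "i - j"] pow[of "i - j"] False by simp
  qed
  then show ?thesis by (simp add: D_def)
qed

text \<open>A block of j - i equal parts carries the proportion (j - i) / N of the whole increment,
  up to the factor \<open>R ^ N\<close>.\<close>

lemma equal_parts_bounds:
  fixes H :: "real \<Rightarrow> real" and R L x :: real
  assumes R: "1 \<le> R" and mono: "\<And>x y. x \<le> y \<Longrightarrow> H x \<le> H y"
    and ratio: "\<And>x. H (x + L / N) - H x \<le> R * (H x - H (x - L / N))"
      "\<And>x. H x - H (x - L / N) \<le> R * (H (x + L / N) - H x)"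
    and L: "0 \<le> L" and N: "0 < N" and ij: "i \<le> j" "j \<le> N"
  shows "H (x + real j * (L / N)) - H (x + real i * (L / N)) \<le> R ^ N * (real (j - i) / N) * (H (x + L) - H x)"
    and "(real (j - i) / N) * (H (x + L) - H x) \<le> R ^ N * (H (x + real j * (L / N)) - H (x + real i * (L / N)))"
proof -
  define t where "t = L / N"
  define D where "D i = H (x + real (Suc i) * t) - H (x + real i * t)" for i
  have t: "0 \<le> t" using L by (simp add: t_def)
  have cmp: "D i \<le> R ^ N * D j" if "i < N" "j < N" for i j
    unfolding D_def using equal_parts_ratio[where H = H and x = x and t = t and R = R, OF R mono _ _ t that] ratio t_def by simp
  have tel: "H (x + real j * t) - H (x + real i * t) = (\<Sum>k=i..<j. D k)" if "i \<le> j" for i j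
    unfolding D_def using sum_Suc_diff'[OF that, of "\<lambda>k. H (x + real k * t)"] by simp
  have tot: "H (x + L) - H x = (\<Sum>k<N. D k)"
    using tel[of 0 N] N by (simp add: t_def atLeast0LessThan)
  \<comment> \<open>Summing over all l compares the block with the total of the N parts instead of
    with a single part.\<close>
  have "(\<Sum>l<N. \<Sum>k=i..<j. D k) \<le> (\<Sum>l<N. \<Sum>k=i..<j. R ^ N * D l)"
    using ij by (intro sum_mono cmp) auto
  then have "N * (\<Sum>k=i..<j. D k) \<le> R ^ N * real (j - i) * (\<Sum>l<N. D l)"
    by (simp add: sum_distrib_left[symmetric] sum_distrib_right[symmetric] mult_ac)
  then show "H (x + real j * (L / N)) - H (x + real i * (L / N)) \<le> R ^ N * (real (j - i) / N) * (H (x + L) - H x)"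
    using N tel[OF ij(1)] tot by (simp add: t_def[symmetric] field_simps)
  have "(\<Sum>l<N. \<Sum>k=i..<j. D l) \<le> (\<Sum>l<N. \<Sum>k=i..<j. R ^ N * D k)"
    using ij by (intro sum_mono cmp) auto
  then have "real (j - i) * (\<Sum>l<N. D l) \<le> N * (R ^ N * (\<Sum>k=i..<j. D k))"
    by (simp add: sum_distrib_left[symmetric] sum_distrib_right[symmetric] mult_ac)
  then show "(real (j - i) / N) * (H (x + L) - H x) \<le> R ^ N * (H (x + real j * (L / N)) - H (x + real i * (L / N)))"
    using N tel[OF ij(1)] tot by (simp add: t_def[symmetric] field_simps)
qed

text \<open>A monotone map with ratios close to 1 nearly preserves relative positions. Enclosing s
  between consecutive multiples of 1 / N costs the rounding error 1 / N, and the comparison of the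
  parts costs a multiple of \<open>R ^ N - 1\<close>.\<close>

lemma relative_position_distortion:
  fixes H :: "real \<Rightarrow> real" and R L x s :: real
  assumes R: "1 \<le> R" and mono: "\<And>x y. x < y \<Longrightarrow> H x < H y"
    and ratio: "\<And>x. H (x + L / N) - H x \<le> R * (H x - H (x - L / N))"
      "\<And>x. H x - H (x - L / N) \<le> R * (H (x + L / N) - H x)"
    and L: "0 < L" and N: "0 < N" and s: "0 \<le> s" "s \<le> 1"
  shows "\<bar>(H (x + s * L) - H x) / (H (x + L) - H x) - s\<bar> \<le> 2 * (R ^ N - 1) + 1 / N"
proof -
  have mono': "\<And>x y. x \<le> y \<Longrightarrow> H x \<le> H y" using mono by (metis less_eq_real_def)
  define T where "T = H (x + L) - H x"
  define u where "u = (H (x + s * L) - H x) / T"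
  define Q where "Q = R ^ N"
  have T: "0 < T" using mono L by (simp add: T_def)
  have Q1: "1 \<le> Q" using R by (simp add: Q_def)
  define i where "i = nat \<lfloor>s * N\<rfloor>"
  have i: "real i \<le> s * N" "s * N < real i + 1" using s by (simp_all add: i_def)
  have sN: "s * N \<le> N" using s N by (simp add: mult_left_le_one_le)
  have iN: "i \<le> N" using i sN by linarith
  have low: "(real i / N) * T \<le> Q * (H (x + real i * (L / N)) - H x)"
    using equal_parts_bounds(2)[where H = H and x = x and i = 0 and j = i, OF R mono' ratio _ N] L iN by (simp add: T_def Q_def)
  have "x + real i * (L / N) \<le> x + s * L" using i L N by (simp add: field_simps)
  then have low': "H (x + real i * (L / N)) \<le> H (x + s * L)" by (rule mono')
  have "(real i / N) * T \<le> Q * (u * T)"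
    using low low' Q1 T by (simp add: u_def) (smt (verit) mult_left_mono)
  then have lower: "real i / N \<le> Q * u" using T by (metis mult.assoc mult_le_cancel_right_pos)
  have upper: "u \<le> Q * (s + 1 / N)"
  proof (cases "i < N")
    case True
    have "s * L = (s * N) * (L / N)" using N by simp
    also have "\<dots> \<le> real (Suc i) * (L / N)" using i L N by (intro mult_right_mono) auto
    finally have "x + s * L \<le> x + real (Suc i) * (L / N)" by simp
    then have "H (x + s * L) \<le> H (x + real (Suc i) * (L / N))" by (rule mono')
    also have "\<dots> - H x \<le> Q * (real (Suc i) / N) * T"
      using equal_parts_bounds(1)[where H = H and x = x and i = 0 and j = "Suc i", OF R mono' ratio _ N] L True by (simp add: T_def Q_def)
    finally have "u \<le> Q * (real (Suc i) / N)" using T by (simp add: u_def field_simps)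
    also have "\<dots> \<le> Q * (s + 1 / N)" 
    proof (rule mult_left_mono)
      have "real (Suc i) / N \<le> (s * N + 1) / N" using i by (intro divide_right_mono) auto
      then show "real (Suc i) / N \<le> s + 1 / N" using N by (simp add: add_divide_distrib)
    qed (use Q1 in simp)
    finally show ?thesis .
  next
    case False
    \<comment> \<open>The right neighbour of the grid point i is missing only at the right end of
      the interval.\<close>
    then have "s = 1" using i iN sN s N by (simp add: field_simps)
    then have "u = 1" using T by (simp add: u_def T_def)
    moreover have "1 * 1 \<le> Q * (s + 1 / N)" using Q1 \<open>s = 1\<close> by (intro mult_mono) auto
    ultimately show ?thesis by simp
  qed
  have u1: "0 \<le> u" "u \<le> 1" using s L T by (auto simp: u_def T_def divide_simps intro!: mono' mult_left_le_one_le)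
  have N1: "1 / N \<le> 1" using N by simp
  have "s - 1 / N = (s * N - 1) / N" using N by (simp add: diff_divide_distrib)
  also have "\<dots> \<le> real i / N" using i by (intro divide_right_mono) auto

  also have "\<dots> \<le> u + (Q - 1) * u" using lower by (simp add: algebra_simps)
  also have "(Q - 1) * u \<le> (Q - 1) * 1" using u1 Q1 by (intro mult_left_mono) auto
  finally have A: "s - u \<le> (Q - 1) + 1 / N" by simp
  have "u \<le> s + 1 / N + (Q - 1) * (s + 1 / N)" using upper by (simp add: algebra_simps diff_divide_distrib)
  \<comment> \<open>Origin of the factor 2 in the bound: s + 1 / N \<le> 2.\<close>
  also have "(Q - 1) * (s + 1 / N) \<le> (Q - 1) * 2" using s N1 Q1 by (intro mult_left_mono) auto
  finally have B: "u - s \<le> 2 * (Q - 1) + 1 / N" by simp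
  show ?thesis using A B Q1 unfolding u_def[symmetric] T_def[symmetric] Q_def[symmetric]
    by (intro abs_leI) simp_all
qed


subsection \<open>Convergence of the dual derivative\<close>

text \<open>\<open>G\<close> is the inverse of the lift F, so F(x + 1) = F(x) + d turns into G(x +
  d) = G(x) + 1.\<close>

locale symmetric_inverse_lift =
  fixes d :: nat and G :: "real \<Rightarrow> real" and \<epsilon> :: "real \<Rightarrow> real"
  assumes d2: "2 \<le> d" and bij_G: "bij G" and mono_G: "strict_mono G" and G_zero: "G 0 = 0"
    and G_period: "G (x + real d) = G x + 1"
    and eps_pos: "0 < t \<Longrightarrow> 0 < \<epsilon> t" and eps_bounded: "bounded (\<epsilon> ` {0<..})"
    and eps_limit: "(\<epsilon> \<longlongrightarrow> 0) (at_right 0)"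
    and eps_ratio: "0 < t \<Longrightarrow> 0 < n \<Longrightarrow>
       1 / (1 + \<epsilon> t) \<le> \<bar>(G ^^ n) (x + t) - (G ^^ n) x\<bar> / \<bar>(G ^^ n) x - (G ^^ n) (x - t)\<bar> \<and>
       \<bar>(G ^^ n) (x + t) - (G ^^ n) x\<bar> / \<bar>(G ^^ n) x - (G ^^ n) (x - t)\<bar> \<le> 1 + \<epsilon> t"
begin

lemma mono_Gn: "x < y \<Longrightarrow> (G ^^ n) x < (G ^^ n) y"
  by (induction n) (use mono_G in \<open>auto simp: strict_mono_def\<close>)

lemma mono_Gn_le: "x \<le> y \<Longrightarrow> (G ^^ n) x \<le> (G ^^ n) y"
  using mono_Gn by (metis less_eq_real_def)

lemma Gn_le_iff: "(G ^^ n) x \<le> (G ^^ n) y \<longleftrightarrow> x \<le> y"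
  using mono_Gn mono_Gn_le by (metis not_le)

lemma G_period_mult: "G (x + real d * real j) = G x + real j"
proof (induction j)
  case (Suc j)
  then show ?case using G_period[of "x + real d * real j"] by (simp add: algebra_simps)
qed simp

lemma Gn_period: "(G ^^ n) (x + real d ^ n * real j) = (G ^^ n) x + real j"
proof (induction n arbitrary: x)
  case (Suc n)
  have "G (x + real d ^ Suc n * real j) = G x + real d ^ n * real j"
    using G_period_mult[of x "d ^ n * j"] by (simp add: mult_ac)
  then show ?case using Suc[of "G x"] by (simp del: funpow.simps add: funpow_Suc_right)
qed simp

lemma Gn_ratio:
  assumes "0 < t" "1 + \<epsilon> t \<le> R"
  shows "(G ^^ n) (x + t) - (G ^^ n) x \<le> R * ((G ^^ n) x - (G ^^ n) (x - t))"
    and "(G ^^ n) x - (G ^^ n) (x - t) \<le> R * ((G ^^ n) (x + t) - (G ^^ n) x)"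
proof -
  define a where "a = (G ^^ n) (x + t) - (G ^^ n) x"
  define b where "b = (G ^^ n) x - (G ^^ n) (x - t)"
  have pos: "0 < a" "0 < b" using mono_Gn assms by (simp_all add: a_def b_def)
  have e: "0 < \<epsilon> t" using eps_pos assms by blast
  have ab: "1 / (1 + \<epsilon> t) \<le> a / b \<and> a / b \<le> 1 + \<epsilon> t"
  \<comment> \<open>The hypothesis speaks of n > 0 only; for n = 0 both increments equal t and their
    ratio is 1.\<close>
  proof (cases "n = 0")
    case True
    then show ?thesis using e assms by (simp add: a_def b_def field_simps)
  next
    case False
    then show ?thesis using eps_ratio[of t n x] assms pos by (simp add: a_def b_def)
  qed
  have "a \<le> (1 + \<epsilon> t) * b" "b \<le> (1 + \<epsilon> t) * a"
    using ab pos e by (simp_all add: field_simps)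
  moreover have "(1 + \<epsilon> t) * b \<le> R * b" "(1 + \<epsilon> t) * a \<le> R * a"
    using assms pos by (simp_all add: mult_right_mono)
  ultimately show "(G ^^ n) (x + t) - (G ^^ n) x \<le> R * ((G ^^ n) x - (G ^^ n) (x - t))"
    "(G ^^ n) x - (G ^^ n) (x - t) \<le> R * ((G ^^ n) (x + t) - (G ^^ n) x)"
    by (simp_all add: a_def b_def)
qed

text \<open>N is fixed by the rounding error before the scale is chosen so small that (1 +
  \<epsilon>(t))^N is close to 1. The threshold does not depend on k because \<epsilon> serves all
  iterates.\<close>

lemma uniform_distortion:
  assumes "0 < e"
  obtains L0 where "0 < L0"
    "\<And>L k x s. 0 < L \<Longrightarrow> L < L0 \<Longrightarrow> 0 \<le> s \<Longrightarrow> s \<le> 1 \<Longrightarrow>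
       \<bar>((G ^^ k) (x + s * L) - (G ^^ k) x) / ((G ^^ k) (x + L) - (G ^^ k) x) - s\<bar> \<le> e"
proof -
  obtain N :: nat where N: "0 < N" "1 / N < e / 2"
    using assms reals_Archimedean[of "e / 2"] by (metis half_gt_zero inverse_eq_divide zero_less_Suc)
  have "((\<lambda>t. 2 * ((1 + \<epsilon> t) ^ N - 1)) \<longlongrightarrow> 2 * ((1 + 0) ^ N - 1)) (at_right 0)"
    by (intro tendsto_intros eps_limit)
  then have "eventually (\<lambda>t. 2 * ((1 + \<epsilon> t) ^ N - 1) < e / 2) (at_right 0)"
    using assms by (intro order_tendstoD) auto
  then obtain b where b: "0 < b" "\<And>t. 0 < t \<Longrightarrow> t < b \<Longrightarrow> 2 * ((1 + \<epsilon> t) ^ N - 1) < e / 2"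
    unfolding eventually_at_right_field by auto
  show ?thesis
  proof (rule that[of "b * N"])
    show "0 < b * N" using b N by simp
    fix L x s :: real and k :: nat assume L: "0 < L" "L < b * N" and s: "0 \<le> s" "s \<le> 1"
    have t: "0 < L / N" "L / N < b" using L N by (simp_all add: field_simps)
    have "\<bar>((G ^^ k) (x + s * L) - (G ^^ k) x) / ((G ^^ k) (x + L) - (G ^^ k) x) - s\<bar>
      \<le> 2 * ((1 + \<epsilon> (L / N)) ^ N - 1) + 1 / N"
      using Gn_ratio[OF t(1) order_refl] eps_pos[OF t(1)] L N s mono_Gn
      by (intro relative_position_distortion) (auto simp: less_imp_le)
    also have "\<dots> \<le> e" using b(2)[OF t] N by simp
    finally show "\<bar>((G ^^ k) (x + s * L) - (G ^^ k) x) / ((G ^^ k) (x + L) - (G ^^ k) x) - s\<bar> \<le> e" .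
  qed
qed

section \<open>Interval lengths and their ratios\<close>

text \<open>The integer m of the word w(n-1) ... w(0): the last letter of the word is the digit of
  lowest weight.\<close>

definition val :: "nat \<Rightarrow> (nat \<Rightarrow> nat) \<Rightarrow> real" where
  "val n w = (\<Sum>k<n. real (w k) * real d ^ k)"

text \<open>The length of the interval of the word w(n-1) ... w(0).\<close>

definition len :: "nat \<Rightarrow> (nat \<Rightarrow> nat) \<Rightarrow> real" where
  "len n w = (G ^^ n) (val n w + 1) - (G ^^ n) (val n w)"

text \<open>Deleting the digit 0 passes from an interval of level n + 1 to its parent of level n, so
  this is the reciprocal of the quotient of index n + 1 in the dual derivative.\<close>

definition rho :: "nat \<Rightarrow> (nat \<Rightarrow> nat) \<Rightarrow> real" where
  "rho n w = len (Suc n) w / len n (right_shift w)"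

lemma val_Suc: "val (Suc n) w = real (w 0) + real d * val n (right_shift w)"
  by (simp add: val_def sum.lessThan_Suc_shift right_shift_def sum_distrib_left mult_ac del: sum.lessThan_Suc)

lemma val_nat: "val n w = real (\<Sum>k<n. w k * d ^ k)"
  by (simp add: val_def)

lemma val_add: "val (n + k) w = val n w + real d ^ n * val k ((right_shift ^^ n) w)"
proof -
  have "val (n + k) w = (\<Sum>i<n. real (w i) * real d ^ i) + (\<Sum>i<k. real (w (n + i)) * real d ^ (n + i))"
    unfolding val_def by (induction k) (simp_all add: add.assoc)
  then show ?thesis
    by (simp add: val_def funpow_right_shift sum_distrib_left power_add mult_ac add.commute)
qed

lemma len_pos: "0 < len n w"
  by (simp add: len_def mono_Gn)

text \<open>Periodicity turns all digits but the lowest into a translation by an integer. Before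
  \<open>G ^^ n\<close> is applied, the child thus lies in its parent's unit interval between the
  offsets \<open>G (real (w 0))\<close> and \<open>G (real (w 0) + 1)\<close>, which do not depend
  on n.\<close>

lemma Gn_Suc_val:
  "(G ^^ Suc n) (val (Suc n) w) = (G ^^ n) (val n (right_shift w) + G (real (w 0)))"
  "(G ^^ Suc n) (val (Suc n) w + 1) = (G ^^ n) (val n (right_shift w) + G (real (w 0) + 1))"
proof -
  have "G (y + val (Suc n) w - real (w 0)) = val n (right_shift w) + G y" for y
    using G_period_mult[of y "\<Sum>k<n. right_shift w k * d ^ k"] by (simp add: val_Suc val_nat[of n])
  from this[of "real (w 0)"] this[of "real (w 0) + 1"]
  show "(G ^^ Suc n) (val (Suc n) w) = (G ^^ n) (val n (right_shift w) + G (real (w 0)))"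
    "(G ^^ Suc n) (val (Suc n) w + 1) = (G ^^ n) (val n (right_shift w) + G (real (w 0) + 1))"
    by (simp_all del: funpow.simps add: funpow_Suc_right algebra_simps)
qed

lemma len_Suc: "len (Suc n) w = (G ^^ n) (val n (right_shift w) + G (real (w 0) + 1)) - (G ^^ n) (val n (right_shift w) + G (real (w 0)))"
  unfolding len_def Gn_Suc_val ..

lemma G_d: "G (real d) = 1" using G_period[of 0] G_zero by simp

lemma G_unit: assumes "x \<in> {0..real d}" shows "G x \<in> {0..1}"
  using assms mono_G G_zero G_d by (auto simp: strict_mono_less_eq) (metis strict_mono_less_eq)+

lemma dual_digit: "w \<in> dual_space d \<Longrightarrow> real (w 0) + 1 \<le> real d"
  by (auto simp: dual_space_def Suc_le_eq dest!: spec[of _ 0])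

text \<open>The points G(0) = 0, ..., G(d) = 1 subdivide the unit interval, so the lengths of the
  children telescope to that of the parent.\<close>

lemma rho_sum:
  "(\<Sum>i<d. rho n (cons_seq i x)) = 1"
proof -
  define h where "h i = (G ^^ n) (val n x + G (real i))" for i :: nat
  have "(\<Sum>i<d. rho n (cons_seq i x)) = (\<Sum>i<d. h (Suc i) - h i) / len n x"
    by (simp add: rho_def len_Suc h_def sum_divide_distrib add.commute)
  also have "(\<Sum>i<d. h (Suc i) - h i) = h d - h 0" by (rule sum_lessThan_telescope)
  also have "\<dots> = len n x" by (simp add: h_def len_def G_d G_zero)
  finally show ?thesis using len_pos[of n x] by simp
qed

text \<open>A bound for \<epsilon> gives one constant R for all iterates on the grid of mesh 1 / N.
  The grid is so fine that every child contains a full mesh, whose share of the parent is at least 1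
  / (N R^N).\<close>

lemma rho_lower_bound:
  obtains c where "0 < c" "\<And>n w. w \<in> dual_space d \<Longrightarrow> c \<le> rho n w"
proof -
  obtain M where M: "\<And>t. 0 < t \<Longrightarrow> \<epsilon> t \<le> M"
    using eps_bounded unfolding bounded_iff by (metis abs_le_D1 greaterThan_iff imageI real_norm_def)
  define R where "R = 1 + M"
  have R: "1 \<le> R" using M[of 1] eps_pos[of 1] by (simp add: R_def)
  \<comment> \<open>Shortest of the d intervals of level one; 2 / N < \<beta> then forces a full
    mesh into each of them.\<close>
  define \<beta> where "\<beta> = Min ((\<lambda>i. G (real i + 1) - G (real i)) ` {..<d})"
  have "0 < \<beta>" unfolding \<beta>_def using d2 mono_G
    by (subst Min_gr_iff) (auto simp: strict_mono_def lessThan_empty_iff)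
  have \<beta>: "\<beta> \<le> G (real i + 1) - G (real i)" if "i < d" for i
    unfolding \<beta>_def using that by (intro Min_le) auto
  obtain N :: nat where N: "0 < N" "1 / N < \<beta> / 2"
    using \<open>0 < \<beta>\<close> reals_Archimedean[of "\<beta> / 2"] by (metis half_gt_zero inverse_eq_divide zero_less_Suc)
  show ?thesis
  proof (rule that[of "1 / (N * R ^ N)"])
    show "0 < 1 / (N * R ^ N)" using N R by simp
    fix n w assume w: "w \<in> dual_space d"
    define a where "a = G (real (w 0))"
    define b where "b = G (real (w 0) + 1)"
    define m where "m = val n (right_shift w)"
    have ab: "a \<in> {0..1}" "b \<in> {0..1}" unfolding a_def b_def using dual_digit[OF w] by (intro G_unit; auto)+
    have wd: "w 0 < d" using w by (simp add: dual_space_def)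
    have "2 / N \<le> b - a" using N \<beta>[OF wd] by (simp add: a_def b_def)
    then have gap: "a * N + 2 \<le> b * N" using N by (simp add: field_simps)
    \<comment> \<open>First grid point at or after a; the mesh starting there still ends before
      b.\<close>
    define j where "j = nat \<lceil>a * N\<rceil>"
    have aN: "0 \<le> a * N" using ab by simp
    have j: "a * N \<le> real j" "real j < a * N + 1" using aN by (simp_all add: j_def) linarith
    have bN: "b * N \<le> N" using ab by (simp add: mult_left_le_one_le)
    have jN: "Suc j \<le> N" using j gap bN by linarith
    have "(real (Suc j - j) / N) * ((G ^^ n) (m + 1) - (G ^^ n) m) \<le>
      R ^ N * ((G ^^ n) (m + real (Suc j) * (1 / N)) - (G ^^ n) (m + real j * (1 / N)))"
    proof (rule equal_parts_bounds(2)[OF R mono_Gn_le])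
      have t: "0 < 1 / real N" "1 + \<epsilon> (1 / N) \<le> R" using N M by (simp_all add: R_def)
      show "(G ^^ n) (x + 1 / N) - (G ^^ n) x \<le> R * ((G ^^ n) x - (G ^^ n) (x - 1 / N))"
        "(G ^^ n) x - (G ^^ n) (x - 1 / N) \<le> R * ((G ^^ n) (x + 1 / N) - (G ^^ n) x)" for x
        using Gn_ratio[OF t] by auto
    qed (use N jN in auto)
    also have "\<dots> \<le> R ^ N * len (Suc n) w"
    proof (rule mult_left_mono)
      have "m + real (Suc j) * (1 / N) \<le> m + b" "m + a \<le> m + real j * (1 / N)"
        using j gap N by (simp_all add: field_simps)
      then show "(G ^^ n) (m + real (Suc j) * (1 / N)) - (G ^^ n) (m + real j * (1 / N)) \<le> len (Suc n) w"
        unfolding len_Suc m_def[symmetric] a_def[symmetric] b_def[symmetric]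
        by (intro diff_mono mono_Gn_le)
    qed (use R in simp)
    finally have "len n (right_shift w) / N \<le> R ^ N * len (Suc n) w"
      by (simp add: len_def m_def)
    then show "1 / (N * R ^ N) \<le> rho n w"
      using len_pos[of n "right_shift w"] N R by (simp add: rho_def field_simps)
  qed
qed

lemma rho_agree:
  assumes "agree (Suc n) x y" shows "rho n x = rho n y"
proof -
  have "val (Suc n) x = val (Suc n) y" "val n (right_shift x) = val n (right_shift y)"
    using assms by (auto simp: val_def agree_def right_shift_def intro!: sum.cong)
  then show ?thesis by (simp add: rho_def len_def)
qed

text \<open>Some sibling occupies at least the proportion c of the parent, so no child exceeds the
  proportion 1 - c. Multiplying along the levels gives uniform exponential decay.\<close>

lemma len_small:
  obtains \<theta> where "0 \<le> \<theta>" "\<theta> < 1" "\<And>n w. w \<in> dual_space d \<Longrightarrow> len n w \<le> \<theta> ^ n"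
proof -
  obtain c where c: "0 < c" "\<And>n w. w \<in> dual_space d \<Longrightarrow> c \<le> rho n w" using rho_lower_bound by blast
  have rho_le: "rho n w \<le> 1 - c" if w: "w \<in> dual_space d" for n w
  proof -
    \<comment> \<open>A digit other than w(0), which exists since d \<ge> 2.\<close>
    define j where "j = (if w 0 = 0 then 1 else 0 :: nat)"
    define h where "h i = rho n (cons_seq i (right_shift w))" for i
    have h: "c \<le> h i" if "i < d" for i using that w c by (simp add: h_def)
    have j: "j < d" "j \<noteq> w 0" "w 0 < d" using d2 w by (auto simp: j_def dual_space_def)
    have "h (w 0) + h j = sum h {w 0, j}" using j by simp
    also have "\<dots> \<le> sum h {..<d}" using j h c by (intro sum_mono2) (auto intro: order.trans[OF less_imp_le])
    also have "\<dots> = 1" by (simp add: h_def rho_sum)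
    finally show ?thesis using h[OF j(1)] by (simp add: h_def cons_seq_right_shift)
  qed
  have "0 \<le> 1 - c" using rho_le[of "\<lambda>_. 0" 0] c(2)[of "\<lambda>_. 0" 0] c(1) d2 by simp
  moreover have "len n w \<le> (1 - c) ^ n" if "w \<in> dual_space d" for n w
    using that
  proof (induction n arbitrary: w)
    case (Suc n)
    have "len (Suc n) w = rho n w * len n (right_shift w)"
      using len_pos[of n "right_shift w"] by (simp add: rho_def)
    also have "\<dots> \<le> (1 - c) * (1 - c) ^ n"
      using Suc rho_le \<open>0 \<le> 1 - c\<close> len_pos[of n "right_shift w"] by (intro mult_mono) auto
    finally show ?case by simp
  qed (simp add: len_def)
  ultimately show ?thesis using that[of "1 - c"] c(1) by simp
qed

text \<open>Adding k digits on the left applies \<open>G ^^ k\<close> to a translate of the level n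
  picture. For large n that picture is uniformly small, so both endpoints of the child keep their
  relative positions up to e / 2, whatever k is.\<close>

lemma rho_uniformly_Cauchy:
  assumes "0 < e"
  obtains n0 where "\<And>n k w. n0 \<le> n \<Longrightarrow> w \<in> dual_space d \<Longrightarrow> \<bar>rho (n + k) w - rho n w\<bar> \<le> e"
proof -
  obtain L0 where L0: "0 < L0" and dist: "\<And>L k x s. 0 < L \<Longrightarrow> L < L0 \<Longrightarrow> 0 \<le> s \<Longrightarrow> s \<le> 1 \<Longrightarrow>
       \<bar>((G ^^ k) (x + s * L) - (G ^^ k) x) / ((G ^^ k) (x + L) - (G ^^ k) x) - s\<bar> \<le> e / 2"
    using uniform_distortion[of "e / 2"] assms by auto
  obtain \<theta> where \<theta>: "0 \<le> \<theta>" "\<theta> < 1" "\<And>n w. w \<in> dual_space d \<Longrightarrow> len n w \<le> \<theta> ^ n"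
    using len_small by blast
  have "(\<lambda>n. \<theta> ^ n) \<longlonglongrightarrow> 0" using \<theta> by (intro LIMSEQ_power_zero) auto
  then have "eventually (\<lambda>n. \<theta> ^ n < L0) sequentially" using L0 by (rule order_tendstoD(2))
  then obtain n0 where n0: "\<And>n. n0 \<le> n \<Longrightarrow> \<theta> ^ n < L0" unfolding eventually_sequentially by blast
  show ?thesis
  proof (rule that[of n0])
    fix n k w assume n: "n0 \<le> n" and w: "w \<in> dual_space d"
    define v where "v = right_shift w"
    define m where "m = val n v"
    define a where "a = G (real (w 0))"
    define b where "b = G (real (w 0) + 1)"
    \<comment> \<open>The additional digits of higher weight: after \<open>G ^^ n\<close> they
      merely translate by the integer j, which leaves relative positions unchanged.\<close>
    define j where "j = (\<Sum>i<k. (right_shift ^^ n) v i * d ^ i)"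
    define L where "L = len n v"
    define x where "x = (G ^^ n) m + real j"
    have ab: "a \<in> {0..1}" "b \<in> {0..1}" unfolding a_def b_def using dual_digit[OF w] by (intro G_unit; auto)+
    have v: "v \<in> dual_space d" using w by (simp add: v_def)
    have L: "0 < L" "L < L0" using len_pos \<theta>(3)[OF v, of n] n0[OF n] by (auto simp: L_def)
    have valnk: "val (n + k) v = m + real d ^ n * real j"
      by (simp add: val_add m_def j_def val_nat[of k])
    \<comment> \<open>Relative position of an offset y in the parent of level n; \<open>u\<close>
      below is the position of the same offset after applying \<open>G ^^ k\<close>.\<close>
    define s where "s y = ((G ^^ n) (m + y) - (G ^^ n) m) / L" for y
    have s01: "0 \<le> s y" "s y \<le> 1" if "y \<in> {0..1}" for y
      using that L by (auto simp: s_def L_def len_def m_def divide_simps intro!: mono_Gn_le)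
    have shift: "(G ^^ (n + k)) (val (n + k) v + y) = (G ^^ k) (x + s y * L)" for y
    proof -
      have "(G ^^ n) (val (n + k) v + y) = (G ^^ n) (m + y) + real j"

        using Gn_period[of n "m + y" j] 
        unfolding valnk by (simp only: ac_simps)
      then have "(G ^^ (n + k)) (val (n + k) v + y) = (G ^^ k) ((G ^^ n) (m + y) + real j)"
        by (simp add: add.commute[of n k] funpow_add)
      also have "(G ^^ n) (m + y) + real j = x + s y * L" using L by (simp add: x_def s_def)
      finally show ?thesis .
    qed
    have s0: "s 0 = 0" "s 1 = 1" using L by (simp_all add: s_def L_def len_def m_def)
    define u where "u y = ((G ^^ k) (x + s y * L) - (G ^^ k) x) / ((G ^^ k) (x + L) - (G ^^ k) x)" for y
    have us: "\<bar>u y - s y\<bar> \<le> e / 2" if "y \<in> {0..1}" for y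
      unfolding u_def by (rule dist[OF L s01[OF that]])
    have "rho (n + k) w = u b - u a"
      using shift[of 0] shift[of 1] shift[of a] shift[of b] s0
      unfolding rho_def len_Suc v_def[symmetric] a_def[symmetric] b_def[symmetric]
      by (simp add: len_def u_def diff_divide_distrib)
    moreover have "rho n w = s b - s a"
      unfolding rho_def len_Suc v_def[symmetric] a_def[symmetric] b_def[symmetric] m_def[symmetric] L_def[symmetric]
      by (simp add: s_def diff_divide_distrib)
    ultimately show "\<bar>rho (n + k) w - rho n w\<bar> \<le> e" using us[OF ab(1)] us[OF ab(2)] by linarith
  qed
qed

section \<open>The limit function and the dual derivative\<close>

definition dual_g :: "(nat \<Rightarrow> nat) \<Rightarrow> real" where "dual_g w = lim (\<lambda>n. rho n w)"

lemma rho_tendsto: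
  assumes w: "w \<in> dual_space d" shows "(\<lambda>n. rho n w) \<longlonglongrightarrow> dual_g w"
proof -
  have "Cauchy (\<lambda>n. rho n w)"
  proof (rule CauchyI')
    fix e :: real assume "0 < e"
    then obtain n0 where n0: "\<And>n k w. n0 \<le> n \<Longrightarrow> w \<in> dual_space d \<Longrightarrow> \<bar>rho (n + k) w - rho n w\<bar> \<le> e / 2"
      using rho_uniformly_Cauchy[of "e / 2"] by auto
    show "\<exists>M. \<forall>m\<ge>M. \<forall>n>m. dist (rho m w) (rho n w) < e"
    proof (intro exI allI impI)
      fix m n assume "n0 \<le> m" "m < n"
      then show "dist (rho m w) (rho n w) < e" 
        using n0[of m w "n - m"] w \<open>0 < e\<close> by (simp add: dist_real_def abs_minus_commute)
    qed
  qed
  then show ?thesis by (simp add: dual_g_def Cauchy_convergent_iff convergent_LIMSEQ_iff)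
qed

text \<open>A uniform limit of the functions \<open>rho n\<close>, each of which depends on n + 1
  digits only.\<close>

lemma dual_g_continuous: "continuous_on (dual_space d) dual_g"
  unfolding continuous_on_dual_iff
proof (intro allI impI)
  fix e :: real assume e: "0 < e"
  then obtain n where n: "\<And>k w. w \<in> dual_space d \<Longrightarrow> \<bar>rho (n + k) w - rho n w\<bar> \<le> e / 3"
    using rho_uniformly_Cauchy[of "e / 3"] by (metis order_refl divide_pos_pos zero_less_numeral)
  have close: "\<bar>dual_g w - rho n w\<bar> \<le> e / 3" if w: "w \<in> dual_space d" for w
  proof (rule tendsto_upperbound)
    show "(\<lambda>k. \<bar>rho (k + n) w - rho n w\<bar>) \<longlonglongrightarrow> \<bar>dual_g w - rho n w\<bar>"
      by (intro tendsto_intros LIMSEQ_ignore_initial_segment rho_tendsto w)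
    show "\<forall>\<^sub>F k in sequentially. \<bar>rho (k + n) w - rho n w\<bar> \<le> e / 3"
      using n[OF w] by (simp add: add.commute)
  qed simp
  show "\<exists>m. \<forall>x\<in>dual_space d. \<forall>y\<in>dual_space d. agree m x y \<longrightarrow> \<bar>dual_g x - dual_g y\<bar> < e"
  proof (intro exI ballI impI)
    fix x y assume xy: "x \<in> dual_space d" "y \<in> dual_space d" "agree (Suc n) x y"
    show "\<bar>dual_g x - dual_g y\<bar> < e"
      using close[OF xy(1)] close[OF xy(2)] rho_agree[OF xy(3)] e by linarith
  qed
qed

lemma dual_g_pos: assumes w: "w \<in> dual_space d" shows "0 < dual_g w"
proof -
  obtain c where c: "0 < c" "\<And>n w. w \<in> dual_space d \<Longrightarrow> c \<le> rho n w" using rho_lower_bound by blast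
  have "c \<le> dual_g w" using c(2)[OF w] by (intro tendsto_lowerbound[OF rho_tendsto[OF w]]) auto
  with c show ?thesis by simp
qed

lemma dual_g_sum: assumes x: "x \<in> dual_space d" shows "(\<Sum>i<d. dual_g (cons_seq i x)) = 1"
proof -
  have "(\<lambda>n. \<Sum>i<d. rho n (cons_seq i x)) \<longlonglongrightarrow> (\<Sum>i<d. dual_g (cons_seq i x))"
    using x by (intro tendsto_sum rho_tendsto) auto
  then show ?thesis by (simp add: rho_sum LIMSEQ_const_iff)
qed

lemma measure_word_interval:
  assumes "inv (lift_of d f) = G"
  shows "measure lborel (word_interval d f (map w (rev [0..<n]))) = len n w"
    and "measure lborel (word_interval d f (map w (rev [1..<Suc n]))) = len n (right_shift w)"
proof -
  have A: "measure lborel (word_interval d f (map w (rev [0..<n]))) = len n w" for w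
  proof -
    \<comment> \<open>Position k of the word carries w(n - 1 - k), so the sum over positions is the
      sum over digit indices in reverse order.\<close>
    have "word_value d (map w (rev [0..<n])) = (\<Sum>k<n. w (n - Suc k) * d ^ (n - Suc k))"
      unfolding word_value_def by (intro sum.cong) (auto simp: rev_nth)
    also have "\<dots> = (\<Sum>k<n. w k * d ^ k)"
      by (rule sum.nat_diff_reindex)
    finally have v: "real (word_value d (map w (rev [0..<n]))) = val n w" by (simp add: val_nat)
    have surj: "\<exists>x. y = (G ^^ n) x" for y
      using bij_fn[OF bij_G, of n] by (metis bij_pointE)
    have "(G ^^ n) ` {val n w..val n w + 1} = {(G ^^ n) (val n w)..(G ^^ n) (val n w + 1)}"
      using surj by (auto simp: Gn_le_iff image_iff) (metis Gn_le_iff atLeastAtMost_iff)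
    then show ?thesis
      using assms mono_Gn_le[of "val n w" "val n w + 1" n] by (simp add: word_interval_def v len_def)
  qed
  show "measure lborel (word_interval d f (map w (rev [0..<n]))) = len n w" by (rule A)
  have "map w (rev [1..<Suc n]) = map (right_shift w) (rev [0..<n])"
    by (simp add: rev_map[symmetric] right_shift_def map_Suc_upt[symmetric] del: upt_Suc map_Suc_upt)
  then show "measure lborel (word_interval d f (map w (rev [1..<Suc n]))) = len n (right_shift w)"
    by (simp only: A)
qed

lemma dual_derivative_eq:
  assumes "inv (lift_of d f) = G" "w \<in> dual_space d"
  shows "dual_derivative d f w = 1 / dual_g w"
proof -
  define q where "q n = measure lborel (word_interval d f (map w (rev [1..<n]))) /
              measure lborel (word_interval d f (map w (rev [0..<n])))" for n
  \<comment> \<open>The quotient of index 0 is dropped; from index 1 on, the words have lengths n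
    and n + 1.\<close>
  have "q (Suc n) = 1 / rho n w" for n
    unfolding q_def measure_word_interval[OF assms(1)] rho_def by simp
  moreover have "(\<lambda>n. 1 / rho n w) \<longlonglongrightarrow> 1 / dual_g w"
    using dual_g_pos[OF assms(2)] by (intro tendsto_intros rho_tendsto assms) auto
  ultimately have "(\<lambda>n. q (Suc n)) \<longlonglongrightarrow> 1 / dual_g w" by simp
  then have "q \<longlonglongrightarrow> 1 / dual_g w" by (simp add: filterlim_sequentially_Suc)
  then show ?thesis unfolding dual_derivative_def q_def by (rule limI)
qed

end

text \<open>The passage from circle maps to symbolic dynamics. Uniqueness of lifts identifies
  \<open>lift_of\<close> with the increasing lift, whose inverse then meets the assumptions on
  \<open>G\<close>.\<close>

lemma TUS_normalized:
  assumes "2 \<le> d" "\<Psi> \<in> TUS d"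
  obtains g where "continuous_on (dual_space d) g" "\<And>w. w \<in> dual_space d \<Longrightarrow> 0 < g w"
    "\<And>x. x \<in> dual_space d \<Longrightarrow> (\<Sum>i<d. g (cons_seq i x)) = 1"
    "\<And>w. w \<in> dual_space d \<Longrightarrow> \<Psi> w = 1 / g w"
proof -
  obtain f where f: "uniformly_symmetric d f" and \<Psi>: "\<And>w. w \<in> dual_space d \<Longrightarrow> \<Psi> w = dual_derivative d f w"
    using assms by (auto simp: TUS_def)
  define G where "G = inv (lift_of d f)"
  obtain F where F: "circle_lift d f F" "strict_mono F"
    using f by (auto simp: uniformly_symmetric_def circle_endomorphism_def)
  have lift: "lift_of d f = F"
    unfolding lift_of_def using F circle_lift_unique by blast
  obtain K where K: "homeomorphism UNIV UNIV F K" using F by (auto simp: circle_lift_def)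
  have bijF: "bij F" using K by (intro bijI') (auto simp: homeomorphism_def, metis+)
  have GF: "G (F x) = x" "F (G x) = x" for x
    using bijF by (simp_all add: G_def lift bij_is_inj bij_is_surj surj_f_inv_f)
  obtain \<epsilon> where \<epsilon>: "\<And>t. 0 < t \<Longrightarrow> 0 < \<epsilon> t" "bounded (\<epsilon> ` {0<..})" "(\<epsilon> \<longlongrightarrow> 0) (at_right 0)"
    "\<And>x t n. 0 < t \<Longrightarrow> 0 < n \<Longrightarrow> 1 / (1 + \<epsilon> t) \<le> \<bar>(G ^^ n) (x + t) - (G ^^ n) x\<bar> / \<bar>(G ^^ n) x - (G ^^ n) (x - t)\<bar> \<and>
           \<bar>(G ^^ n) (x + t) - (G ^^ n) x\<bar> / \<bar>(G ^^ n) x - (G ^^ n) (x - t)\<bar> \<le> 1 + \<epsilon> t"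
    using f unfolding uniformly_symmetric_def Let_def G_def[symmetric] by blast
  interpret symmetric_inverse_lift d G \<epsilon>
  proof
    show "bij G" using bijF by (simp add: G_def lift bij_imp_bij_inv)
    show "strict_mono G" using F(2) GF by (metis strict_monoI strict_mono_less)
    show "G 0 = 0" using GF(1)[of 0] F by (simp add: circle_lift_def)
    show "G (x + real d) = G x + 1" for x
      using GF(1)[of "G x + 1"] F GF(2)[of x] by (simp add: circle_lift_def)
  qed (use assms \<epsilon> in auto)
  show ?thesis
    using dual_g_continuous dual_g_pos dual_g_sum \<Psi> dual_derivative_eq[OF G_def[symmetric]]
    by (intro that[of dual_g]) auto
qed

subsection \<open>Construction of the g-measure\<close>

locale normalized_potential =
  fixes d :: nat and g :: "(nat \<Rightarrow> nat) \<Rightarrow> real"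
  assumes d2: "2 \<le> d" and g_cont: "continuous_on (dual_space d) g"
    and g_pos: "w \<in> dual_space d \<Longrightarrow> 0 < g w"
    and g_sum: "x \<in> dual_space d \<Longrightarrow> (\<Sum>i<d. g (cons_seq i x)) = 1"
begin

section \<open>Transfer operator and Cesaro means\<close>

definition birkhoff :: "nat \<Rightarrow> (nat \<Rightarrow> nat) \<Rightarrow> real" where
  "birkhoff n x = (\<Prod>i<n. g ((right_shift ^^ i) x))"

abbreviation transfer :: "((nat \<Rightarrow> nat) \<Rightarrow> real) \<Rightarrow> (nat \<Rightarrow> nat) \<Rightarrow> real" where
  "transfer \<equiv> transfer_op d g"

text \<open>The n-th iterate of the transfer operator applied to \<phi>, evaluated at the zero
  sequence.\<close>

definition branch_sum :: "nat \<Rightarrow> ((nat \<Rightarrow> nat) \<Rightarrow> real) \<Rightarrow> real" where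
  "branch_sum n \<phi> = (\<Sum>y\<in>fibre d n. birkhoff n y * \<phi> y)"

definition cesaro :: "nat \<Rightarrow> ((nat \<Rightarrow> nat) \<Rightarrow> real) \<Rightarrow> real" where
  "cesaro n \<phi> = (\<Sum>j<n. branch_sum j \<phi>) / real n"

lemma d_pos [simp]: "0 < d" using d2 by simp

lemma birkhoff_Suc: "birkhoff (Suc n) x = g x * birkhoff n (right_shift x)"
  unfolding birkhoff_def
  by (subst prod.lessThan_Suc_shift) (simp add: funpow_Suc_right del: funpow.simps)

lemma birkhoff_pos: "x \<in> dual_space d \<Longrightarrow> 0 < birkhoff n x"
  unfolding birkhoff_def by (intro prod_pos) (simp add: g_pos)

lemma branch_sum_Suc: "branch_sum (Suc n) \<phi> = branch_sum n (transfer \<phi>)"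
  unfolding branch_sum_def sum_fibre_Suc
proof (rule sum.cong[OF refl])
  fix y assume "y \<in> fibre d n"
  then have "y \<in> dual_space d" using fibre_subset by blast
  then show "(\<Sum>i<d. birkhoff (Suc n) (cons_seq i y) * \<phi> (cons_seq i y)) = birkhoff n y * transfer \<phi> y"
    by (simp add: birkhoff_Suc transfer_op_eq sum_distrib_left mult_ac)
qed

lemma transfer_const: "x \<in> dual_space d \<Longrightarrow> transfer (\<lambda>_. c) x = c"
  by (simp add: transfer_op_eq g_sum sum_distrib_left[symmetric])

lemma branch_sum_mono:
  assumes "\<And>x. x \<in> dual_space d \<Longrightarrow> \<phi> x \<le> \<psi> x" shows "branch_sum n \<phi> \<le> branch_sum n \<psi>"
  unfolding branch_sum_def
proof (rule sum_mono)
  fix y assume "y \<in> fibre d n"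
  then have y: "y \<in> dual_space d" using fibre_subset by blast
  show "birkhoff n y * \<phi> y \<le> birkhoff n y * \<psi> y"
    using assms[OF y] birkhoff_pos[OF y, of n] by (simp add: mult_left_mono)
qed

lemma branch_sum_const: "branch_sum n (\<lambda>_. c) = c"
proof (induction n)
  case 0
  show ?case by (simp add: branch_sum_def fibre_0 birkhoff_def)
next
  case (Suc n)
  have "branch_sum n (transfer (\<lambda>_. c)) = branch_sum n (\<lambda>_. c)"
    by (intro antisym branch_sum_mono) (simp_all add: transfer_const)
  with Suc show ?case by (simp add: branch_sum_Suc)
qed

lemma sum_birkhoff: "(\<Sum>y\<in>fibre d n. birkhoff n y) = 1"
  using branch_sum_const[of n 1] by (simp add: branch_sum_def)

lemma cesaro_mono:
  assumes "\<And>x. x \<in> dual_space d \<Longrightarrow> \<phi> x \<le> \<psi> x" shows "cesaro n \<phi> \<le> cesaro n \<psi>"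
  unfolding cesaro_def using assms by (intro divide_right_mono sum_mono branch_sum_mono) auto

lemma cesaro_cong:
  assumes "\<And>x. x \<in> dual_space d \<Longrightarrow> \<phi> x = \<psi> x" shows "cesaro n \<phi> = cesaro n \<psi>"
  by (intro antisym cesaro_mono) (use assms in auto)

lemma cesaro_const: "0 < n \<Longrightarrow> cesaro n (\<lambda>_. c) = c"
  by (simp add: cesaro_def branch_sum_const)

lemma cesaro_add: "cesaro n (\<lambda>x. \<phi> x + \<psi> x) = cesaro n \<phi> + cesaro n \<psi>"
  by (simp add: cesaro_def branch_sum_def distrib_left sum.distrib add_divide_distrib)

lemma cesaro_cmult: "cesaro n (\<lambda>x. c * \<phi> x) = c * cesaro n \<phi>"
  by (simp add: cesaro_def branch_sum_def sum_distrib_left mult_ac)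

lemma cesaro_sum: "finite I \<Longrightarrow> cesaro n (\<lambda>x. \<Sum>i\<in>I. \<phi> i x) = (\<Sum>i\<in>I. cesaro n (\<phi> i))"
proof (induction I rule: finite_induct)
  case empty
  then show ?case by (simp add: cesaro_def branch_sum_def)
qed (simp add: cesaro_add)

lemma cesaro_close:
  assumes "0 < n" "\<And>x. x \<in> dual_space d \<Longrightarrow> \<bar>\<phi> x - \<psi> x\<bar> \<le> e"
  shows "\<bar>cesaro n \<phi> - cesaro n \<psi>\<bar> \<le> e"
proof -
  have "cesaro n \<phi> \<le> cesaro n (\<lambda>x. \<psi> x + e)" "cesaro n \<psi> \<le> cesaro n (\<lambda>x. \<phi> x + e)"
    using assms(2) by (auto intro!: cesaro_mono simp: abs_le_iff algebra_simps)
  then show ?thesis using assms(1) by (simp add: cesaro_add[of _ _ "\<lambda>_. e"] cesaro_const)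
qed

text \<open>Applying the operator shifts the mean by one index, so all but the two end terms cancel.
  Hence every limit of these means is fixed by the dual operator.\<close>

lemma cesaro_transfer:
  assumes "0 < n" "\<And>x. x \<in> dual_space d \<Longrightarrow> \<bar>\<phi> x\<bar> \<le> B"
  shows "\<bar>cesaro n (transfer \<phi>) - cesaro n \<phi>\<bar> \<le> 2 * B / n"
proof -
  have b: "\<bar>branch_sum k \<phi>\<bar> \<le> B" for k
    using branch_sum_mono[of \<phi> "\<lambda>_. B" k] branch_sum_mono[of "\<lambda>_. - B" \<phi> k] assms(2)
    by (auto simp: branch_sum_const abs_le_iff) (smt (verit))+
  have "(\<Sum>j<n. branch_sum j (transfer \<phi>)) - (\<Sum>j<n. branch_sum j \<phi>) = branch_sum n \<phi> - branch_sum 0 \<phi>"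
    using sum_lessThan_telescope[of "\<lambda>j. branch_sum j \<phi>" n]
    by (simp add: branch_sum_Suc[symmetric] sum_subtractf)
  then have "cesaro n (transfer \<phi>) - cesaro n \<phi> = (branch_sum n \<phi> - branch_sum 0 \<phi>) / n"
    by (simp add: cesaro_def diff_divide_distrib[symmetric])
  moreover have "\<bar>branch_sum n \<phi> - branch_sum 0 \<phi>\<bar> \<le> 2 * B" using b[of n] b[of 0] by linarith
  ultimately show ?thesis using assms(1) by (simp add: divide_right_mono)
qed

section \<open>Weak limits of the Cesaro means\<close>

lemma pad_decomposition:
  fixes \<phi> :: "_ \<Rightarrow> real"
  assumes "x \<in> dual_space d"
  shows "\<phi> (pad m x) = (\<Sum>y\<in>fibre d m. \<phi> y * indicator (right_cylinder d y m) x)"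
proof -
  have "(\<Sum>y\<in>fibre d m. \<phi> y * indicator (right_cylinder d y m) x) =
    (\<Sum>y\<in>fibre d m. if pad m x = y then \<phi> y else 0)"
    using assms
    by (intro sum.cong refl) (auto simp: right_cylinder_eq pad_eq_fibre_iff indicator_def)
  then show ?thesis using pad_in_fibre[OF assms] by simp
qed

text \<open>The means of all cylinder indicators form a point of a cube with one coordinate per
  word. There are countably many words, so the cube is sequentially compact and one subsequence
  serves every cylinder.\<close>

lemma cesaro_subsequence:
  obtains r where "strict_mono (r :: nat \<Rightarrow> nat)"
    "\<And>m \<phi>. convergent (\<lambda>k. cesaro (r k) (\<lambda>x. \<phi> (pad m x)))"
proof -
  define cyl where "cyl u = {v \<in> dual_space d. \<forall>k<length u. v k = u ! k}" for u :: "nat list"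
  define a where "a n u = cesaro (Suc n) (indicator (cyl u))" for n u
  have "compactin (product_topology (\<lambda>_::nat list. euclidean :: real topology) UNIV) (PiE UNIV (\<lambda>_. {0..1}))"
    by (simp add: compactin_PiE)
  then have "compact (PiE UNIV (\<lambda>_::nat list. {0..1::real}))" by (simp add: euclidean_product_topology)
  then have sc: "seq_compact (PiE UNIV (\<lambda>_::nat list. {0..1::real}))" by (rule compact_imp_seq_compact)
  have "a n u \<in> {0..1}" for n u
    using cesaro_mono[of "\<lambda>_. 0" "indicator (cyl u)" "Suc n"] cesaro_mono[of "indicator (cyl u)" "\<lambda>_. 1" "Suc n"]
    by (simp add: a_def cesaro_const)
  then have "\<forall>n. a n \<in> PiE UNIV (\<lambda>_. {0..1})" by (simp add: PiE_iff)
  then obtain l r where r: "strict_mono (r :: nat \<Rightarrow> nat)" and l: "(a \<circ> r) \<longlonglongrightarrow> l"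
    using seq_compactE[OF sc] by metis
  have lim: "(\<lambda>k. a (r k) u) \<longlonglongrightarrow> l u" for u
    using continuous_on_tendsto_compose[OF continuous_on_product_coordinates[of u] l] by (simp add: o_def)
  show ?thesis
  \<comment> \<open>The sequence \<open>a\<close> starts with the mean of length 1, as the mean of
    length 0 is a division by zero.\<close>
  proof (rule that[of "\<lambda>k. Suc (r k)"])
    show "strict_mono (\<lambda>k. Suc (r k))" using r by (simp add: strict_mono_def)
    fix m and \<phi> :: "_ \<Rightarrow> real"
    have cyl: "right_cylinder d y m = cyl (map y [0..<m])" for y by (auto simp: right_cylinder_def cyl_def)
    have "cesaro n (\<lambda>x. \<phi> (pad m x)) = (\<Sum>y\<in>fibre d m. \<phi> y * cesaro n (indicator (cyl (map y [0..<m]))))" for n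
      unfolding cesaro_cmult[symmetric]
      by (subst cesaro_sum[symmetric]) (auto intro!: cesaro_cong simp: pad_decomposition cyl)
    then have "cesaro (Suc (r k)) (\<lambda>x. \<phi> (pad m x)) = (\<Sum>y\<in>fibre d m. \<phi> y * a (r k) (map y [0..<m]))" for k
      by (simp add: a_def)
    moreover have "(\<lambda>k. \<Sum>y\<in>fibre d m. \<phi> y * a (r k) (map y [0..<m])) \<longlonglongrightarrow>
      (\<Sum>y\<in>fibre d m. \<phi> y * l (map y [0..<m]))"
      by (intro tendsto_intros lim)
    ultimately show "convergent (\<lambda>k. cesaro (Suc (r k)) (\<lambda>x. \<phi> (pad m x)))"
      by (auto simp: convergent_def)
  qed
qed

text \<open>Nested nonempty closed subsets of a compact space have a common point. This is the
  continuity at the empty set that makes an additive set function on clopen sets countably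
  additive.\<close>

lemma decseq_clopen_empty:
  assumes A: "range A \<subseteq> dual_clopen d" "decseq A" "(\<Inter>i. A i) = {}"
  shows "\<exists>n. A n = {}"
proof (rule ccontr)
  assume ne: "\<nexists>n. A n = {}"
  have "dual_space d \<inter> (\<Inter>i\<in>UNIV. A i) \<noteq> {}"
  proof (rule compact_imp_fip_image[OF compact_dual_space])
    show "closed (A i)" for i using A(1) closed_dual_clopen by blast
    fix I' :: "nat set" assume I': "finite I'"
    define N where "N = Max (insert 0 I')"
    have "A N \<subseteq> A i" if "i \<in> I'" for i
      using A(2) I' that by (auto simp: decseq_def N_def)
    moreover have "A N \<subseteq> dual_space d" "A N \<noteq> {}" using A(1) dual_clopen_subset ne by blast+
    ultimately show "dual_space d \<inter> (\<Inter>i\<in>I'. A i) \<noteq> {}" by blast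
  qed
  with A(3) show False by simp
qed

lemma g_measure_exists:
  obtains \<mu> where "prob_space \<mu>" "sets \<mu> = sets (dual_borel d)"
    "\<And>\<phi>. continuous_on (dual_space d) \<phi> \<Longrightarrow> integral\<^sup>L \<mu> \<phi> = integral\<^sup>L \<mu> (transfer \<phi>)"
proof -
  interpret A: algebra "dual_space d" "dual_clopen d" by (rule algebra_dual_clopen)
  obtain r :: "nat \<Rightarrow> nat" where r: "strict_mono r" and
    conv: "\<And>m \<phi>. convergent (\<lambda>k. cesaro (r k) (\<lambda>x. \<phi> (pad m x)))"
    using cesaro_subsequence by blast
  \<comment> \<open>Only \<open>r 0\<close> might vanish; there the mean has the default value 0
    even for constants.\<close>
  have r_pos: "0 < r (Suc k)" for k using strict_mono_less[OF r, of 0 "Suc k"] by simp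
  have ev_pos: "eventually (\<lambda>k. 0 < r k) sequentially"
    using r_pos by (auto simp: eventually_sequentially Suc_le_eq intro!: exI[of _ 1]) (metis gr0_conv_Suc)
  define f where "f A = lim (\<lambda>k. cesaro (r k) (indicator A))" for A :: "(nat \<Rightarrow> nat) set"
  have f_lim: "(\<lambda>k. cesaro (r k) (indicator A)) \<longlonglongrightarrow> f A" if A: "A \<in> dual_clopen d" for A
  proof -
    obtain m where m: "\<And>k x y. m \<le> k \<Longrightarrow> x \<in> dual_space d \<Longrightarrow> y \<in> dual_space d \<Longrightarrow> agree k x y \<Longrightarrow> x \<in> A \<longleftrightarrow> y \<in> A"
      using A by (rule dual_clopenE) blast
    have "cesaro n (indicator A) = cesaro n (\<lambda>x. indicator A (pad m x))" for n
    proof (rule cesaro_cong)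
      fix x assume x: "x \<in> dual_space d"
      have "x \<in> A \<longleftrightarrow> pad m x \<in> A" by (rule m[OF order_refl x pad_in_dual[OF x] agree_pad])
      then show "indicator A x = (indicator A (pad m x) :: real)" by (simp add: indicator_def)
    qed
    then show ?thesis unfolding f_def using conv[of "indicator A" m] by (simp add: convergent_LIMSEQ_iff)
  qed
  have f_nonneg: "0 \<le> f A" if "A \<in> dual_clopen d" for A
    using cesaro_mono[of "\<lambda>_. 0" "indicator A"]
    by (intro LIMSEQ_le_const[OF f_lim[OF that]]) (auto simp: cesaro_def branch_sum_const)
  have f_add: "f (A \<union> B) = f A + f B" if "A \<in> dual_clopen d" "B \<in> dual_clopen d" "A \<inter> B = {}" for A B
  proof (rule LIMSEQ_unique[OF f_lim])
    have "(\<lambda>k. cesaro (r k) (indicator A) + cesaro (r k) (indicator B)) \<longlonglongrightarrow> f A + f B"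
      using that by (intro tendsto_add f_lim)
    moreover have "indicator (A \<union> B) = (\<lambda>x. indicator A x + indicator B x :: real)"
      using that by (auto simp: indicator_def fun_eq_iff)
    ultimately show "(\<lambda>k. cesaro (r k) (indicator (A \<union> B))) \<longlonglongrightarrow> f A + f B"
      by (simp add: cesaro_add)
  qed (use that in auto)
  have f_empty: "f {} = 0" using f_add[of "{}" "{}"] by simp
  have f_space: "f (dual_space d) = 1"
  proof (rule LIMSEQ_unique[OF f_lim])
    have "eventually (\<lambda>k. cesaro (r k) (indicator (dual_space d)) = 1) sequentially"
      using ev_pos
    proof eventually_elim
      case (elim k)
      have "cesaro (r k) (indicator (dual_space d)) = cesaro (r k) (\<lambda>_. 1)"
        by (intro cesaro_cong) auto
      with elim show ?case by (simp add: cesaro_const)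
    qed
    then show "(\<lambda>k. cesaro (r k) (indicator (dual_space d))) \<longlonglongrightarrow> 1" by (rule tendsto_eventually)
  qed simp
  \<comment> \<open>Caratheodory extension from the clopen algebra; continuity at the empty set is
    trivial since the sets themselves become empty.\<close>
  have "\<exists>\<mu>'::(nat \<Rightarrow> nat) set \<Rightarrow> ennreal. (\<forall>s\<in>dual_clopen d. \<mu>' s = ennreal (f s)) \<and>
      measure_space (dual_space d) (sigma_sets (dual_space d) (dual_clopen d)) \<mu>'"
  proof (rule A.caratheodory_empty_continuous)
    show "positive (dual_clopen d) (\<lambda>x. ennreal (f x))" by (simp add: positive_def f_empty)
    show "additive (dual_clopen d) (\<lambda>x. ennreal (f x))"
      by (auto simp: additive_def f_add f_nonneg ennreal_plus)
    fix A assume A: "range A \<subseteq> dual_clopen d" "decseq A" "(\<Inter>i. A i) = {}"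
    then obtain n where "A n = {}" using decseq_clopen_empty by blast
    then have "A k = {}" if "n \<le> k" for k using A(2) that by (auto simp: decseq_def)
    then have "eventually (\<lambda>k. ennreal (f (A k)) = 0) sequentially"
      by (auto simp: eventually_sequentially f_empty intro!: exI[of _ n])
    then show "(\<lambda>i. ennreal (f (A i))) \<longlonglongrightarrow> 0" by (rule tendsto_eventually)
  qed simp
  then obtain \<mu>' :: "(nat \<Rightarrow> nat) set \<Rightarrow> ennreal" where \<mu>': "\<And>s. s \<in> dual_clopen d \<Longrightarrow> \<mu>' s = ennreal (f s)"
      "measure_space (dual_space d) (sigma_sets (dual_space d) (dual_clopen d)) \<mu>'" by blast
  define \<mu> where "\<mu> = measure_of (dual_space d) (dual_clopen d) \<mu>'"
  have sets: "sets \<mu> = sets (dual_borel d)"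
    unfolding \<mu>_def sets_dual_borel by (rule sets_measure_of) (use dual_clopen_subset in auto)
  have space: "space \<mu> = dual_space d" using sets_eq_imp_space_eq[OF sets] by simp
  have em: "emeasure \<mu> A = ennreal (f A)" if "A \<in> dual_clopen d" for A
    using \<mu>' that by (simp add: \<mu>_def emeasure_measure_of_conv)
  have prob: "prob_space \<mu>"
    by (rule prob_spaceI) (simp add: space em f_space)
  interpret prob_space \<mu> by (rule prob)
  have meas: "measure \<mu> A = f A" if "A \<in> dual_clopen d" for A
    using that em f_nonneg by (simp add: measure_def)
  have lim_step: "(\<lambda>k. cesaro (r k) (\<lambda>x. \<phi> (pad m x))) \<longlonglongrightarrow> (\<integral>x. \<phi> (pad m x) \<partial>\<mu>)" for \<phi> m
  proof -
    have "(\<integral>x. \<phi> (pad m x) \<partial>\<mu>) = (\<integral>x. (\<Sum>y\<in>fibre d m. \<phi> y * indicator (right_cylinder d y m) x) \<partial>\<mu>)"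
      by (intro Bochner_Integration.integral_cong) (auto simp: pad_decomposition space)
    also have "\<dots> = (\<Sum>y\<in>fibre d m. \<phi> y * f (right_cylinder d y m))"
      using right_cylinder_sets[of d _ m] right_cylinder_clopen[of d _ m]
      by (subst Bochner_Integration.integral_sum) (auto simp: sets meas emeasure_eq_measure intro!: sum.cong)
    finally have I: "(\<integral>x. \<phi> (pad m x) \<partial>\<mu>) = (\<Sum>y\<in>fibre d m. \<phi> y * f (right_cylinder d y m))" .
    have "cesaro n (\<lambda>x. \<phi> (pad m x)) = (\<Sum>y\<in>fibre d m. \<phi> y * cesaro n (indicator (right_cylinder d y m)))" for n
      unfolding cesaro_cmult[symmetric]
      by (subst cesaro_sum[symmetric]) (auto intro!: cesaro_cong simp: pad_decomposition)
    then show ?thesis unfolding I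
      by (auto intro!: tendsto_intros f_lim right_cylinder_clopen)
  qed
  have lim_cont: "(\<lambda>k. cesaro (r k) \<phi>) \<longlonglongrightarrow> integral\<^sup>L \<mu> \<phi>" if cont: "continuous_on (dual_space d) \<phi>" for \<phi>
  proof (rule LIMSEQ_I)
    fix e :: real assume "0 < e"
    \<comment> \<open>Three errors of this size: replacing \<phi> by its padded version in the mean,
      the same in the integral, and the convergence for the padded version.\<close>
    then have "0 < e / 4" by simp
    then obtain m where m: "\<And>x y. x \<in> dual_space d \<Longrightarrow> y \<in> dual_space d \<Longrightarrow> agree m x y \<Longrightarrow> \<bar>\<phi> x - \<phi> y\<bar> < e / 4"
      using continuous_on_dualE[OF cont] by blast
    have close: "\<bar>\<phi> x - \<phi> (pad m x)\<bar> \<le> e / 4" if "x \<in> dual_space d" for x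
      using m[OF that pad_in_dual[OF that]] by (simp add: less_imp_le)
    have cont': "continuous_on (dual_space d) (\<lambda>x. \<phi> (pad m x))"
      unfolding continuous_on_dual_iff
      by (intro allI impI exI[of _ m] ballI) (metis pad_eq_iff abs_zero cancel_comm_monoid_add_class.diff_cancel)
    note int = continuous_on_dual_integrable[OF cont sets finite_measure_axioms]
      continuous_on_dual_integrable[OF cont' sets finite_measure_axioms]
    have "\<bar>integral\<^sup>L \<mu> \<phi> - (\<integral>x. \<phi> (pad m x) \<partial>\<mu>)\<bar> = \<bar>\<integral>x. \<phi> x - \<phi> (pad m x) \<partial>\<mu>\<bar>"
      using int by simp
    also have "\<dots> \<le> (\<integral>x. \<bar>\<phi> x - \<phi> (pad m x)\<bar> \<partial>\<mu>)" by (rule integral_abs_bound)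
    also have "\<dots> \<le> (\<integral>x. e / 4 \<partial>\<mu>)" using int close by (intro integral_mono) (auto simp: space)
    finally have I: "\<bar>integral\<^sup>L \<mu> \<phi> - (\<integral>x. \<phi> (pad m x) \<partial>\<mu>)\<bar> \<le> e / 4" by (simp add: prob_space)
    obtain k0 where k0: "\<And>k. k0 \<le> k \<Longrightarrow> \<bar>cesaro (r k) (\<lambda>x. \<phi> (pad m x)) - (\<integral>x. \<phi> (pad m x) \<partial>\<mu>)\<bar> < e / 4"
      using LIMSEQ_D[OF lim_step[of \<phi> m] \<open>0 < e / 4\<close>] by auto
    show "\<exists>no. \<forall>n\<ge>no. norm (cesaro (r n) \<phi> - integral\<^sup>L \<mu> \<phi>) < e"
    proof (intro exI allI impI)
      fix k assume k: "Suc k0 \<le> k"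
      then have "0 < r k" using r_pos[of "k - 1"] by simp
      then have "\<bar>cesaro (r k) \<phi> - cesaro (r k) (\<lambda>x. \<phi> (pad m x))\<bar> \<le> e / 4"
        using close by (intro cesaro_close)
      then show "norm (cesaro (r k) \<phi> - integral\<^sup>L \<mu> \<phi>) < e" using k0[of k] k I \<open>0 < e\<close>
        unfolding real_norm_def by linarith
    qed
  qed
  have transfer_cont: "continuous_on (dual_space d) (transfer \<phi>)" if "continuous_on (dual_space d) \<phi>" for \<phi>
  proof (rule continuous_on_dual_ext)
    have c: "continuous_on (dual_space d) (\<lambda>x. \<psi> (cons_seq i x))" if \<psi>: "continuous_on (dual_space d) \<psi>" and i: "i < d"
      for \<psi> :: "_ \<Rightarrow> real" and i
      unfolding continuous_on_dual_iff
    proof (intro allI impI)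
      fix e :: real assume "0 < e"
      then obtain m where m: "\<And>x y. x \<in> dual_space d \<Longrightarrow> y \<in> dual_space d \<Longrightarrow> agree m x y \<Longrightarrow> \<bar>\<psi> x - \<psi> y\<bar> < e"
        using continuous_on_dualE[OF \<psi>] by blast
      then show "\<exists>m. \<forall>x\<in>dual_space d. \<forall>y\<in>dual_space d. agree m x y \<longrightarrow> \<bar>\<psi> (cons_seq i x) - \<psi> (cons_seq i y)\<bar> < e"
        using i by (intro exI[of _ m] ballI impI m) (auto intro: agree_mono[OF agree_cons])
    qed
    show "continuous_on (dual_space d) (\<lambda>x. \<Sum>i<d. \<phi> (cons_seq i x) * g (cons_seq i x))"
      using that g_cont by (intro continuous_intros c) auto
  qed (rule transfer_op_eq)
  show ?thesis
  proof (rule that[OF prob sets])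
    fix \<phi> :: "(nat \<Rightarrow> nat) \<Rightarrow> real" assume cont: "continuous_on (dual_space d) \<phi>"
    obtain B where B: "\<And>x. x \<in> dual_space d \<Longrightarrow> \<bar>\<phi> x\<bar> \<le> B"
      using continuous_on_dual_bounded[OF cont] by blast
    have "(\<lambda>k. cesaro (r k) (transfer \<phi>) - cesaro (r k) \<phi>) \<longlonglongrightarrow> 0"
    proof (rule Lim_null_comparison)
      show "eventually (\<lambda>k. norm (cesaro (r k) (transfer \<phi>) - cesaro (r k) \<phi>) \<le> 2 * B / r k) sequentially"
        using ev_pos by eventually_elim (use cesaro_transfer B in auto)
      have "(\<lambda>n. 2 * B / real n) \<longlonglongrightarrow> 0" by (rule lim_const_over_n)
      then show "(\<lambda>k. 2 * B / real (r k)) \<longlonglongrightarrow> 0"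
        using LIMSEQ_subseq_LIMSEQ[OF _ r] by (fastforce simp: o_def)
    qed
    moreover have "(\<lambda>k. cesaro (r k) (transfer \<phi>) - cesaro (r k) \<phi>) \<longlonglongrightarrow> integral\<^sup>L \<mu> (transfer \<phi>) - integral\<^sup>L \<mu> \<phi>"
      by (intro tendsto_diff lim_cont transfer_cont cont)
    ultimately show "integral\<^sup>L \<mu> \<phi> = integral\<^sup>L \<mu> (transfer \<phi>)" using LIMSEQ_unique by fastforce
  qed
qed

end

subsection \<open>Properties of the g-measure\<close>

context normalized_potential
begin

text \<open>Here c is the minimum of \<open>g\<close>; the value at a second preimage of the same
  point is at least c, which leaves at most 1 - c.\<close>

lemma g_bounds:
  obtains c where "0 < c" "c < 1" "\<And>w. w \<in> dual_space d \<Longrightarrow> c \<le> g w" "\<And>w. w \<in> dual_space d \<Longrightarrow> g w \<le> 1 - c"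
proof -
  obtain w0 where w0: "w0 \<in> dual_space d" "\<And>w. w \<in> dual_space d \<Longrightarrow> g w0 \<le> g w"
    using continuous_attains_inf[OF compact_dual_space _ g_cont] zero_in_dual[OF d_pos] by blast
  have upper: "g w \<le> 1 - g w0" if w: "w \<in> dual_space d" for w
  proof -
    define j where "j = (if w 0 = 0 then 1 else 0 :: nat)"
    define h where "h i = g (cons_seq i (right_shift w))" for i
    have h: "g w0 \<le> h i" if "i < d" for i using that w w0 by (simp add: h_def)
    have h0: "0 \<le> h i" if "i < d" for i using h[OF that] g_pos[OF w0(1)] by simp
    have j: "j < d" "j \<noteq> w 0" "w 0 < d" using d2 w by (auto simp: j_def dual_space_def)
    have "h (w 0) + h j = sum h {w 0, j}" using j by simp
    also have "\<dots> \<le> sum h {..<d}" using j h0 by (intro sum_mono2) auto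
    also have "\<dots> = 1" using w by (simp add: h_def g_sum)
    finally show ?thesis using h[OF j(1)] by (simp add: h_def cons_seq_right_shift)
  qed
  have "g w0 < 1" using upper[OF w0(1)] g_pos[OF w0(1)] by simp
  then show ?thesis using that[of "g w0"] g_pos w0 upper by blast
qed

lemma inverse_g_cont: "continuous_on (dual_space d) (\<lambda>w. 1 / g w)"
  using g_pos by (intro continuous_intros g_cont) (auto simp: less_imp_neq[symmetric])

end

text \<open>\<open>fixed\<close> says that \<mu> is its own image under the dual of
  \<open>transfer\<close>, in terms of integrals and without a definite description.\<close>

locale g_measure_space = normalized_potential +
  fixes \<mu> :: "(nat \<Rightarrow> nat) measure"
  assumes prob: "prob_space \<mu>" and sets: "sets \<mu> = sets (dual_borel d)"
    and fixed: "continuous_on (dual_space d) \<phi> \<Longrightarrow> integral\<^sup>L \<mu> \<phi> = integral\<^sup>L \<mu> (transfer \<phi>)"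
begin

sublocale prob_space \<mu> by (rule prob)

abbreviation cyl :: "(nat \<Rightarrow> nat) \<Rightarrow> nat \<Rightarrow> (nat \<Rightarrow> nat) set" where
  "cyl \<equiv> right_cylinder d"

lemma space: "space \<mu> = dual_space d"
  using sets_eq_imp_space_eq[OF sets] by simp

lemma cyl_sets: "cyl w n \<in> sets \<mu>"
  by (simp add: sets right_cylinder_sets)

section \<open>Masses of cylinders\<close>

text \<open>Among the d preimages of x only the one with digit w(0) can lie in the cylinder.\<close>

lemma transfer_cyl:
  assumes w: "w \<in> dual_space d" and x: "x \<in> dual_space d"
  shows "transfer (indicator (cyl w (Suc n))) x = g (cons_seq (w 0) x) * indicator (cyl (right_shift w) n) x"
proof -
  have "agree (Suc n) (cons_seq i x) w \<longleftrightarrow> i = w 0 \<and> agree n x (right_shift w)" for i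
    by (auto simp: agree_def right_shift_def less_Suc_eq_0_disj)
  then have "transfer (indicator (cyl w (Suc n))) x =
      (\<Sum>i<d. if i = w 0 then g (cons_seq i x) * indicator (cyl (right_shift w) n) x else 0)"
    using x by (auto simp: transfer_op_eq indicator_def right_cylinder_eq intro!: sum.cong)
  then show ?thesis using w by (simp add: dual_space_def)
qed

text \<open>The bounds a and b are left free: the extreme values of \<open>g\<close> give positivity
  and decay of cylinders, values near \<open>g w\<close> the Gibbs limit, and a distortion bound the
  comparison with \<open>birkhoff\<close>.\<close>

lemma cyl_bounds:
  assumes w: "w \<in> dual_space d" and ab: "\<And>x. x \<in> cyl w (Suc n) \<Longrightarrow> a \<le> g x" "\<And>x. x \<in> cyl w (Suc n) \<Longrightarrow> g x \<le> b"
  shows "a * measure \<mu> (cyl (right_shift w) n) \<le> measure \<mu> (cyl w (Suc n))"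
    and "measure \<mu> (cyl w (Suc n)) \<le> b * measure \<mu> (cyl (right_shift w) n)"
proof -
  define h where "h x = g (cons_seq (w 0) x) * indicator (cyl (right_shift w) n) x" for x
  have w0: "w 0 < d" using w by (simp add: dual_space_def)
  have c: "continuous_on (dual_space d) (indicator (cyl w (Suc n)) :: _ \<Rightarrow> real)" for w
    by (intro indicator_clopen_continuous right_cylinder_clopen)
  have "measure \<mu> (cyl w (Suc n)) = (\<integral>x. transfer (indicator (cyl w (Suc n))) x \<partial>\<mu>)"
    using fixed[OF c] cyl_sets by simp
  also have "\<dots> = integral\<^sup>L \<mu> h"
    by (intro Bochner_Integration.integral_cong) (auto simp: space transfer_cyl[OF w] h_def)
  finally have eq: "measure \<mu> (cyl w (Suc n)) = integral\<^sup>L \<mu> h" .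
  have "continuous_on (dual_space d) (\<lambda>x. g (cons_seq (w 0) x))"
    unfolding continuous_on_dual_iff
  proof (intro allI impI)
    fix e :: real assume "0 < e"
    then obtain m where m: "\<And>x y. x \<in> dual_space d \<Longrightarrow> y \<in> dual_space d \<Longrightarrow> agree m x y \<Longrightarrow> \<bar>g x - g y\<bar> < e"
      using continuous_on_dualE[OF g_cont] by blast
    show "\<exists>m. \<forall>x\<in>dual_space d. \<forall>y\<in>dual_space d. agree m x y \<longrightarrow> \<bar>g (cons_seq (w 0) x) - g (cons_seq (w 0) y)\<bar> < e"
      using w0 by (intro exI[of _ m] ballI impI m) (auto intro: agree_mono[OF agree_cons])
  qed
  then have "continuous_on (dual_space d) h"
    unfolding h_def by (intro continuous_intros indicator_clopen_continuous right_cylinder_clopen)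
  then have int: "integrable \<mu> h" by (rule continuous_on_dual_integrable[OF _ sets finite_measure_axioms])
  have mem: "cons_seq (w 0) x \<in> cyl w (Suc n)" if "x \<in> cyl (right_shift w) n" for x
    using that w0 by (auto simp: right_cylinder_eq agree_def right_shift_def split: nat.splits)
  have int_c: "integrable \<mu> (\<lambda>x. k * indicator (cyl (right_shift w) n) x)" for k :: real
    using cyl_sets by (simp add: emeasure_eq_measure)
  have "(\<integral>x. a * indicator (cyl (right_shift w) n) x \<partial>\<mu>) \<le> integral\<^sup>L \<mu> h"
    using ab(1) mem by (intro integral_mono int int_c) (auto simp: h_def split: split_indicator)
  then show "a * measure \<mu> (cyl (right_shift w) n) \<le> measure \<mu> (cyl w (Suc n))" using cyl_sets eq by simp
  have "integral\<^sup>L \<mu> h \<le> (\<integral>x. b * indicator (cyl (right_shift w) n) x \<partial>\<mu>)"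
    using ab(2) mem by (intro integral_mono int int_c) (auto simp: h_def split: split_indicator)
  then show "measure \<mu> (cyl w (Suc n)) \<le> b * measure \<mu> (cyl (right_shift w) n)" using cyl_sets eq by simp
qed

lemma cyl_subset: "cyl w n \<subseteq> dual_space d"
  by (auto simp: right_cylinder_def)

lemma cyl_0: "cyl w 0 = dual_space d"
  by (auto simp: right_cylinder_def)

lemma cyl_pos: "w \<in> dual_space d \<Longrightarrow> 0 < measure \<mu> (cyl w n)"
proof (induction n arbitrary: w)
  case 0
  then show ?case using prob_space space by (simp add: cyl_0)
next
  case (Suc n)
  obtain c where c: "0 < c" "\<And>w. w \<in> dual_space d \<Longrightarrow> c \<le> g w" "\<And>w. w \<in> dual_space d \<Longrightarrow> g w \<le> 1 - c"
    using g_bounds by metis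
  have "0 < c * measure \<mu> (cyl (right_shift w) n)" using Suc c by simp
  also have "\<dots> \<le> measure \<mu> (cyl w (Suc n))"
    using cyl_subset c(2,3) by (intro cyl_bounds(1)[OF Suc.prems]) blast+
  finally show ?case .
qed

lemma cyl_small:
  obtains \<theta> where "0 \<le> \<theta>" "\<theta> < 1" "\<And>w n. w \<in> dual_space d \<Longrightarrow> measure \<mu> (cyl w n) \<le> \<theta> ^ n"
proof -
  obtain c where c: "0 < c" "c < 1" "\<And>w. w \<in> dual_space d \<Longrightarrow> c \<le> g w" "\<And>w. w \<in> dual_space d \<Longrightarrow> g w \<le> 1 - c"
    using g_bounds by metis
  have "measure \<mu> (cyl w n) \<le> (1 - c) ^ n" if "w \<in> dual_space d" for w n
    using that
  proof (induction n arbitrary: w)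
    case (Suc n)
    have "measure \<mu> (cyl w (Suc n)) \<le> (1 - c) * measure \<mu> (cyl (right_shift w) n)"
      using cyl_subset c(3,4) by (intro cyl_bounds(2)[OF Suc.prems]) blast+
    also have "\<dots> \<le> (1 - c) * (1 - c) ^ n" using Suc c by (intro mult_left_mono) auto
    finally show ?case by simp
  qed simp
  then show ?thesis using that[of "1 - c"] c by simp
qed

lemma right_shift_cyl:
  assumes "w \<in> dual_space d" shows "right_shift ` cyl w (Suc n) = cyl (right_shift w) n"
proof (intro equalityI subsetI)
  fix x assume x: "x \<in> cyl (right_shift w) n"
  have "cons_seq (w 0) x \<in> cyl w (Suc n)"
    using x assms by (auto simp: right_cylinder_def dual_space_def right_shift_def split: nat.splits)
  then show "x \<in> right_shift ` cyl w (Suc n)" by (metis imageI right_shift_cons)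
qed (auto simp: right_cylinder_def, auto simp: right_shift_def)

text \<open>The inverse quotient averages values of \<open>g\<close> over a cylinder that shrinks to
  w.\<close>

lemma gibbs_limit:
  assumes w: "w \<in> dual_space d"
  shows "(\<lambda>n. measure \<mu> (right_shift ` cyl w n) / measure \<mu> (cyl w n)) \<longlonglongrightarrow> 1 / g w"
proof -
  define q where "q n = measure \<mu> (cyl w (Suc n)) / measure \<mu> (cyl (right_shift w) n)" for n
  have "q \<longlonglongrightarrow> g w"
  proof (rule LIMSEQ_I)
    fix e :: real assume "0 < e"
    then have e: "0 < e / 2" by simp
    obtain m where m: "\<And>x y. x \<in> dual_space d \<Longrightarrow> y \<in> dual_space d \<Longrightarrow> agree m x y \<Longrightarrow> \<bar>g x - g y\<bar> < e / 2"
      using continuous_on_dualE[OF g_cont e] by blast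
    show "\<exists>no. \<forall>n\<ge>no. norm (q n - g w) < e"
    proof (intro exI allI impI)
      fix n assume n: "m \<le> n"
      have "\<bar>g x - g w\<bar> < e / 2" if "x \<in> cyl w (Suc n)" for x
        using that w n by (intro m) (auto simp: right_cylinder_eq intro: agree_mono)
      then have close: "g w - e / 2 \<le> g x" "g x \<le> g w + e / 2" if "x \<in> cyl w (Suc n)" for x
        using that by (simp_all add: abs_less_iff) (smt (verit) field_sum_of_halves)+
      have p: "0 < measure \<mu> (cyl (right_shift w) n)" using cyl_pos w by simp
      have "(g w - e / 2) * measure \<mu> (cyl (right_shift w) n) \<le> measure \<mu> (cyl w (Suc n))"
        "measure \<mu> (cyl w (Suc n)) \<le> (g w + e / 2) * measure \<mu> (cyl (right_shift w) n)"
        using cyl_bounds[OF w, of n "g w - e / 2" "g w + e / 2"] close by blast+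
      then have "g w - e / 2 \<le> q n" "q n \<le> g w + e / 2" using p by (simp_all add: q_def pos_le_divide_eq pos_divide_le_eq)
      then show "norm (q n - g w) < e" using \<open>0 < e\<close> by (simp add: abs_less_iff)
    qed
  qed
  then have "(\<lambda>n. 1 / q n) \<longlonglongrightarrow> 1 / g w" using g_pos[OF w] by (intro tendsto_intros) auto
  then have "(\<lambda>n. measure \<mu> (right_shift ` cyl w (Suc n)) / measure \<mu> (cyl w (Suc n))) \<longlonglongrightarrow> 1 / g w"
    by (simp add: q_def right_shift_cyl[OF w])
  then show ?thesis by (rule LIMSEQ_imp_Suc)
qed

text \<open>Cylinders of large length all have less mass than A, and finitely many of them cover A;
  one of them therefore meets A in a set of positive but smaller mass.\<close>

lemma non_atomic: "non_atomic \<mu>"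
  unfolding non_atomic_def
proof (intro ballI impI)
  fix A assume A: "A \<in> sets \<mu>" "0 < emeasure \<mu> A"
  then have mA: "0 < measure \<mu> A" by (simp add: emeasure_eq_measure)
  obtain \<theta> where \<theta>: "0 \<le> \<theta>" "\<theta> < 1" "\<And>w n. w \<in> dual_space d \<Longrightarrow> measure \<mu> (cyl w n) \<le> \<theta> ^ n"
    using cyl_small by blast
  have "(\<lambda>n. \<theta> ^ n) \<longlonglongrightarrow> 0" using \<theta> by (intro LIMSEQ_power_zero) auto
  then have "eventually (\<lambda>n. \<theta> ^ n < measure \<mu> A) sequentially" using mA by (rule order_tendstoD(2))
  then obtain n where n: "\<theta> ^ n < measure \<mu> A" by (auto simp: eventually_sequentially)
  have cover: "A = (\<Union>y\<in>fibre d n. A \<inter> cyl y n)"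
  proof (intro equalityI subsetI)
    fix x assume x: "x \<in> A"
    then have "x \<in> dual_space d" using A sets.sets_into_space space by blast
    then have "pad n x \<in> fibre d n" "x \<in> cyl (pad n x) n" by (auto simp: pad_in_fibre right_cylinder_eq)
    then show "x \<in> (\<Union>y\<in>fibre d n. A \<inter> cyl y n)" using x by blast
  qed auto
  obtain y where y: "y \<in> fibre d n" "measure \<mu> (A \<inter> cyl y n) \<noteq> 0"
  proof (atomize_elim, rule ccontr)
    assume "\<nexists>y. y \<in> fibre d n \<and> measure \<mu> (A \<inter> cyl y n) \<noteq> 0"
    moreover have "measure \<mu> (\<Union>y\<in>fibre d n. A \<inter> cyl y n) \<le> (\<Sum>y\<in>fibre d n. measure \<mu> (A \<inter> cyl y n))"
      using A cyl_sets by (intro measure_UNION_le) auto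
    ultimately show False using mA cover by simp
  qed
  have yd: "y \<in> dual_space d" using y fibre_subset by blast
  have "measure \<mu> (A \<inter> cyl y n) \<le> measure \<mu> (cyl y n)" using cyl_sets by (intro finite_measure_mono) auto
  also have "\<dots> < measure \<mu> A" using \<theta>(3)[OF yd, of n] n by simp
  finally have lt: "measure \<mu> (A \<inter> cyl y n) < measure \<mu> A" .
  show "\<exists>B\<in>sets \<mu>. B \<subseteq> A \<and> 0 < emeasure \<mu> B \<and> emeasure \<mu> B < emeasure \<mu> A"
    using lt y(2) A cyl_sets
    by (intro bexI[of _ "A \<inter> cyl y n"]) (auto simp: emeasure_eq_measure ennreal_less_iff zero_less_measure_iff)
qed

lemma full_support: "dual_support d \<mu> = dual_space d"
proof -
  have "0 < emeasure \<mu> (U \<inter> dual_space d)" if w: "w \<in> dual_space d" and U: "open U" "w \<in> U" for w U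
  proof -
    obtain m where m: "{v. agree m w v} \<subseteq> U" using agree_subset_open[OF U] by blast
    have "cyl w m \<subseteq> U \<inter> dual_space d" using m by (auto simp: right_cylinder_eq intro: agree_sym)
    moreover have "U \<inter> dual_space d \<in> sets \<mu>"
      using U by (auto simp: sets dual_borel_def sets_restrict_space)
    ultimately have "emeasure \<mu> (cyl w m) \<le> emeasure \<mu> (U \<inter> dual_space d)" by (rule emeasure_mono)
    then show ?thesis using cyl_pos[OF w, of m] by (auto simp: emeasure_eq_measure intro: less_le_trans)
  qed
  then show ?thesis by (auto simp: dual_support_def)
qed

section \<open>Gibbs property, g-measure, density and invariance\<close>

lemma dual_prob: "dual_prob d \<mu>"
  by (simp add: dual_prob_def prob sets)

lemma dual_gibbs_type:
  assumes \<Psi>: "\<And>w. w \<in> dual_space d \<Longrightarrow> \<Psi> w = 1 / g w"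
  shows "dual_gibbs_type d \<Psi> \<mu>"
  unfolding dual_gibbs_type_def
  using continuous_on_dual_ext[OF inverse_g_cont \<Psi>] \<Psi> g_pos dual_prob non_atomic full_support gibbs_limit
  by auto

lemma g_measure:
  assumes \<psi>: "\<And>w. w \<in> dual_space d \<Longrightarrow> \<psi> w = g w"
  shows "g_measure d \<psi> \<mu>"
proof -
  have "transfer_op d \<psi> \<phi> = transfer \<phi>" for \<phi>
    unfolding transfer_op_def using \<psi> by (auto simp: fun_eq_iff intro!: sum.cong)
  then have "transfer_dual d \<psi> \<mu> = \<mu>"
    using fixed by (intro transfer_dual_eqI finite_measure_axioms sets) auto
  moreover have "g_function d \<psi>"
    unfolding g_function_def using continuous_on_dual_ext[OF g_cont \<psi>] \<psi> g_pos
    by (auto simp: sum_preimages g_sum less_imp_le)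
  ultimately show ?thesis by (simp add: g_measure_def dual_prob)
qed

text \<open>The operator with weight 1 is \<phi> \<mapsto> \<open>transfer\<close> (\<phi> / g), and
  \<mu> is fixed by the dual of \<open>transfer\<close>.\<close>

lemma transfer_dual_one: "transfer_dual d (\<lambda>_. 1) \<mu> = density \<mu> (\<lambda>w. ennreal (1 / g w))"
proof (rule transfer_dual_eqI)
  have meas: "(\<lambda>w. 1 / g w) \<in> borel_measurable \<mu>"
    by (rule continuous_on_dual_measurable[OF inverse_g_cont sets])
  have int: "integrable \<mu> (\<lambda>w. 1 / g w)"
    by (rule continuous_on_dual_integrable[OF inverse_g_cont sets finite_measure_axioms])
  have nn: "AE w in \<mu>. 0 \<le> 1 / g w" using g_pos by (intro AE_I2) (auto simp: space less_imp_le)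
  show "finite_measure (density \<mu> (\<lambda>w. ennreal (1 / g w)))"
  proof
    have "emeasure (density \<mu> (\<lambda>w. ennreal (1 / g w))) (space (density \<mu> (\<lambda>w. ennreal (1 / g w))))
      = (\<integral>\<^sup>+ w. ennreal (1 / g w) \<partial>\<mu>)"
      using meas by (simp add: emeasure_density cong: nn_integral_cong)
    also have "\<dots> = ennreal (\<integral>w. 1 / g w \<partial>\<mu>)" by (rule nn_integral_eq_integral[OF int nn])
    finally show "emeasure (density \<mu> (\<lambda>w. ennreal (1 / g w))) (space (density \<mu> (\<lambda>w. ennreal (1 / g w)))) \<noteq> \<infinity>"
      by simp
  qed
  show "sets (density \<mu> (\<lambda>w. ennreal (1 / g w))) = sets (dual_borel d)" by (simp add: sets)
  fix \<phi> :: "(nat \<Rightarrow> nat) \<Rightarrow> real" assume \<phi>: "continuous_on (dual_space d) \<phi>"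
  have c: "continuous_on (dual_space d) (\<lambda>w. 1 / g w * \<phi> w)"
    by (intro continuous_on_mult inverse_g_cont \<phi>)
  have "integral\<^sup>L (density \<mu> (\<lambda>w. ennreal (1 / g w))) \<phi> = (\<integral>w. 1 / g w * \<phi> w \<partial>\<mu>)"
    using continuous_on_dual_measurable[OF \<phi> sets] meas nn by (intro integral_real_density)
  also have "\<dots> = (\<integral>w. transfer (\<lambda>w. 1 / g w * \<phi> w) w \<partial>\<mu>)" by (rule fixed[OF c])
  also have "\<dots> = integral\<^sup>L \<mu> (transfer_op d (\<lambda>_. 1) \<phi>)"
    using g_pos by (intro Bochner_Integration.integral_cong)
      (auto simp: space transfer_op_eq less_imp_neq[symmetric] intro!: sum.cong)
  finally show "integral\<^sup>L (density \<mu> (\<lambda>w. ennreal (1 / g w))) \<phi> = integral\<^sup>L \<mu> (transfer_op d (\<lambda>_. 1) \<phi>)" .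
qed

lemma RN_deriv_transfer_dual:
  "AE w in transfer_dual d (\<lambda>_. 1) \<mu>. RN_deriv (transfer_dual d (\<lambda>_. 1) \<mu>) \<mu> w = ennreal (g w)"
proof -
  have mg: "g \<in> borel_measurable \<mu>" by (rule continuous_on_dual_measurable[OF g_cont sets])
  have "density (density \<mu> (\<lambda>w. ennreal (1 / g w))) (\<lambda>w. ennreal (g w)) = density \<mu> (\<lambda>w. ennreal (1 / g w) * ennreal (g w))"
    using mg by (intro density_density_eq) auto
  also have "\<dots> = density \<mu> (\<lambda>_. 1)"
  proof (rule density_cong)
    show "AE w in \<mu>. ennreal (1 / g w) * ennreal (g w) = 1"
    proof (intro AE_I2)
      fix w assume "w \<in> space \<mu>"
      then show "ennreal (1 / g w) * ennreal (g w) = 1"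
        using g_pos[of w] by (simp add: space ennreal_mult[symmetric])
    qed
  qed (use mg in auto)
  finally have "density (transfer_dual d (\<lambda>_. 1) \<mu>) (\<lambda>w. ennreal (g w)) = \<mu>"
    by (simp add: transfer_dual_one density_1)
  moreover have "(\<lambda>w. ennreal (g w)) \<in> borel_measurable (transfer_dual d (\<lambda>_. 1) \<mu>)"
    using mg by (simp add: transfer_dual_one)
  ultimately have "AE w in transfer_dual d (\<lambda>_. 1) \<mu>. ennreal (g w) = RN_deriv (transfer_dual d (\<lambda>_. 1) \<mu>) \<mu> w"
    using sigma_finite_measure_axioms by (intro RN_deriv_unique_sigma_finite)
  then show ?thesis by eventually_elim simp
qed

text \<open>On a function of the form \<phi> o \<sigma> the transfer operator returns \<phi>,
  because the weights over a fibre add up to 1.\<close>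

lemma invariant: "distr \<mu> \<mu> right_shift = \<mu>"
proof (rule measure_eqI_continuous)
  have m: "right_shift \<in> measurable \<mu> \<mu>" by (rule measurable_right_shift[OF sets])
  show "finite_measure (distr \<mu> \<mu> right_shift)" using m by (rule finite_measure_distr)
  fix \<phi> :: "(nat \<Rightarrow> nat) \<Rightarrow> real" assume \<phi>: "continuous_on (dual_space d) \<phi>"
  have c: "continuous_on (dual_space d) (\<lambda>x. \<phi> (right_shift x))"
    unfolding continuous_on_dual_iff
  proof (intro allI impI)
    fix e :: real assume "0 < e"
    then obtain m where m: "\<And>x y. x \<in> dual_space d \<Longrightarrow> y \<in> dual_space d \<Longrightarrow> agree m x y \<Longrightarrow> \<bar>\<phi> x - \<phi> y\<bar> < e"
      using continuous_on_dualE[OF \<phi>] by blast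
    show "\<exists>m. \<forall>x\<in>dual_space d. \<forall>y\<in>dual_space d. agree m x y \<longrightarrow> \<bar>\<phi> (right_shift x) - \<phi> (right_shift y)\<bar> < e"
      using agree_shift[of m 1] by (intro exI[of _ "m + 1"] ballI impI m) auto
  qed
  have "integral\<^sup>L (distr \<mu> \<mu> right_shift) \<phi> = (\<integral>x. \<phi> (right_shift x) \<partial>\<mu>)"
    by (intro integral_distr m continuous_on_dual_measurable[OF \<phi> sets])
  also have "\<dots> = (\<integral>x. transfer (\<lambda>x. \<phi> (right_shift x)) x \<partial>\<mu>)" by (rule fixed[OF c])
  also have "\<dots> = integral\<^sup>L \<mu> \<phi>"
    by (intro Bochner_Integration.integral_cong)
      (auto simp: space transfer_op_eq g_sum sum_distrib_left[symmetric])
  finally show "integral\<^sup>L (distr \<mu> \<mu> right_shift) \<phi> = integral\<^sup>L \<mu> \<phi>" .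
qed (simp_all add: sets finite_measure_axioms)

end

subsection \<open>Bounded distortion and the pressure\<close>

context normalized_potential
begin

lemma g_le_1: assumes w: "w \<in> dual_space d" shows "g w \<le> 1"
proof -
  have "w 0 < d" using w by (simp add: dual_space_def)
  then have "g (cons_seq (w 0) (right_shift w)) \<le> (\<Sum>i<d. g (cons_seq i (right_shift w)))"
    using w by (intro member_le_sum less_imp_le g_pos) auto
  then show ?thesis using w by (simp add: cons_seq_right_shift g_sum)
qed

text \<open>Agreement on at least K digits gives the ratio exp \<delta>; shorter agreement gives
  only 1 / c, but at most K such factors occur. The product over \<open>Suc k\<close> runs through
  the agreement lengths 1 to n met along an orbit segment.\<close>

lemma g_distortion:
  fixes \<delta> :: real
  assumes "0 < \<delta>"
  obtains b C where "1 \<le> C" "\<And>n. 0 \<le> b n" "\<And>n. (\<Prod>k<n. b (Suc k)) \<le> C * exp (\<delta> * n)"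
    "\<And>n x y. x \<in> dual_space d \<Longrightarrow> y \<in> dual_space d \<Longrightarrow> agree n x y \<Longrightarrow> g x \<le> b n * g y"
proof -
  obtain w0 where w0: "w0 \<in> dual_space d" "\<And>w. w \<in> dual_space d \<Longrightarrow> g w0 \<le> g w"
    using continuous_attains_inf[OF compact_dual_space _ g_cont] zero_in_dual[OF d_pos] by blast
  define c where "c = g w0"
  have c: "0 < c" "c \<le> 1" using g_pos g_le_1 w0 by (auto simp: c_def)
  \<comment> \<open>With this tolerance the additive error is at most (exp \<delta> - 1) g(y), that
    is, it becomes multiplicative.\<close>
  have "0 < (exp \<delta> - 1) * c" using assms c by simp
  then obtain K where K: "\<And>x y. x \<in> dual_space d \<Longrightarrow> y \<in> dual_space d \<Longrightarrow> agree K x y \<Longrightarrow> \<bar>g x - g y\<bar> < (exp \<delta> - 1) * c"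
    using continuous_on_dualE[OF g_cont] by blast
  define b where "b n = (if K \<le> n then exp \<delta> else 1 / c)" for n
  have b1: "1 \<le> b n" for n using assms c by (simp add: b_def)
  show ?thesis
  proof (rule that[of "(1 / c) ^ K" b])
    show "1 \<le> (1 / c) ^ K" using c by simp
    show "0 \<le> b n" for n using b1[of n] by simp
    \<comment> \<open>The exponent min n K bounds the number of crude factors met so far.\<close>
    have "(\<Prod>k<n. b (Suc k)) \<le> (1 / c) ^ min n K * exp (\<delta> * n)" for n
    proof (induction n)
      case (Suc n)
      have "(\<Prod>k<Suc n. b (Suc k)) \<le> (1 / c) ^ min n K * exp (\<delta> * n) * b (Suc n)"
        using Suc b1[of "Suc n"] by (simp add: mult_right_mono)
      also have "\<dots> \<le> (1 / c) ^ min (Suc n) K * exp (\<delta> * Suc n)"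
      proof (cases "K \<le> Suc n")
        case True
        have "(1 / c) ^ min n K \<le> (1 / c) ^ min (Suc n) K" using c by (intro power_increasing) auto
        then show ?thesis using True by (simp add: b_def distrib_left exp_add mult_right_mono)
      next
        case False
        have "exp (\<delta> * n) \<le> exp (\<delta> * Suc n)" using assms by simp
        then show ?thesis using False c by (simp add: b_def divide_right_mono)
      qed
      finally show ?case .
    qed simp
    moreover have "(1 / c) ^ min n K \<le> (1 / c) ^ K" for n using c by (intro power_increasing) auto
    ultimately show "(\<Prod>k<n. b (Suc k)) \<le> (1 / c) ^ K * exp (\<delta> * n)" for n
      by (meson exp_ge_zero mult_right_mono order_trans)
    fix n x y assume xy: "x \<in> dual_space d" "y \<in> dual_space d" "agree n x y"
    show "g x \<le> b n * g y"
    proof (cases "K \<le> n")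
      case True
      then have "agree K x y" using xy agree_mono by blast
      then have "g x \<le> g y + (exp \<delta> - 1) * c" using K[OF xy(1,2)] by linarith
      also have "(exp \<delta> - 1) * c \<le> (exp \<delta> - 1) * g y"
        using w0 xy assms by (intro mult_left_mono) (auto simp: c_def)
      finally show ?thesis using True by (simp add: b_def algebra_simps)
    next
      case False
      have "g x * c \<le> 1 * g y" using g_le_1[OF xy(1)] w0(2)[OF xy(2)] c by (intro mult_mono) (auto simp: c_def)
      then show ?thesis using False c by (simp add: b_def field_simps)
    qed
  qed
qed

text \<open>After i shifts, n - i digits of agreement are left.\<close>

lemma birkhoff_distortion:
  fixes \<delta> :: real
  assumes "0 < \<delta>"
  obtains C where "1 \<le> C"
    "\<And>n x y. x \<in> dual_space d \<Longrightarrow> y \<in> dual_space d \<Longrightarrow> agree n x y \<Longrightarrow> birkhoff n x \<le> C * exp (\<delta> * n) * birkhoff n y"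
proof -
  obtain b C where C: "1 \<le> C" and b: "\<And>n. 0 \<le> b n" "\<And>n. (\<Prod>k<n. b (Suc k)) \<le> C * exp (\<delta> * n)"
    and step: "\<And>n x y. x \<in> dual_space d \<Longrightarrow> y \<in> dual_space d \<Longrightarrow> agree n x y \<Longrightarrow> g x \<le> b n * g y"
    using g_distortion[OF assms] by metis
  have main: "birkhoff n x \<le> (\<Prod>k<n. b (Suc k)) * birkhoff n y"
    if "x \<in> dual_space d" "y \<in> dual_space d" "agree n x y" for n x y
    using that
  proof (induction n arbitrary: x y)
    case (Suc n)
    have "birkhoff n (right_shift x) \<le> (\<Prod>k<n. b (Suc k)) * birkhoff n (right_shift y)"
      using Suc.prems agree_shift[of n 1 x y] by (intro Suc.IH) auto
    then have "g x * birkhoff n (right_shift x) \<le> (b (Suc n) * g y) * ((\<Prod>k<n. b (Suc k)) * birkhoff n (right_shift y))"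
      using step[OF Suc.prems] Suc.prems g_pos birkhoff_pos b(1)
      by (intro mult_mono) (simp_all add: less_imp_le)
    then show ?case by (simp add: birkhoff_Suc mult_ac)
  qed (simp add: birkhoff_def)
  show ?thesis
  proof (rule that[OF C])
    fix n x y assume xy: "x \<in> dual_space d" "y \<in> dual_space d" "agree n x y"
    show "birkhoff n x \<le> C * exp (\<delta> * n) * birkhoff n y"
      using main[OF xy] mult_right_mono[OF b(2)[of n] less_imp_le[OF birkhoff_pos[OF xy(2), of n]]] by linarith
  qed
qed

section \<open>Vanishing of the pressure\<close>

lemma birkhoff_add: "birkhoff (n + m) x = birkhoff n x * birkhoff m ((right_shift ^^ n) x)"
  by (induction m) (simp_all add: birkhoff_def funpow_right_shift add_ac)

lemma exp_sum_ln_g: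
  assumes "x \<in> dual_space d"
  shows "exp (\<Sum>i<n. ln (g ((right_shift ^^ i) x))) = birkhoff n x"
  unfolding birkhoff_def using assms by (subst exp_sum) (auto intro!: prod.cong simp: g_pos)

lemma ln_birkhoff:
  assumes "x \<in> dual_space d"
  shows "ln (birkhoff n x) = (\<Sum>i<n. ln (g ((right_shift ^^ i) x)))"
  by (metis assms exp_sum_ln_g ln_exp)

text \<open>Agreement on m + n digits leaves more than m digits after each of the first n iterates,
  hence distances below (1/2)^m. Points of a separated set thus lie in distinct cylinders of length
  m + n.\<close>

lemma separated_agree:
  assumes "separated seq_dist right_shift n \<epsilon> E" "(1/2) ^ m \<le> \<epsilon>" "x \<in> E" "y \<in> E" "agree (m + n) x y"
  shows "x = y"
proof (rule ccontr)
  assume "x \<noteq> y"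
  then obtain i where i: "i < n" "\<epsilon> < seq_dist ((right_shift ^^ i) x) ((right_shift ^^ i) y)"
    using assms unfolding separated_def by blast
  have "\<forall>k\<le>m. (right_shift ^^ i) x k = (right_shift ^^ i) y k"
    using i(1) assms(5) by (auto simp: funpow_right_shift agree_def)
  then have "seq_dist ((right_shift ^^ i) x) ((right_shift ^^ i) y) < (1/2) ^ m" by (simp add: seq_dist_less_iff)
  with i assms(2) show False by linarith
qed

text \<open>Passing to m + n factors costs (1 / c)^m, and moving each point to its representative
  costs C exp (\<delta> (m + n)). The representatives are distinct, so what remains is part of a
  fibre sum equal to 1.\<close>

lemma separated_sum_bound:
  fixes \<delta> :: real
  assumes "0 < \<delta>"
  obtains C where "1 \<le> C" and
    "\<And>n E. finite E \<Longrightarrow> E \<subseteq> dual_space d \<Longrightarrow> inj_on (pad (m + n)) E \<Longrightarrow>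
       (\<Sum>x\<in>E. birkhoff n x) \<le> C * exp (\<delta> * n)"
proof -
  obtain C where C: "1 \<le> C" "\<And>n x y. x \<in> dual_space d \<Longrightarrow> y \<in> dual_space d \<Longrightarrow> agree n x y \<Longrightarrow>
     birkhoff n x \<le> C * exp (\<delta> * n) * birkhoff n y"
    using birkhoff_distortion[OF assms] by blast
  obtain w0 where w0: "w0 \<in> dual_space d" "\<And>w. w \<in> dual_space d \<Longrightarrow> g w0 \<le> g w"
    using continuous_attains_inf[OF compact_dual_space _ g_cont] zero_in_dual[OF d_pos] by blast
  define c where "c = g w0"
  have c: "0 < c" "c \<le> 1" using g_pos g_le_1 w0 by (auto simp: c_def)
  have low: "c ^ m \<le> birkhoff m x" if "x \<in> dual_space d" for x
  proof -
    have "(\<Prod>i<m. c) \<le> birkhoff m x" unfolding birkhoff_def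
      using c w0 that by (intro prod_mono) (auto simp: c_def)
    then show ?thesis by simp
  qed
  show ?thesis
  proof (rule that[of "C * exp (\<delta> * m) * (1 / c) ^ m"])
    have "1 * 1 * 1 \<le> C * exp (\<delta> * m) * (1 / c) ^ m" using C c assms by (intro mult_mono) auto
    then show "1 \<le> C * exp (\<delta> * m) * (1 / c) ^ m" by simp
    fix n E assume E: "finite E" "E \<subseteq> dual_space d"
      and inj: "inj_on (pad (m + n)) E"
    have "birkhoff n x \<le> (C * exp (\<delta> * m) * (1 / c) ^ m) * exp (\<delta> * n) * birkhoff (m + n) (pad (m + n) x)" if "x \<in> E" for x
    proof -
      have x: "x \<in> dual_space d" using that E by blast
      have "birkhoff n x * c ^ m \<le> birkhoff (n + m) x"
        unfolding birkhoff_add using x low[of "(right_shift ^^ n) x"] birkhoff_pos[OF x, of n]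
        by (intro mult_left_mono) auto
      also have "\<dots> \<le> C * exp (\<delta> * (n + m)) * birkhoff (n + m) (pad (n + m) x)"
        using C(2)[OF x pad_in_dual[OF x] agree_pad, of "n + m"] by simp
      finally show ?thesis using c
        by (simp add: field_simps exp_add distrib_left add.commute)
    qed
    then have "(\<Sum>x\<in>E. birkhoff n x) \<le> (\<Sum>x\<in>E. (C * exp (\<delta> * m) * (1 / c) ^ m) * exp (\<delta> * n) * birkhoff (m + n) (pad (m + n) x))"
      by (rule sum_mono)
    also have "\<dots> = (C * exp (\<delta> * m) * (1 / c) ^ m) * exp (\<delta> * n) * (\<Sum>y\<in>pad (m + n) ` E. birkhoff (m + n) y)"
      using inj by (simp add: sum.reindex sum_distrib_left)
    also have "(\<Sum>y\<in>pad (m + n) ` E. birkhoff (m + n) y) \<le> (\<Sum>y\<in>fibre d (m + n). birkhoff (m + n) y)"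
    proof (rule sum_mono2)
      show "pad (m + n) ` E \<subseteq> fibre d (m + n)" using E pad_in_fibre by blast
      show "0 \<le> birkhoff (m + n) y" if "y \<in> fibre d (m + n) - pad (m + n) ` E" for y
        using that fibre_subset by (intro less_imp_le birkhoff_pos) blast
    qed simp
    also have "\<dots> = 1" by (rule sum_birkhoff)
    finally show "(\<Sum>x\<in>E. birkhoff n x) \<le> C * exp (\<delta> * m) * (1 / c) ^ m * exp (\<delta> * n)"
      using C c by (simp add: mult_left_le)
  qed
qed

lemma pressure_eq_0:
  assumes \<phi>: "\<And>w. w \<in> dual_space d \<Longrightarrow> \<phi> w = ln (g w)"
  shows "pressure (dual_space d) seq_dist right_shift \<phi> = 0"
proof -
  define S where "S \<epsilon> n = (SUP E\<in>{E. finite E \<and> E \<noteq> {} \<and> E \<subseteq> dual_space d \<and> separated seq_dist right_shift n \<epsilon> E}.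
         ereal (ln (\<Sum>x\<in>E. exp (\<Sum>i<n. \<phi> ((right_shift ^^ i) x))) / real n))" for \<epsilon> n
  have expS: "exp (\<Sum>i<n. \<phi> ((right_shift ^^ i) x)) = birkhoff n x" if "x \<in> dual_space d" for n x
    using that by (simp add: \<phi> exp_sum_ln_g)
  have lower: "0 \<le> S \<epsilon> n" if \<epsilon>: "0 < \<epsilon>" "\<epsilon> < 1" for \<epsilon> n
  proof -
    \<comment> \<open>Distinct representatives differ at some digit i < n, and after i shifts their
      distance is 1. The sum over this set is exactly 1, with logarithm 0.\<close>
    have "separated seq_dist right_shift n \<epsilon> (fibre d n)"
      unfolding separated_def
    proof (intro ballI impI)
      fix x y assume xy: "x \<in> fibre d n" "y \<in> fibre d n" "x \<noteq> y"
      then obtain i where i: "i < n" "x i \<noteq> y i"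
        by (metis agree_def pad_eq_iff pad_fibre)
      have "\<not> seq_dist ((right_shift ^^ i) x) ((right_shift ^^ i) y) < (1/2) ^ 0"
        unfolding seq_dist_less_iff using i by (auto simp: funpow_right_shift)
      then show "\<exists>i<n. \<epsilon> < seq_dist ((right_shift ^^ i) x) ((right_shift ^^ i) y)" using i \<epsilon> by auto
    qed
    moreover have "(\<Sum>x\<in>fibre d n. exp (\<Sum>i<n. \<phi> ((right_shift ^^ i) x))) = 1"
      using expS fibre_subset[of d n] by (subst sum_birkhoff[of n, symmetric]) (auto intro!: sum.cong)
    ultimately show ?thesis unfolding S_def
      using fibre_subset[of d n] fibre_nonempty[of d n] by (intro SUP_upper2[of "fibre d n"]) auto
  qed
  have upper: "limsup (S \<epsilon>) \<le> ereal \<delta>" if "0 < \<epsilon>" "0 < \<delta>" for \<epsilon> \<delta>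
  proof -
    obtain m where "(1/2) ^ m < \<epsilon>" using real_arch_pow_inv[OF \<open>0 < \<epsilon>\<close>, of "1/2"] by auto
    then have m: "(1/2) ^ m \<le> \<epsilon>" by simp
    obtain C where C: "1 \<le> C" and sum: "\<And>n E. finite E \<Longrightarrow> E \<subseteq> dual_space d \<Longrightarrow>
       inj_on (pad (m + n)) E \<Longrightarrow>
       (\<Sum>x\<in>E. birkhoff n x) \<le> C * exp (\<delta> * n)"
      using separated_sum_bound[OF \<open>0 < \<delta>\<close>, of m] by blast
    have "S \<epsilon> n \<le> ereal (ln C / n + \<delta>)" if n: "0 < n" for n
      unfolding S_def
    proof (rule SUP_least)
      fix E assume "E \<in> {E. finite E \<and> E \<noteq> {} \<and> E \<subseteq> dual_space d \<and> separated seq_dist right_shift n \<epsilon> E}"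
      then have E: "finite E" "E \<noteq> {}" "E \<subseteq> dual_space d" "separated seq_dist right_shift n \<epsilon> E" by auto
      have eq: "(\<Sum>x\<in>E. exp (\<Sum>i<n. \<phi> ((right_shift ^^ i) x))) = (\<Sum>x\<in>E. birkhoff n x)"
        using E expS by (intro sum.cong) auto
      have pos: "0 < (\<Sum>x\<in>E. birkhoff n x)" using E birkhoff_pos by (intro sum_pos) auto
      have "(\<Sum>x\<in>E. birkhoff n x) \<le> C * exp (\<delta> * n)"
        using separated_agree[OF E(4) m] by (intro sum E) (auto simp: inj_on_def pad_eq_iff)
      then have "ln (\<Sum>x\<in>E. birkhoff n x) \<le> ln (C * exp (\<delta> * n))" using pos C by simp
      also have "\<dots> = ln C + \<delta> * n" using C by (simp add: ln_mult)
      finally have "ln (\<Sum>x\<in>E. birkhoff n x) / n \<le> (ln C + \<delta> * n) / n" by (rule divide_right_mono) simp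
      also have "\<dots> = ln C / n + \<delta>" using n by (simp add: add_divide_distrib)
      finally show "ereal (ln (\<Sum>x\<in>E. exp (\<Sum>i<n. \<phi> ((right_shift ^^ i) x))) / real n) \<le> ereal (ln C / n + \<delta>)"
        by (simp add: eq)
    qed
    then have "eventually (\<lambda>n. S \<epsilon> n \<le> ereal (ln C / n + \<delta>)) sequentially"
      by (auto simp: eventually_sequentially intro!: exI[of _ 1])
    then have "limsup (S \<epsilon>) \<le> limsup (\<lambda>n. ereal (ln C / n + \<delta>))" by (rule Limsup_mono)
    also have "(\<lambda>n. ln C / real n + \<delta>) \<longlonglongrightarrow> 0 + \<delta>" by (intro tendsto_intros lim_const_over_n)
    then have "limsup (\<lambda>n. ereal (ln C / n + \<delta>)) = ereal \<delta>" by (intro lim_imp_Limsup) auto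
    finally show ?thesis .
  qed
  have "limsup (S \<epsilon>) = 0" if \<epsilon>: "0 < \<epsilon>" "\<epsilon> < 1" for \<epsilon>
  proof (rule antisym)
    show "limsup (S \<epsilon>) \<le> 0"
      by (rule ereal_le_epsilon2) (simp add: upper[OF \<epsilon>(1)])
    have "0 = limsup (\<lambda>_. 0 :: ereal)" by (simp add: Limsup_const)
    also have "\<dots> \<le> limsup (S \<epsilon>)" using lower[OF \<epsilon>] by (intro Limsup_mono) auto
    finally show "0 \<le> limsup (S \<epsilon>)" .
  qed
  then have "eventually (\<lambda>\<epsilon>. limsup (S \<epsilon>) = 0) (at_right (0::real))"
    unfolding eventually_at_right_field by (intro exI[of _ 1]) auto
  then have "((\<lambda>\<epsilon>. limsup (S \<epsilon>)) \<longlongrightarrow> 0) (at_right (0::real))" by (rule tendsto_eventually)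
  then have "Lim (at_right (0::real)) (\<lambda>\<epsilon>. limsup (S \<epsilon>)) = 0" by (intro tendsto_Lim) auto
  then show ?thesis unfolding pressure_def S_def[abs_def] .
qed

end

subsection \<open>Entropy rates of finite partitions\<close>

text \<open>Division with remainder by a k for which \<open>a k / k\<close> is nearly the infimum;
  the finitely many remainders contribute a bounded term.\<close>

lemma fekete_subadditive:
  fixes a :: "nat \<Rightarrow> real"
  assumes sub: "\<And>m n. a (m + n) \<le> a m + a n" and nn: "\<And>n. 0 \<le> a n"
  shows "convergent (\<lambda>n. a n / n)"
proof -
  define L where "L = (INF n\<in>{1..}. a n / n)"
  have bdd: "bdd_below ((\<lambda>n. a n / n) ` {1..})" using nn by (intro bdd_belowI2[of _ 0]) simp
  have lower: "L \<le> a n / n" if "1 \<le> n" for n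
    unfolding L_def using that by (intro cINF_lower bdd) simp
  have mult: "a (q * k) \<le> q * a k" if "1 \<le> q" for q k
    using that
  proof (induction q rule: nat_induct_at_least)
    case (Suc q)
    have "a (Suc q * k) \<le> a k + a (q * k)" using sub[of k "q * k"] by simp
    then show ?case using Suc by (simp add: algebra_simps)
  qed simp
  have "(\<lambda>n. a n / n) \<longlonglongrightarrow> L"
  proof (rule LIMSEQ_I)
    fix e :: real assume "0 < e"
    then have "L < L + e / 2" by simp
    then obtain k where k: "1 \<le> k" "a k / k < L + e / 2"
      unfolding L_def using cINF_less_iff[OF _ bdd, of "L + e / 2"] by (auto simp: L_def)
    define B where "B = Max (a ` {..<k})"
    have B: "a r \<le> B" if "r < k" for r unfolding B_def using that by (intro Max_ge) auto
    have "(\<lambda>n. B / real n) \<longlonglongrightarrow> 0" by (rule lim_const_over_n)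
    then have "eventually (\<lambda>n. B / real n < e / 2) sequentially"
      using \<open>0 < e\<close> by (intro order_tendstoD(2)) auto
    then obtain n0 where n0: "\<And>n. n0 \<le> n \<Longrightarrow> B / real n < e / 2" unfolding eventually_sequentially by blast
    show "\<exists>no. \<forall>n\<ge>no. norm (a n / n - L) < e"
    proof (intro exI allI impI)
      fix n assume n: "max n0 k \<le> n"
      then have n1: "0 < n" "1 \<le> n div k" using k by (auto simp: Suc_le_eq div_greater_zero_iff)
      have "a n \<le> a (n div k * k) + a (n mod k)" using sub[of "n div k * k" "n mod k"] by simp
      also have "\<dots> \<le> (n div k) * a k + B" using mult[OF n1(2), of k] B[of "n mod k"] k by simp
      finally have "a n / n \<le> ((n div k) * a k + B) / n" by (intro divide_right_mono) auto
      also have "\<dots> = (n div k) * a k / n + B / n" by (simp add: add_divide_distrib)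
      also have "(n div k) * a k / n \<le> a k / k"
      proof -
        have "real (n div k) * real k \<le> n" by (metis div_times_less_eq_dividend of_nat_le_iff of_nat_mult)
        then have "real (n div k) * real k * a k \<le> n * a k" using nn by (intro mult_right_mono) auto
        then show ?thesis using n1 k by (simp add: field_simps)
      qed
      finally have "a n / n \<le> a k / k + B / n" by simp
      moreover have "B / n < e / 2" using n0 n by simp
      ultimately have "a n / n < L + e" using k(2) by linarith
      moreover have "L \<le> a n / n" using lower[of n] n1 by simp
      ultimately show "norm (a n / n - L) < e" by simp
    qed
  qed
  then show ?thesis by (auto simp: convergent_def)
qed

text \<open>Sum of ln t \<le> t - 1 at t = q / p, weighted by p. Indices with p = 0 contribute 0 on
  both sides, and positivity of q elsewhere excludes the default value of
  \<open>ln 0\<close>.\<close>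

lemma gibbs_inequality:
  fixes p q :: "'a \<Rightarrow> real"
  assumes "finite I" and p: "\<And>i. i \<in> I \<Longrightarrow> 0 \<le> p i" "sum p I = 1"
    and q: "\<And>i. i \<in> I \<Longrightarrow> 0 \<le> q i" "sum q I \<le> 1" and pq: "\<And>i. i \<in> I \<Longrightarrow> 0 < p i \<Longrightarrow> 0 < q i"
  shows "- (\<Sum>i\<in>I. p i * ln (p i)) \<le> (\<Sum>i\<in>I. p i * - ln (q i))"
proof -
  have "p i * - ln (p i) \<le> p i * - ln (q i) + (q i - p i)" if i: "i \<in> I" for i
  proof (cases "p i = 0")
    case True
    then show ?thesis using q i by simp
  next
    case False
    then have pos: "0 < p i" "0 < q i" using p pq i by (auto simp: less_le)
    have "ln (q i / p i) \<le> q i / p i - 1" using pos by (intro ln_le_minus_one) simp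
    then have "p i * ln (q i / p i) \<le> p i * (q i / p i - 1)" using pos by (intro mult_left_mono) auto
    then show ?thesis using pos by (simp add: ln_div algebra_simps)
  qed
  then have "(\<Sum>i\<in>I. p i * - ln (p i)) \<le> (\<Sum>i\<in>I. p i * - ln (q i) + (q i - p i))" by (rule sum_mono)
  also have "\<dots> = (\<Sum>i\<in>I. p i * - ln (q i)) + (sum q I - sum p I)" by (simp add: sum.distrib sum_subtractf sum_negf)
  finally show ?thesis using p q by (simp add: sum_negf)
qed

locale partition_dynamics = prob_space M for M :: "'a measure" +
  fixes T :: "'a \<Rightarrow> 'a" and P :: "'a set set"
  assumes T: "T \<in> measurable M M" and T_invariant: "distr M M T = M" and P: "finite_partition M P"
begin

section \<open>Itineraries and the entropy of a partition\<close>

definition lab :: "'a \<Rightarrow> 'a set" where "lab x = (THE A. A \<in> P \<and> x \<in> A)"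

text \<open>The itinerary of x through the partition, made extensional so that all itineraries of
  length n lie in a finite product set.\<close>

definition name :: "nat \<Rightarrow> 'a \<Rightarrow> nat \<Rightarrow> 'a set" where
  "name n x = restrict (\<lambda>i. lab ((T ^^ i) x)) {..<n}"

definition names :: "nat \<Rightarrow> (nat \<Rightarrow> 'a set) set" where
  "names n = PiE {..<n} (\<lambda>_. P)"

definition atom :: "nat \<Rightarrow> (nat \<Rightarrow> 'a set) \<Rightarrow> 'a set" where
  "atom n a = {x \<in> space M. name n x = a}"

definition mass :: "nat \<Rightarrow> (nat \<Rightarrow> 'a set) \<Rightarrow> real" where
  "mass n a = measure M (atom n a)"

definition H :: "nat \<Rightarrow> real" where
  "H n = partition_entropy M (iterated_join M T P n)"

lemma finite_P: "finite P" and P_sets: "A \<in> P \<Longrightarrow> A \<in> sets M" and P_cover: "\<Union>P = space M"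
  using P unfolding finite_partition_def by blast+

lemma P_disjoint: "A \<in> P \<Longrightarrow> B \<in> P \<Longrightarrow> x \<in> A \<Longrightarrow> x \<in> B \<Longrightarrow> A = B"
proof (rule ccontr)
  assume AB: "A \<in> P" "B \<in> P" "x \<in> A" "x \<in> B" "A \<noteq> B"
  have "disjoint P" using P by (simp add: finite_partition_def)
  then have "A \<inter> B = {}" using AB by (intro disjointD)
  with AB show False by blast
qed

lemma lab_eq: "A \<in> P \<Longrightarrow> x \<in> A \<Longrightarrow> lab x = A"
  unfolding lab_def by (rule the_equality) (auto dest: P_disjoint)

lemma lab_in: "x \<in> space M \<Longrightarrow> lab x \<in> P" and in_lab: "x \<in> space M \<Longrightarrow> x \<in> lab x"
  using lab_eq P_cover by (metis UnionE)+

lemma funpow_T: "T ^^ n \<in> measurable M M"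
  by (induction n) (simp_all add: id_def o_def measurable_compose[OF _ T])

lemma funpow_space: "x \<in> space M \<Longrightarrow> (T ^^ n) x \<in> space M"
  using measurable_space[OF funpow_T] .

lemma funpow_invariant: "distr M M (T ^^ n) = M"
proof (induction n)
  case 0
  have "distr M M (\<lambda>x. x) = M" by (rule distr_id)
  then show ?case by (simp add: id_def)
next
  case (Suc n)
  have "distr M M (T ^^ Suc n) = distr (distr M M (T ^^ n)) M T"
    by (simp add: distr_distr[OF T funpow_T] o_def)
  then show ?case unfolding Suc T_invariant .
qed

lemma integral_funpow:
  fixes \<phi> :: "'a \<Rightarrow> real"
  assumes "integrable M \<phi>"
  shows "integrable M (\<lambda>x. \<phi> ((T ^^ n) x))" and "(\<integral>x. \<phi> ((T ^^ n) x) \<partial>M) = integral\<^sup>L M \<phi>"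
proof -
  have m: "\<phi> \<in> borel_measurable M" using assms by simp
  show "integrable M (\<lambda>x. \<phi> ((T ^^ n) x))"
    using integrable_distr_eq[OF funpow_T[of n] m] assms by (simp add: funpow_invariant)
  show "(\<integral>x. \<phi> ((T ^^ n) x) \<partial>M) = integral\<^sup>L M \<phi>"
    using integral_distr[OF funpow_T[of n] m] by (simp add: funpow_invariant)
qed

lemma finite_names [simp]: "finite (names n)"
  unfolding names_def by (intro finite_PiE finite_P) auto

lemma name_in: "x \<in> space M \<Longrightarrow> name n x \<in> names n"
  by (auto simp: name_def names_def lab_in funpow_space)

lemma atom_eq: assumes "a \<in> names n" shows "atom n a = space M \<inter> (\<Inter>i<n. (T ^^ i) -` a i)"
proof -
  have "name n x = a \<longleftrightarrow> (\<forall>i<n. (T ^^ i) x \<in> a i)" if x: "x \<in> space M" for x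
  proof
    assume "name n x = a"
    then show "\<forall>i<n. (T ^^ i) x \<in> a i"
      using in_lab[OF funpow_space[OF x]] by (auto simp: name_def)
  next
    assume R: "\<forall>i<n. (T ^^ i) x \<in> a i"
    show "name n x = a"
    proof
      fix i show "name n x i = a i"
      proof (cases "i < n")
        case True
        then have "lab ((T ^^ i) x) = a i" using R assms by (intro lab_eq) (auto simp: names_def)
        then show ?thesis using True by (simp add: name_def)
      next
        case False
        then show ?thesis using assms by (simp add: name_def names_def PiE_iff extensional_def)
      qed
    qed
  qed
  then show ?thesis by (auto simp: atom_def)
qed

lemma atom_sets: assumes "a \<in> names n" shows "atom n a \<in> sets M"
proof -
  have "atom n a = space M \<inter> (\<Inter>i<n. (T ^^ i) -` a i \<inter> space M)"
    using atom_eq[OF assms] by auto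
  moreover have "(T ^^ i) -` a i \<inter> space M \<in> sets M" if "i < n" for i
    using assms that by (intro measurable_sets[OF funpow_T] P_sets) (auto simp: names_def)
  ultimately show ?thesis
  proof (cases "n = 0")
    case False
    then have "(\<Inter>i<n. (T ^^ i) -` a i \<inter> space M) \<in> sets M"
      using \<open>\<And>i. i < n \<Longrightarrow> (T ^^ i) -` a i \<inter> space M \<in> sets M\<close>
      by (intro sets.finite_INT) auto
    then show ?thesis using \<open>atom n a = _\<close> by (simp add: sets.Int)
  qed simp
qed

lemma mass_nonneg: "0 \<le> mass n a" and mass_le_1: "mass n a \<le> 1"
  by (simp_all add: mass_def)

lemma integral_name:
  fixes h :: "(nat \<Rightarrow> 'a set) \<Rightarrow> real"
  shows "integrable M (\<lambda>x. h (name n x))" and "(\<integral>x. h (name n x) \<partial>M) = (\<Sum>a\<in>names n. mass n a * h a)"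
proof -
  define s where "s x = (\<Sum>a\<in>names n. h a * indicator (atom n a) x)" for x
  have eq: "h (name n x) = s x" if "x \<in> space M" for x
  proof -
    have "s x = (\<Sum>a\<in>names n. if a = name n x then h a else 0)"
      unfolding s_def using that by (intro sum.cong) (auto simp: atom_def)
    then show ?thesis using name_in[OF that] by simp
  qed
  have int: "integrable M (\<lambda>x. h a * indicator (atom n a) x)" if "a \<in> names n" for a
    using atom_sets[OF that] by (simp add: emeasure_eq_measure)
  have "integrable M s" unfolding s_def by (intro Bochner_Integration.integrable_sum int)
  then show "integrable M (\<lambda>x. h (name n x))"
    using eq by (simp cong: Bochner_Integration.integrable_cong)
  have "(\<integral>x. h (name n x) \<partial>M) = integral\<^sup>L M s" by (intro Bochner_Integration.integral_cong eq refl)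
  also have "\<dots> = (\<Sum>a\<in>names n. \<integral>x. h a * indicator (atom n a) x \<partial>M)"
    unfolding s_def by (intro Bochner_Integration.integral_sum int)
  also have "\<dots> = (\<Sum>a\<in>names n. mass n a * h a)"
    using atom_sets by (intro sum.cong) (simp_all add: mass_def mult.commute)
  finally show "(\<integral>x. h (name n x) \<partial>M) = (\<Sum>a\<in>names n. mass n a * h a)" .
qed

lemma sum_mass: "(\<Sum>a\<in>names n. mass n a) = 1"
  using integral_name(2)[of "\<lambda>_. 1" n] by (simp add: prob_space)

lemma H_eq: "H n = - (\<Sum>a\<in>names n. mass n a * ln (mass n a))"
proof -
  have "iterated_join M T P n = atom n ` names n"
  proof (intro equalityI subsetI)
    fix X assume "X \<in> iterated_join M T P n"
    then obtain A where A: "X = space M \<inter> (\<Inter>i<n. (T ^^ i) -` A i)" "\<forall>i<n. A i \<in> P"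
      by (auto simp: iterated_join_def)
    have a: "restrict A {..<n} \<in> names n" using A(2) by (auto simp: names_def)
    have "X = atom n (restrict A {..<n})" unfolding atom_eq[OF a] A(1) by auto
    with a show "X \<in> atom n ` names n" by blast
  next
    fix X assume "X \<in> atom n ` names n"
    then obtain a where a: "a \<in> names n" "X = atom n a" by blast
    then show "X \<in> iterated_join M T P n"
      unfolding iterated_join_def using atom_eq[OF a(1)] by (auto simp: names_def PiE_iff intro!: exI[of _ a])
  qed
  \<comment> \<open>Different itineraries can have the same atom only if it is empty, and then the
    term is 0.\<close>
  moreover have "(\<Sum>X\<in>atom n ` names n. measure M X * ln (measure M X)) = (\<Sum>a\<in>names n. mass n a * ln (mass n a))"
  proof (subst sum.reindex_nontrivial)
    fix a b assume "a \<in> names n" "b \<in> names n" "a \<noteq> b" "atom n a = atom n b"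
    then have "atom n a = {}" by (auto simp: atom_def)
    then show "measure M (atom n a) * ln (measure M (atom n a)) = 0" by simp
  qed (simp_all add: mass_def)
  ultimately show ?thesis by (simp add: H_def partition_entropy_def)
qed

lemma H_integral: "H n = (\<integral>x. - ln (mass n (name n x)) \<partial>M)"
  using integral_name(2)[of "\<lambda>a. - ln (mass n a)" n] by (simp add: H_eq sum_negf)

lemma H_nonneg: "0 \<le> H n"
  unfolding H_integral using mass_nonneg mass_le_1 by (intro integral_nonneg_AE AE_I2) (metis ln_0 ln_le_zero_iff neg_0_le_iff_le order_refl order_le_less)

text \<open>Turns a pointwise lower estimate of subprobability weights on itineraries into an upper
  bound for the entropy. Both subadditivity and the variational upper bound reduce to a choice of
  such weights.\<close>

lemma H_le_integral:
  assumes q: "\<And>a. a \<in> names n \<Longrightarrow> 0 \<le> q a" "sum q (names n) \<le> 1"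
    and pos: "\<And>a. a \<in> names n \<Longrightarrow> 0 < mass n a \<Longrightarrow> 0 < q a"
    and \<phi>: "integrable M \<phi>" "\<And>x. x \<in> space M \<Longrightarrow> - ln (q (name n x)) \<le> \<phi> x"
  shows "H n \<le> integral\<^sup>L M \<phi>"
proof -
  have "H n \<le> (\<Sum>a\<in>names n. mass n a * - ln (q a))"
    unfolding H_eq using q pos by (intro gibbs_inequality) (auto simp: mass_nonneg sum_mass)
  also have "\<dots> = (\<integral>x. - ln (q (name n x)) \<partial>M)" by (rule integral_name(2)[symmetric])
  also have "\<dots> \<le> integral\<^sup>L M \<phi>" using \<phi> by (intro integral_mono integral_name) auto
  finally show ?thesis .
qed

text \<open>The weights make the first n and the last m letters independent, with their own masses;
  by invariance the last m letters are distributed like an itinerary of length m.\<close>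

lemma H_subadditive: "H (n + m) \<le> H n + H m"
proof -
  define front where "front a = restrict a {..<n}" for a :: "nat \<Rightarrow> 'a set"
  define rear where "rear a = restrict (\<lambda>i. a (n + i)) {..<m}" for a :: "nat \<Rightarrow> 'a set"
  define q where "q a = mass n (front a) * mass m (rear a)" for a
  have fb: "front (name (n + m) x) = name n x" "rear (name (n + m) x) = name m ((T ^^ n) x)" for x
    by (auto simp: front_def rear_def name_def restrict_def fun_eq_iff funpow_add add.commute[of n])
  define \<phi> where "\<phi> x = - ln (mass n (name n x)) + - ln (mass m (name m ((T ^^ n) x)))" for x
  have int: "integrable M (\<lambda>x. - ln (mass k (name k x)))" for k
    by (rule integral_name(1)[of "\<lambda>a. - ln (mass k a)"])
  have "H (n + m) \<le> integral\<^sup>L M \<phi>"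
  proof (rule H_le_integral)
    show "0 \<le> q a" for a by (simp add: q_def mass_nonneg)
    have "sum q (names (n + m)) = (\<Sum>(a, b)\<in>names n \<times> names m. mass n a * mass m b)"
    proof (rule sum.reindex_bij_witness[where j = "\<lambda>a. (front a, rear a)" and
        i = "\<lambda>(a, b) i. if i < n then a i else if i < n + m then b (i - n) else undefined"])
      fix a assume "a \<in> names (n + m)"
      then show "(case (front a, rear a) of (a, b) \<Rightarrow> \<lambda>i. if i < n then a i else if i < n + m then b (i - n) else undefined) = a"
        "(front a, rear a) \<in> names n \<times> names m"
        by (auto simp: names_def front_def rear_def PiE_iff extensional_def fun_eq_iff)
    next
      fix ab assume "ab \<in> names n \<times> names m"
      then show "(front (case ab of (a, b) \<Rightarrow> \<lambda>i. if i < n then a i else if i < n + m then b (i - n) else undefined),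
          rear (case ab of (a, b) \<Rightarrow> \<lambda>i. if i < n then a i else if i < n + m then b (i - n) else undefined)) = ab"
        "(case ab of (a, b) \<Rightarrow> \<lambda>i. if i < n then a i else if i < n + m then b (i - n) else undefined) \<in> names (n + m)"
        by (auto simp: names_def front_def rear_def PiE_iff extensional_def fun_eq_iff)
    qed (simp add: q_def)
    also have "\<dots> = (\<Sum>a\<in>names n. mass n a) * (\<Sum>b\<in>names m. mass m b)"
      by (simp add: sum_product sum.cartesian_product)
    finally show "sum q (names (n + m)) \<le> 1" by (simp add: sum_mass)
    fix a assume a: "a \<in> names (n + m)" and pos: "0 < mass (n + m) a"
    have fa: "front a \<in> names n" "rear a \<in> names m" using a by (auto simp: names_def front_def rear_def)
    have "atom (n + m) a \<subseteq> atom n (front a)" using fb by (auto simp: atom_def)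
    then have "mass (n + m) a \<le> mass n (front a)"
      unfolding mass_def using fa atom_sets by (intro finite_measure_mono) auto
    moreover have "mass (n + m) a \<le> mass m (rear a)"
    proof -
      have "atom (n + m) a \<subseteq> (T ^^ n) -` atom m (rear a) \<inter> space M"
        using fb funpow_space by (auto simp: atom_def)
      then have "mass (n + m) a \<le> measure M ((T ^^ n) -` atom m (rear a) \<inter> space M)"
        unfolding mass_def using fa atom_sets funpow_T by (intro finite_measure_mono) auto
      also have "\<dots> = measure (distr M M (T ^^ n)) (atom m (rear a))"
        using fa atom_sets by (intro measure_distr[symmetric] funpow_T) auto
      finally show ?thesis by (simp add: funpow_invariant mass_def)
    qed
    ultimately show "0 < q a" using pos by (simp add: q_def)
  next
    show "integrable M \<phi>" unfolding \<phi>_def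
      by (intro Bochner_Integration.integrable_add int integral_funpow(1)[OF int])
    show "- ln (q (name (n + m) x)) \<le> \<phi> x" for x
    proof -
      \<comment> \<open>Where a factor vanishes, the convention ln 0 = 0 makes the left side 0, and
        both summands of \<phi> are nonnegative.\<close>
      have "0 \<le> - ln (mass k a)" for k a using mass_nonneg[of k a] mass_le_1[of k a]
        by (cases "mass k a = 0") auto
      moreover have "ln (u * v) = ln u + ln v \<or> u * v = 0" if "0 \<le> u" "0 \<le> v" for u v :: real
        using that by (cases "u = 0 \<or> v = 0") (auto simp: ln_mult)
      ultimately show ?thesis unfolding q_def \<phi>_def fb
        by (smt (verit) ln_0 mass_nonneg)
    qed
  qed
  also have "integral\<^sup>L M \<phi> = H n + H m"
    unfolding \<phi>_def H_integral using integral_funpow[OF int, of m n] int[of n]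
    by (subst Bochner_Integration.integral_add) simp_all
  finally show ?thesis .
qed

text \<open>Makes the \<open>lim\<close> in the definition of entropy a genuine limit, with a real
  value.\<close>

lemma entropy_rate:
  obtains L where "(\<lambda>n. H n / n) \<longlonglongrightarrow> L"
    "lim (\<lambda>n. ereal (partition_entropy M (iterated_join M T P n) / real n)) = ereal L"
proof -
  have "convergent (\<lambda>n. H n / n)" using H_subadditive H_nonneg by (rule fekete_subadditive)
  then obtain L where L: "(\<lambda>n. H n / n) \<longlonglongrightarrow> L" by (auto simp: convergent_def)
  then have "(\<lambda>n. ereal (H n / n)) \<longlonglongrightarrow> ereal L" by simp
  then have "lim (\<lambda>n. ereal (H n / n)) = ereal L" by (rule limI)
  then show ?thesis using that[OF L] by (simp add: H_def)
qed

end

subsection \<open>The variational principle\<close>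

text \<open>The approximable sets contain the generating algebra and form a sigma-algebra:
  complements keep the symmetric difference, and a countable union is first truncated to a finite
  one.\<close>

lemma clopen_approximation:
  assumes "prob_space \<nu>" and sets: "sets \<nu> = sets (dual_borel d)" and A: "A \<in> sets \<nu>" and "0 < e"
  shows "\<exists>C\<in>dual_clopen d. measure \<nu> ((A - C) \<union> (C - A)) < e"
proof -
  interpret prob_space \<nu> by fact
  interpret A: algebra "dual_space d" "dual_clopen d" by (rule algebra_dual_clopen)
  have clopen: "C \<in> sets \<nu>" if "C \<in> dual_clopen d" for C using that by (simp add: sets dual_clopen_sets)
  have "A \<in> sigma_sets (dual_space d) (dual_clopen d)" using A by (simp add: sets sets_dual_borel)
  then show ?thesis using \<open>0 < e\<close>
  proof (induction A arbitrary: e rule: sigma_sets.induct)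
    case (Basic A)
    then show ?case by (intro bexI[of _ A]) auto
  next
    case Empty
    then show ?case by (intro bexI[of _ "{}"]) auto
  next
    case (Compl A)
    then obtain C where C: "C \<in> dual_clopen d" "measure \<nu> ((A - C) \<union> (C - A)) < e" by blast
    have Asub: "A \<subseteq> dual_space d" by (rule sigma_sets_into_sp[OF A.space_closed Compl.hyps])
    have "dual_space d - A - (dual_space d - C) \<union> (dual_space d - C - (dual_space d - A)) = (A - C) \<union> (C - A)"
      using Asub dual_clopen_subset[OF C(1)] by blast
    then show ?case using C by (intro bexI[of _ "dual_space d - C"]) auto
  next
    case (Union A)
    have As: "A i \<in> sets \<nu>" for i using Union.hyps by (simp add: sets sets_dual_borel)
    have "(\<lambda>n. measure \<nu> (\<Union>i<n. A i)) \<longlonglongrightarrow> measure \<nu> (\<Union>n. \<Union>i<n. A i)"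
      using As by (intro finite_Lim_measure_incseq incseq_SucI) (auto simp: lessThan_Suc)
    moreover have un: "(\<Union>n. \<Union>i<n. A i) = (\<Union>i. A i)" by blast
    ultimately have "eventually (\<lambda>n. measure \<nu> (\<Union>i. A i) - e / 2 < measure \<nu> (\<Union>i<n. A i)) sequentially"
      using Union.prems by (intro order_tendstoD(1)) auto
    then obtain n where n: "measure \<nu> (\<Union>i. A i) - e / 2 < measure \<nu> (\<Union>i<n. A i)"
      by (auto simp: eventually_sequentially)
    \<comment> \<open>Half of e is spent on truncation, the other half is shared by n
      approximations; n + 1 keeps the denominator positive.\<close>
    have "0 < e / (2 * (real n + 1))" using Union.prems by simp
    then have "\<forall>i. \<exists>C\<in>dual_clopen d. measure \<nu> ((A i - C) \<union> (C - A i)) < e / (2 * (real n + 1))"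
      using Union.IH by blast
    then obtain C where C: "\<And>i. C i \<in> dual_clopen d"
      "\<And>i. measure \<nu> ((A i - C i) \<union> (C i - A i)) < e / (2 * (real n + 1))" by metis
    define D where "D i = (A i - C i) \<union> (C i - A i)" for i
    have Ds: "D i \<in> sets \<nu>" for i using As clopen C by (auto simp: D_def)
    define U where "U = (\<Union>i<n. C i)"
    have U: "U \<in> dual_clopen d" unfolding U_def using C by (intro A.finite_UN) auto
    have "((\<Union>i. A i) - U) \<union> (U - (\<Union>i. A i)) \<subseteq> ((\<Union>i. A i) - (\<Union>i<n. A i)) \<union> (\<Union>i<n. D i)"
      by (auto simp: U_def D_def)
    then have "measure \<nu> (((\<Union>i. A i) - U) \<union> (U - (\<Union>i. A i))) \<le>
        measure \<nu> (((\<Union>i. A i) - (\<Union>i<n. A i)) \<union> (\<Union>i<n. D i))"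
      using As Ds by (intro finite_measure_mono) auto
    also have "\<dots> \<le> measure \<nu> ((\<Union>i. A i) - (\<Union>i<n. A i)) + measure \<nu> (\<Union>i<n. D i)"
      using As Ds by (intro measure_Un_le) auto
    also have "measure \<nu> ((\<Union>i. A i) - (\<Union>i<n. A i)) = measure \<nu> (\<Union>i. A i) - measure \<nu> (\<Union>i<n. A i)"
      using As by (intro finite_measure_Diff) auto
    also have "measure \<nu> (\<Union>i<n. D i) \<le> (\<Sum>i<n. measure \<nu> (D i))"
      using Ds by (intro measure_UNION_le) auto
    also have "(\<Sum>i<n. measure \<nu> (D i)) \<le> (\<Sum>i<n. e / (2 * (real n + 1)))"
      using C(2) by (intro sum_mono) (simp add: D_def less_imp_le)
    also have "\<dots> \<le> e / 2" using Union.prems by (simp add: field_simps)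
    finally have "measure \<nu> (((\<Union>i. A i) - U) \<union> (U - (\<Union>i. A i))) < e" using n by simp
    then show ?case using U by blast
  qed
qed

section \<open>Upper bound for the entropy of invariant measures\<close>

context normalized_potential
begin

lemma ln_g_continuous: "continuous_on (dual_space d) (\<lambda>w. ln (g w))"
  using g_pos by (intro continuous_on_ln g_cont) (auto simp: less_imp_neq[symmetric])

text \<open>The weights \<open>q\<close> are those of a random name: choose a point of the fibre of length \<open>m + n\<close> with
  weight \<open>birkhoff\<close>, read off its name for the clopen approximation \<open>Q\<close> of the partition, and
  perturb each letter independently. Gibbs' inequality against \<open>q\<close> replaces the usual
  argument by conditional entropies.\<close>

lemma entropy_rate_upper_bound:
  assumes \<nu>: "invariant_prob d \<nu>" and P: "finite_partition \<nu> P"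
    and lim: "(\<lambda>n. partition_entropy \<nu> (iterated_join \<nu> right_shift P n) / n) \<longlonglongrightarrow> L"
  shows "L \<le> (\<integral>w. - ln (g w) \<partial>\<nu>)"
proof -
  have prob: "prob_space \<nu>" and sets: "sets \<nu> = sets (dual_borel d)" and inv: "distr \<nu> \<nu> right_shift = \<nu>"
    using \<nu> by (auto simp: invariant_prob_def dual_prob_def)
  interpret prob_space \<nu> by (rule prob)
  interpret partition_dynamics \<nu> right_shift P
    by unfold_locales (use measurable_right_shift[OF sets] inv P in auto)
  have space: "space \<nu> = dual_space d" using sets_eq_imp_space_eq[OF sets] by simp
  define I where "I = (\<integral>w. - ln (g w) \<partial>\<nu>)"
  have int_g: "integrable \<nu> (\<lambda>w. ln (g w))"
    by (rule continuous_on_dual_integrable[OF ln_g_continuous sets finite_measure_axioms])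
  have "(\<lambda>_. 0) \<in> \<Union>P" unfolding P_cover space using d_pos by (rule zero_in_dual)
  then have P_ne: "P \<noteq> {}" by blast
  have bound: "L \<le> I + 3 * \<delta>" if \<delta>: "0 < \<delta>" for \<delta> :: real
  proof -
    obtain C where C: "1 \<le> C" "\<And>n x y. x \<in> dual_space d \<Longrightarrow> y \<in> dual_space d \<Longrightarrow> agree n x y \<Longrightarrow>
       birkhoff n x \<le> C * exp (\<delta> * n) * birkhoff n y"
      using birkhoff_distortion[OF \<delta>] by blast
    \<comment> \<open>The kernel \<open>K\<close> gives the correct letter weight exp (- \<delta>)
      and each other letter an equal small weight \<kappa>. A correct letter then costs \<delta>, a
      wrong one |ln \<kappa>|, and the total weight stays at most 1.\<close>
    define \<kappa> where "\<kappa> = (1 - exp (- \<delta>)) / card P"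
    have cardP: "0 < card P" using P_ne finite_P by (simp add: card_gt_0_iff)
    have \<kappa>: "0 < \<kappa>" using \<delta> cardP by (simp add: \<kappa>_def)
    define K where "K A B = (if A = B then exp (- \<delta>) else \<kappa>)" for A B :: "(nat \<Rightarrow> nat) set"
    have K_pos: "0 < K A B" for A B using \<kappa> by (simp add: K_def)
    have K_sum: "(\<Sum>A\<in>P. K A B) \<le> 1" for B
    proof -
      have "(\<Sum>A\<in>P. K A B) \<le> (\<Sum>A\<in>P. (if A = B then exp (- \<delta>) else 0) + \<kappa>)"
        using \<kappa> by (intro sum_mono) (simp add: K_def)
      also have "\<dots> \<le> exp (- \<delta>) + card P * \<kappa>" using finite_P by (simp add: sum.distrib)
      also have "\<dots> = 1" using cardP by (simp add: \<kappa>_def)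
      finally show ?thesis .
    qed
    define B where "B = \<bar>ln \<kappa>\<bar>"
    \<comment> \<open>Chosen so that misread letters cost at most \<delta> per step on average: B
      times the mass of the bad set \<open>E\<close> is at most \<delta>.\<close>
    have "0 < \<delta> / ((B + 1) * card P)" using \<delta> cardP by (simp add: B_def)
    then have "\<forall>A\<in>P. \<exists>D\<in>dual_clopen d. measure \<nu> ((A - D) \<union> (D - A)) < \<delta> / ((B + 1) * card P)"
      using clopen_approximation[OF prob sets P_sets] by blast
    then obtain D where D: "\<And>A. A \<in> P \<Longrightarrow> D A \<in> dual_clopen d"
      "\<And>A. A \<in> P \<Longrightarrow> measure \<nu> ((A - D A) \<union> (D A - A)) < \<delta> / ((B + 1) * card P)" by metis
    define E where "E = (\<Union>A\<in>P. (A - D A) \<union> (D A - A))"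
    have Es: "E \<in> sets \<nu>" unfolding E_def
      using finite_P P_sets D(1) dual_clopen_sets sets by (intro sets.finite_UN) auto
    have "measure \<nu> E \<le> (\<Sum>A\<in>P. measure \<nu> ((A - D A) \<union> (D A - A)))"
      unfolding E_def using finite_P P_sets D(1) dual_clopen_sets sets by (intro measure_UNION_le) auto
    also have "\<dots> \<le> (\<Sum>A\<in>P. \<delta> / ((B + 1) * card P))" using D(2) by (intro sum_mono) (simp add: less_imp_le)
    also have "\<dots> = \<delta> / (B + 1)" using cardP by simp
    finally have "(B + 1) * measure \<nu> E \<le> \<delta>" by (simp add: B_def field_simps)
    then have "B * measure \<nu> E + measure \<nu> E \<le> \<delta>" by (simp add: distrib_right)
    then have BE: "B * measure \<nu> E \<le> \<delta>" using measure_nonneg[of \<nu> E] by linarith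
    \<comment> \<open>The clopen approximations may overlap or leave gaps, hence the arbitrary
      choices. What counts is that \<open>Q\<close> is decided by m digits and equals the true label
      off \<open>E\<close>.\<close>
    define Q where "Q x = (if \<exists>A\<in>P. x \<in> D A then SOME A. A \<in> P \<and> x \<in> D A else SOME A. A \<in> P)" for x
    have Q_lab: "Q x = lab x" if x: "x \<in> dual_space d" "x \<notin> E" for x
    proof -
      have l: "lab x \<in> P" "x \<in> lab x" using x by (auto simp: space lab_in in_lab)
      then have "x \<in> D (lab x)" using x(2) by (auto simp: E_def)
      then have ex: "\<exists>A\<in>P. x \<in> D A" using l(1) by blast
      have uniq: "A = lab x" if "A \<in> P" "x \<in> D A" for A
      proof -
        have "x \<in> A" using that x(2) unfolding E_def by blast
        then show ?thesis using lab_eq[OF that(1)] by simp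
      qed
      have "(SOME A. A \<in> P \<and> x \<in> D A) = lab x"
      proof (rule some_equality)
        show "lab x \<in> P \<and> x \<in> D (lab x)" using l(1) \<open>x \<in> D (lab x)\<close> by (rule conjI)
      qed (rule uniq, blast+)
      then show ?thesis using ex by (simp add: Q_def)
    qed
    have "\<forall>A\<in>P. \<exists>k. \<forall>j x y. k \<le> j \<longrightarrow> x \<in> dual_space d \<longrightarrow> y \<in> dual_space d \<longrightarrow> agree j x y \<longrightarrow> (x \<in> D A \<longleftrightarrow> y \<in> D A)"
      using D(1) by (meson dual_clopenE)
    then obtain lev where lev: "\<And>A j x y. A \<in> P \<Longrightarrow> lev A \<le> j \<Longrightarrow> x \<in> dual_space d \<Longrightarrow> y \<in> dual_space d \<Longrightarrow>
      agree j x y \<Longrightarrow> (x \<in> D A \<longleftrightarrow> y \<in> D A)" by metis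
    define m where "m = Max (lev ` P)"
    have Q_agree: "Q x = Q y" if "x \<in> dual_space d" "y \<in> dual_space d" "agree m x y" for x y
    proof -
      have "x \<in> D A \<longleftrightarrow> y \<in> D A" if A: "A \<in> P" for A
        by (rule lev[OF A, of m]) (use that \<open>x \<in> dual_space d\<close> \<open>y \<in> dual_space d\<close> \<open>agree m x y\<close> A finite_P in \<open>auto simp: m_def\<close>)
      then have "(A \<in> P \<and> x \<in> D A) = (A \<in> P \<and> y \<in> D A)" for A by blast
      then show ?thesis unfolding Q_def Bex_def by (simp only:)
    qed
    have step: "H n \<le> ln C + \<delta> * (m + n) + (m + n) * I + 2 * n * \<delta>" for n
    proof -
      define q where "q a = (\<Sum>y\<in>fibre d (m + n). birkhoff (m + n) y * (\<Prod>i<n. K (a i) (Q ((right_shift ^^ i) y))))"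
        for a :: "nat \<Rightarrow> (nat \<Rightarrow> nat) set"
      define \<phi> where "\<phi> x = ln C + \<delta> * (m + n) + (\<Sum>i<m + n. - ln (g ((right_shift ^^ i) x))) +
        (\<Sum>i<n. \<delta> + B * indicator E ((right_shift ^^ i) x))" for x
      have term_pos: "0 < birkhoff (m + n) y * (\<Prod>i<n. K (a i) (Q ((right_shift ^^ i) y)))"
        if "y \<in> dual_space d" for y and a :: "nat \<Rightarrow> (nat \<Rightarrow> nat) set"
        using birkhoff_pos[OF that] K_pos by (intro mult_pos_pos prod_pos) auto
      have q_pos: "0 < q a" for a
        unfolding q_def using fibre_subset fibre_nonempty[OF d_pos] by (intro sum_pos term_pos) auto
      have int_E: "integrable \<nu> (indicator E :: _ \<Rightarrow> real)" using Es by (simp add: emeasure_eq_measure)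
      have "H n \<le> integral\<^sup>L \<nu> \<phi>"
      proof (rule H_le_integral)
        show "0 \<le> q a" for a using q_pos[of a] by simp
        show "0 < q a" for a by (rule q_pos)
        have "sum q (names n) = (\<Sum>y\<in>fibre d (m + n). birkhoff (m + n) y *
            (\<Sum>a\<in>names n. \<Prod>i<n. K (a i) (Q ((right_shift ^^ i) y))))"
          unfolding q_def sum_distrib_left by (rule sum.swap)
        also have "\<dots> \<le> (\<Sum>y\<in>fibre d (m + n). birkhoff (m + n) y * 1)"
        proof (intro sum_mono mult_left_mono)
          fix y assume y: "y \<in> fibre d (m + n)"
          \<comment> \<open>The letters are perturbed independently, so the sum over itineraries
            factors into one sum over \<open>P\<close> per step.\<close>
          have "(\<Sum>a\<in>names n. \<Prod>i<n. K (a i) (Q ((right_shift ^^ i) y))) =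
              (\<Prod>i<n. \<Sum>A\<in>P. K A (Q ((right_shift ^^ i) y)))"
            unfolding names_def using finite_P by (intro prod_sum_PiE[symmetric]) auto
          also have "\<dots> \<le> 1" using K_sum K_pos by (intro prod_le_1) (auto intro!: sum_nonneg simp: less_imp_le)
          finally show "(\<Sum>a\<in>names n. \<Prod>i<n. K (a i) (Q ((right_shift ^^ i) y))) \<le> 1" .
          show "0 \<le> birkhoff (m + n) y" using birkhoff_pos y fibre_subset by (intro less_imp_le) blast
        qed
        finally show "sum q (names n) \<le> 1" by (simp add: sum_birkhoff)
        show "integrable \<nu> \<phi>" unfolding \<phi>_def
          using integral_funpow(1)[OF int_g] integral_funpow(1)[OF int_E]
          by (intro Bochner_Integration.integrable_add Bochner_Integration.integrable_sum) auto
        fix x assume "x \<in> space \<nu>"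
        then have x: "x \<in> dual_space d" by (simp add: space)
        define y where "y = pad (m + n) x"
        have y: "y \<in> fibre d (m + n)" "y \<in> dual_space d" "agree (m + n) x y"
          using x by (simp_all add: y_def pad_in_fibre pad_in_dual)
        define W where "W = (\<Prod>i<n. K (lab ((right_shift ^^ i) x)) (Q ((right_shift ^^ i) x)))"
        have W_pos: "0 < W" unfolding W_def using K_pos by (intro prod_pos) auto
        have W_eq: "(\<Prod>i<n. K (name n x i) (Q ((right_shift ^^ i) y))) = W"
          unfolding W_def
        proof (rule prod.cong[OF refl])
          fix i assume "i \<in> {..<n}"
          then have i: "i < n" by simp
          have "agree m ((right_shift ^^ i) x) ((right_shift ^^ i) y)"
            by (rule agree_shift) (use y(3) i in \<open>auto intro: agree_mono\<close>)
          then have "Q ((right_shift ^^ i) x) = Q ((right_shift ^^ i) y)" using x y by (intro Q_agree) auto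
          then show "K (name n x i) (Q ((right_shift ^^ i) y)) = K (lab ((right_shift ^^ i) x)) (Q ((right_shift ^^ i) x))"
            using i by (simp add: name_def)
        qed
        \<comment> \<open>Only the summand of the representative of x is kept; its length m + n
          makes \<open>Q\<close> agree with that of x at all n steps.\<close>
        have "birkhoff (m + n) y * W \<le> q (name n x)"
          unfolding q_def W_eq[symmetric] using y term_pos fibre_subset[of d "m + n"]
          by (intro member_le_sum[of y "fibre d (m + n)" "\<lambda>y. birkhoff (m + n) y * (\<Prod>i<n. K (name n x i) (Q ((right_shift ^^ i) y)))"])
            (auto intro: less_imp_le)
        then have "- ln (q (name n x)) \<le> - ln (birkhoff (m + n) y * W)"
          using birkhoff_pos[OF y(2), of "m + n"] W_pos q_pos by simp
        also have "\<dots> = - ln (birkhoff (m + n) y) - ln W"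
          using birkhoff_pos[OF y(2), of "m + n"] W_pos by (simp add: ln_mult)
        finally have "- ln (q (name n x)) \<le> - ln (birkhoff (m + n) y) - ln W" .
        moreover have "- ln (birkhoff (m + n) y) \<le> ln C + \<delta> * (m + n) - ln (birkhoff (m + n) x)"
        proof -
          have "ln (birkhoff (m + n) x) \<le> ln (C * exp (\<delta> * (m + n)) * birkhoff (m + n) y)"
            using C(2)[OF x y(2,3)] birkhoff_pos[OF x, of "m + n"] by simp
          also have "\<dots> = ln C + \<delta> * (m + n) + ln (birkhoff (m + n) y)"
            using C(1) birkhoff_pos[OF y(2), of "m + n"] by (simp add: ln_mult)
          finally show ?thesis by simp
        qed
        moreover have "- ln W \<le> (\<Sum>i<n. \<delta> + B * indicator E ((right_shift ^^ i) x))"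
        proof -
          have "ln W = (\<Sum>i<n. ln (K (lab ((right_shift ^^ i) x)) (Q ((right_shift ^^ i) x))))"
            unfolding W_def using K_pos by (intro ln_prod) (auto simp: less_imp_neq[symmetric])
          then have "- ln W = (\<Sum>i<n. - ln (K (lab ((right_shift ^^ i) x)) (Q ((right_shift ^^ i) x))))"
            by (simp add: sum_negf)
          also have "\<dots> \<le> (\<Sum>i<n. \<delta> + B * indicator E ((right_shift ^^ i) x))"
          proof (rule sum_mono)
            fix i
            show "- ln (K (lab ((right_shift ^^ i) x)) (Q ((right_shift ^^ i) x))) \<le> \<delta> + B * indicator E ((right_shift ^^ i) x)"
              using Q_lab[of "(right_shift ^^ i) x"] x \<delta>
              by (cases "(right_shift ^^ i) x \<in> E") (auto simp: K_def B_def)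
          qed
          finally show ?thesis .
        qed
        ultimately show "- ln (q (name n x)) \<le> \<phi> x"
          by (simp add: \<phi>_def ln_birkhoff[OF x] sum_negf)
      qed
      also have "integral\<^sup>L \<nu> \<phi> = ln C + \<delta> * (m + n) + (m + n) * I + n * (\<delta> + B * measure \<nu> E)"
      proof -
        have 1: "integrable \<nu> (\<lambda>x. - ln (g ((right_shift ^^ i) x)))" "(\<integral>x. - ln (g ((right_shift ^^ i) x)) \<partial>\<nu>) = I" for i
          using integral_funpow[OF int_g, of i] by (simp_all add: I_def)
        have 2: "integrable \<nu> (\<lambda>x. \<delta> + B * indicator E ((right_shift ^^ i) x))"
          "(\<integral>x. \<delta> + B * indicator E ((right_shift ^^ i) x) \<partial>\<nu>) = \<delta> + B * measure \<nu> E" for i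
          using integral_funpow[OF int_E, of i] Es by (simp_all add: prob_space)
        show ?thesis unfolding \<phi>_def
          using 1 2 by (simp add: Bochner_Integration.integral_add Bochner_Integration.integral_sum
              Bochner_Integration.integrable_sum prob_space del: Bochner_Integration.integral_minus)
      qed
      also have "\<dots> \<le> ln C + \<delta> * (m + n) + (m + n) * I + n * (\<delta> + \<delta>)"
        using BE by (intro add_left_mono mult_left_mono) auto
      finally show ?thesis by (simp add: algebra_simps)
    qed
    have l1: "(\<lambda>n. H n / n) \<longlonglongrightarrow> L" using lim by (simp add: H_def)
    \<comment> \<open>Of the 3 \<delta>, one comes from the distortion of \<open>birkhoff\<close>
      and two from the perturbed letters, correct and misread.\<close>
    have l2: "(\<lambda>n. (ln C + \<delta> * m + m * I) / real n + (I + 3 * \<delta>)) \<longlonglongrightarrow> 0 + (I + 3 * \<delta>)"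
      by (intro tendsto_intros lim_const_over_n)
    have le: "H n / n \<le> (ln C + \<delta> * m + m * I) / real n + (I + 3 * \<delta>)" if "1 \<le> n" for n
    proof -
      have "H n / n \<le> (ln C + \<delta> * (m + n) + (m + n) * I + 2 * n * \<delta>) / n"
        using step[of n] by (intro divide_right_mono) simp_all
      also have "\<dots> = (ln C + \<delta> * m + m * I) / real n + (I + 3 * \<delta>)"
        using that by (simp add: field_simps)
      finally show ?thesis .
    qed
    have "L \<le> 0 + (I + 3 * \<delta>)"
      by (rule LIMSEQ_le[OF l1 l2]) (use le in blast)
    then show ?thesis by simp
  qed
  have "L \<le> I"
  proof (rule field_le_epsilon)
    fix e :: real assume "0 < e"
    then show "L \<le> I + e" using bound[of "e / 3"] by simp
  qed
  then show ?thesis by (simp add: I_def)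
qed

lemma measure_entropy_upper_bound:
  assumes \<nu>: "invariant_prob d \<nu>"
  shows "measure_entropy \<nu> right_shift \<le> ereal (\<integral>w. - ln (g w) \<partial>\<nu>)"
  unfolding measure_entropy_def
proof (rule SUP_least)
  fix P assume "P \<in> {P. finite_partition \<nu> P}"
  then have P: "finite_partition \<nu> P" by simp
  have prob: "prob_space \<nu>" and sets: "sets \<nu> = sets (dual_borel d)" and inv: "distr \<nu> \<nu> right_shift = \<nu>"
    using \<nu> by (auto simp: invariant_prob_def dual_prob_def)
  interpret prob_space \<nu> by (rule prob)
  interpret partition_dynamics \<nu> right_shift P
    by unfold_locales (use measurable_right_shift[OF sets] inv P in auto)
  obtain L where L: "(\<lambda>n. H n / n) \<longlonglongrightarrow> L"
    "lim (\<lambda>n. ereal (partition_entropy \<nu> (iterated_join \<nu> right_shift P n) / real n)) = ereal L"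
    by (rule entropy_rate)
  have "L \<le> (\<integral>w. - ln (g w) \<partial>\<nu>)"
    using L(1) unfolding H_def by (rule entropy_rate_upper_bound[OF \<nu> P])
  then show "lim (\<lambda>n. ereal (partition_entropy \<nu> (iterated_join \<nu> right_shift P n) / real n)) \<le>
      ereal (\<integral>w. - ln (g w) \<partial>\<nu>)" using L(2) by simp
qed

end

section \<open>Lower bound for the entropy of the g-measure\<close>

context g_measure_space
begin

lemma invariant_prob: "invariant_prob d \<mu>"
  by (simp add: invariant_prob_def dual_prob invariant)

text \<open>The same induction as for the distortion of \<open>birkhoff\<close>: on a cylinder of
  length n + 1 around w the values of \<open>g\<close> are at most
  \<open>b (Suc n) * g w\<close>.\<close>

lemma cyl_le_birkhoff:
  fixes \<delta> :: real
  assumes "0 < \<delta>"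
  obtains C where "1 \<le> C" "\<And>n w. w \<in> dual_space d \<Longrightarrow> measure \<mu> (cyl w n) \<le> C * exp (\<delta> * n) * birkhoff n w"
proof -
  obtain b C where C: "1 \<le> C" and b: "\<And>n. 0 \<le> b n" "\<And>n. (\<Prod>k<n. b (Suc k)) \<le> C * exp (\<delta> * n)"
    and step: "\<And>n x y. x \<in> dual_space d \<Longrightarrow> y \<in> dual_space d \<Longrightarrow> agree n x y \<Longrightarrow> g x \<le> b n * g y"
    using g_distortion[OF assms] by metis
  have main: "measure \<mu> (cyl w n) \<le> (\<Prod>k<n. b (Suc k)) * birkhoff n w" if "w \<in> dual_space d" for n w
    using that
  proof (induction n arbitrary: w)
    case (Suc n)
    have "measure \<mu> (cyl w (Suc n)) \<le> (b (Suc n) * g w) * measure \<mu> (cyl (right_shift w) n)"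
      using step[OF _ Suc.prems] g_pos
      by (intro cyl_bounds(2)[OF Suc.prems, of n 0]) (auto simp: right_cylinder_eq less_imp_le)
    also have "\<dots> \<le> (b (Suc n) * g w) * ((\<Prod>k<n. b (Suc k)) * birkhoff n (right_shift w))"
      using Suc b(1) g_pos[OF Suc.prems] by (intro mult_left_mono) auto
    finally show ?case by (simp add: birkhoff_Suc mult_ac)
  qed (simp add: birkhoff_def)
  show ?thesis
  proof (rule that[OF C])
    fix n w assume w: "w \<in> dual_space d"
    show "measure \<mu> (cyl w n) \<le> C * exp (\<delta> * n) * birkhoff n w"
      using main[OF w, of n] mult_right_mono[OF b(2)[of n] less_imp_le[OF birkhoff_pos[OF w, of n]]] by linarith
  qed
qed

text \<open>For the partition by the digit 0 the atoms are the cylinders, and the bound of their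
  masses by \<open>birkhoff\<close> turns the entropy into a Birkhoff sum of - ln g, up to ln C +
  \<delta> n.\<close>

lemma measure_entropy_lower_bound: "ereal (\<integral>w. - ln (g w) \<partial>\<mu>) \<le> measure_entropy \<mu> right_shift"
proof -
  define I where "I = (\<integral>w. - ln (g w) \<partial>\<mu>)"
  define P where "P = (\<lambda>i. {v \<in> dual_space d. v 0 = i}) ` {..<d}"
  have P: "finite_partition \<mu> P"
    unfolding finite_partition_def
  proof (intro conjI)
    show "P \<subseteq> sets \<mu>"
    proof
      fix A assume "A \<in> P"
      then obtain i where "A = {v \<in> dual_space d. v 0 = i}" by (auto simp: P_def)
      then have "A = cyl (\<lambda>_. i) 1" by (auto simp: right_cylinder_def)
      then show "A \<in> sets \<mu>" by (simp only: cyl_sets)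
    qed
    show "disjoint P" by (auto simp: P_def disjoint_def)
    show "\<Union>P = space \<mu>" by (auto simp: P_def space dual_space_def)
  qed (simp add: P_def)
  interpret partition_dynamics \<mu> right_shift P
    by unfold_locales (use measurable_right_shift[OF sets] invariant P in auto)
  have int_g: "integrable \<mu> (\<lambda>w. ln (g w))"
    by (rule continuous_on_dual_integrable[OF ln_g_continuous sets finite_measure_axioms])
  have lab: "lab x = {v \<in> dual_space d. v 0 = x 0}" if "x \<in> dual_space d" for x
    using that by (intro lab_eq) (auto simp: P_def dual_space_def)
  have name_eq: "name n y = name n x \<longleftrightarrow> agree n y x" if x: "x \<in> dual_space d" and y: "y \<in> dual_space d" for n x y
  proof -
    have "lab ((right_shift ^^ i) y) = lab ((right_shift ^^ i) x) \<longleftrightarrow> y i = x i" for i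
    proof -
      have xy: "(right_shift ^^ i) x \<in> dual_space d" "(right_shift ^^ i) y \<in> dual_space d" using x y by simp_all
      have "lab ((right_shift ^^ i) y) = lab ((right_shift ^^ i) x) \<longleftrightarrow> (right_shift ^^ i) y 0 = (right_shift ^^ i) x 0"
        unfolding lab[OF xy(1)] lab[OF xy(2)] using xy by auto
      then show ?thesis by (simp add: funpow_right_shift)
    qed
    then show ?thesis by (auto simp: name_def agree_def restrict_def fun_eq_iff)
  qed
  have mass_eq: "mass n (name n x) = measure \<mu> (cyl x n)" if "x \<in> dual_space d" for n x
    using that name_eq[OF that] by (auto simp: mass_def atom_def right_cylinder_eq space intro!: arg_cong[of _ _ "measure \<mu>"])
  obtain L where L: "(\<lambda>n. H n / n) \<longlonglongrightarrow> L"
    "lim (\<lambda>n. ereal (partition_entropy \<mu> (iterated_join \<mu> right_shift P n) / real n)) = ereal L"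
    by (rule entropy_rate)
  have bound: "I \<le> L + \<delta>" if \<delta>: "0 < \<delta>" for \<delta>
  proof -
    obtain C where C: "1 \<le> C" "\<And>n w. w \<in> dual_space d \<Longrightarrow> measure \<mu> (cyl w n) \<le> C * exp (\<delta> * n) * birkhoff n w"
      using cyl_le_birkhoff[OF \<delta>] by blast
    have int: "integrable \<mu> (\<lambda>x. - ln (g ((right_shift ^^ i) x)))" "(\<integral>x. - ln (g ((right_shift ^^ i) x)) \<partial>\<mu>) = I" for i
      using integral_funpow[OF int_g, of i] by (simp_all add: I_def)
    have "n * I - (ln C + \<delta> * n) \<le> H n" for n
    proof -
      have "n * I - (ln C + \<delta> * n) = (\<integral>x. (\<Sum>i<n. - ln (g ((right_shift ^^ i) x))) - (ln C + \<delta> * n) \<partial>\<mu>)"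
        using int by (simp add: Bochner_Integration.integral_diff Bochner_Integration.integral_sum
            Bochner_Integration.integrable_sum prob_space del: Bochner_Integration.integral_minus)
      also have "\<dots> \<le> H n"
        unfolding H_integral
      proof (rule integral_mono)
        show "integrable \<mu> (\<lambda>x. (\<Sum>i<n. - ln (g ((right_shift ^^ i) x))) - (ln C + \<delta> * n))"
          using int by (intro Bochner_Integration.integrable_diff Bochner_Integration.integrable_sum) auto
        show "integrable \<mu> (\<lambda>x. - ln (mass n (name n x)))"
          by (rule integral_name(1)[of "\<lambda>a. - ln (mass n a)"])
        fix x assume "x \<in> space \<mu>"
        then have x: "x \<in> dual_space d" by (simp add: space)
        have "ln (measure \<mu> (cyl x n)) \<le> ln (C * exp (\<delta> * n) * birkhoff n x)"
          using C(2)[OF x, of n] cyl_pos[OF x, of n] by simp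
        also have "\<dots> = ln C + \<delta> * n + ln (birkhoff n x)"
          using C(1) birkhoff_pos[OF x, of n] by (simp add: ln_mult)
        finally show "(\<Sum>i<n. - ln (g ((right_shift ^^ i) x))) - (ln C + \<delta> * n) \<le> - ln (mass n (name n x))"
          by (simp add: mass_eq[OF x] ln_birkhoff[OF x] sum_negf)
      qed
      finally show ?thesis .
    qed
    then have div_le: "(n * I - (ln C + \<delta> * n)) / n \<le> H n / n" for n by (rule divide_right_mono) simp
    have le: "I - \<delta> - ln C / n \<le> H n / n" if "1 \<le> n" for n
      using div_le[of n] that by (simp add: diff_divide_distrib add_divide_distrib algebra_simps)
    have lim: "(\<lambda>n. I - \<delta> - ln C / real n) \<longlonglongrightarrow> I - \<delta> - 0"
      by (intro tendsto_intros lim_const_over_n)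
    have "I - \<delta> - 0 \<le> L" by (rule LIMSEQ_le[OF lim L(1)]) (use le in blast)
    then show ?thesis by simp
  qed
  have "I \<le> L" by (rule field_le_epsilon) (rule bound)
  also have "ereal L \<le> measure_entropy \<mu> right_shift"
    unfolding measure_entropy_def L(2)[symmetric] using P by (intro SUP_upper) simp
  finally show ?thesis by (simp add: I_def)
qed

lemma measure_entropy_eq: "measure_entropy \<mu> right_shift = ereal (\<integral>w. - ln (g w) \<partial>\<mu>)"
  using measure_entropy_upper_bound[OF invariant_prob] measure_entropy_lower_bound by (rule antisym)

end

text \<open>Since ln \<Psi> = - ln g on the dual space, the entropy bound says that every invariant
  measure has value at most 0, and the entropy formula says that \<mu> attains it.\<close>

lemma (in normalized_potential) equilibrium:
  assumes \<Psi>: "\<And>w. w \<in> dual_space d \<Longrightarrow> \<Psi> w = 1 / g w"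
  shows "\<exists>\<mu>. dual_gibbs_type d \<Psi> \<mu> \<and>
    g_measure d (\<lambda>w. 1 / \<Psi> w) \<mu> \<and>
    pressure (dual_space d) seq_dist right_shift (\<lambda>w. - ln (\<Psi> w)) = 0 \<and>
    (AE w in transfer_dual d (\<lambda>_. 1) \<mu>.
       RN_deriv (transfer_dual d (\<lambda>_. 1) \<mu>) \<mu> w = ennreal (1 / \<Psi> w)) \<and>
    measure_entropy \<mu> right_shift - ereal (\<integral>w. ln (\<Psi> w) \<partial>\<mu>) = 0 \<and>
    (SUP \<nu>\<in>{\<nu>. invariant_prob d \<nu>}.
         measure_entropy \<nu> right_shift - ereal (\<integral>w. ln (\<Psi> w) \<partial>\<nu>)) = 0"
proof -
  obtain \<mu> where \<mu>: "prob_space \<mu>" "sets \<mu> = sets (dual_borel d)"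
    "\<And>\<phi>. continuous_on (dual_space d) \<phi> \<Longrightarrow> integral\<^sup>L \<mu> \<phi> = integral\<^sup>L \<mu> (transfer \<phi>)"
    using g_measure_exists by blast
  interpret g_measure_space d g \<mu>
    by (intro g_measure_space.intro g_measure_space_axioms.intro normalized_potential_axioms \<mu>)
  have lnPsi: "ln (\<Psi> w) = - ln (g w)" if "w \<in> dual_space d" for w
    using g_pos[OF that] by (simp add: \<Psi>[OF that] ln_div)
  have int_eq: "(\<integral>w. ln (\<Psi> w) \<partial>\<nu>) = (\<integral>w. - ln (g w) \<partial>\<nu>)" if "invariant_prob d \<nu>" for \<nu>
  proof -
    have "space \<nu> = dual_space d"
      using that sets_eq_imp_space_eq[of \<nu> "dual_borel d"] by (simp add: invariant_prob_def dual_prob_def)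
    then show ?thesis by (intro Bochner_Integration.integral_cong) (simp_all add: lnPsi)
  qed
  have zero: "measure_entropy \<mu> right_shift - ereal (\<integral>w. ln (\<Psi> w) \<partial>\<mu>) = 0"
    by (simp only: measure_entropy_eq int_eq[OF invariant_prob] ereal_minus) simp
  have le: "measure_entropy \<nu> right_shift - ereal (\<integral>w. ln (\<Psi> w) \<partial>\<nu>) \<le> 0" if "invariant_prob d \<nu>" for \<nu>
    using measure_entropy_upper_bound[OF that] unfolding int_eq[OF that]
    by (simp add: ereal_minus_le)
  have "(SUP \<nu>\<in>{\<nu>. invariant_prob d \<nu>}. measure_entropy \<nu> right_shift - ereal (\<integral>w. ln (\<Psi> w) \<partial>\<nu>)) = 0"
  proof (rule antisym)
    show "(SUP \<nu>\<in>{\<nu>. invariant_prob d \<nu>}. measure_entropy \<nu> right_shift - ereal (\<integral>w. ln (\<Psi> w) \<partial>\<nu>)) \<le> 0"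
      by (rule SUP_least) (simp add: le)
    show "0 \<le> (SUP \<nu>\<in>{\<nu>. invariant_prob d \<nu>}. measure_entropy \<nu> right_shift - ereal (\<integral>w. ln (\<Psi> w) \<partial>\<nu>))"
      using invariant_prob by (intro SUP_upper2[of \<mu>]) (simp_all add: zero)
  qed
  moreover have "AE w in transfer_dual d (\<lambda>_. 1) \<mu>. RN_deriv (transfer_dual d (\<lambda>_. 1) \<mu>) \<mu> w = ennreal (1 / \<Psi> w)"
    using RN_deriv_transfer_dual
  proof (rule AE_mp, intro AE_I2 impI)
    fix w assume "w \<in> space (transfer_dual d (\<lambda>_. 1) \<mu>)"
      and "RN_deriv (transfer_dual d (\<lambda>_. 1) \<mu>) \<mu> w = ennreal (g w)"
    then show "RN_deriv (transfer_dual d (\<lambda>_. 1) \<mu>) \<mu> w = ennreal (1 / \<Psi> w)"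
      by (simp add: transfer_dual_one space \<Psi>)
  qed
  moreover have "dual_gibbs_type d \<Psi> \<mu>" using \<Psi> by (rule dual_gibbs_type)
  moreover have "g_measure d (\<lambda>w. 1 / \<Psi> w) \<mu>" by (rule g_measure) (simp add: \<Psi>)
  moreover have "pressure (dual_space d) seq_dist right_shift (\<lambda>w. - ln (\<Psi> w)) = 0"
    by (rule pressure_eq_0) (simp add: lnPsi)
  ultimately show ?thesis using zero by blast
qed

theorem theorem21:
  fixes d :: nat and \<Psi> :: "(nat \<Rightarrow> nat) \<Rightarrow> real"
  assumes "2 \<le> d" and "\<Psi> \<in> TUS d"
  shows "\<exists>\<mu>. dual_gibbs_type d \<Psi> \<mu> \<and>
    g_measure d (\<lambda>w. 1 / \<Psi> w) \<mu> \<and>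
    pressure (dual_space d) seq_dist right_shift (\<lambda>w. - ln (\<Psi> w)) = 0 \<and>
    (AE w in transfer_dual d (\<lambda>_. 1) \<mu>.
       RN_deriv (transfer_dual d (\<lambda>_. 1) \<mu>) \<mu> w = ennreal (1 / \<Psi> w)) \<and>
    0 = pressure (dual_space d) seq_dist right_shift (\<lambda>w. - ln (\<Psi> w)) \<and>
    pressure (dual_space d) seq_dist right_shift (\<lambda>w. - ln (\<Psi> w)) =
      measure_entropy \<mu> right_shift - ereal (\<integral>w. ln (\<Psi> w) \<partial>\<mu>) \<and>
    measure_entropy \<mu> right_shift - ereal (\<integral>w. ln (\<Psi> w) \<partial>\<mu>) =
      (SUP \<nu>\<in>{\<nu>. invariant_prob d \<nu>}.
         measure_entropy \<nu> right_shift - ereal (\<integral>w. ln (\<Psi> w) \<partial>\<nu>))"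
proof -
  obtain g where g: "continuous_on (dual_space d) g" "\<And>w. w \<in> dual_space d \<Longrightarrow> 0 < g w"
    "\<And>x. x \<in> dual_space d \<Longrightarrow> (\<Sum>i<d. g (cons_seq i x)) = 1"
    and \<Psi>: "\<And>w. w \<in> dual_space d \<Longrightarrow> \<Psi> w = 1 / g w"
    using TUS_normalized[OF assms] by metis
  interpret normalized_potential d g
    by (intro normalized_potential.intro assms g)
  obtain \<mu> where m: "dual_gibbs_type d \<Psi> \<mu>" "g_measure d (\<lambda>w. 1 / \<Psi> w) \<mu>"
    and p: "pressure (dual_space d) seq_dist right_shift (\<lambda>w. - ln (\<Psi> w)) = 0"
    and rn: "AE w in transfer_dual d (\<lambda>_. 1) \<mu>.
       RN_deriv (transfer_dual d (\<lambda>_. 1) \<mu>) \<mu> w = ennreal (1 / \<Psi> w)"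
    and e: "measure_entropy \<mu> right_shift - ereal (\<integral>w. ln (\<Psi> w) \<partial>\<mu>) = 0"
    and s: "(SUP \<nu>\<in>{\<nu>. invariant_prob d \<nu>}.
         measure_entropy \<nu> right_shift - ereal (\<integral>w. ln (\<Psi> w) \<partial>\<nu>)) = 0"
    using equilibrium[OF \<Psi>] by blast
  show ?thesis by (intro exI[of _ \<mu>] conjI m p rn) (simp_all only: p e s)
qed

end
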